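(* Let $(\mathbf u_{\varepsilon,0})_{\varepsilon\in(0,1]}$ be well-prepared initial data and, for each $\varepsilon\in(0,1]$, let $\mathbf u_\varepsilon\colon\mathbb T^d\times(0,\infty)\to\mathbb R^n$ be a solution to the Allen--Cahn system with parameter $\varepsilon$ and initial condition $\mathbf u_{\varepsilon,0}$. Then $$\lim_{\varepsilon\to0}\int_0^T\int_{\mathbb T^d}\Big(\frac\varepsilon2|\nabla\mathbf u_\varepsilon|^2-F_\varepsilon(\mathbf u_\varepsilon)\Big)_+dx\,dt=0\quad\text{for all }T<\infty .$$ In particular, the positive part of the discrepancy measure vanishes in the limit, i.e. $$d\xi^\varepsilon_+=\Big(\frac\varepsilon2|\nabla\mathbf u_\varepsilon|^2-F_\varepsilon(\mathbf u_\varepsilon)\Big)_+dx\,dt\stackrel{\ast}{\rightharpoonup}0\quad\text{as }\varepsilon\to0 .$$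
   Context: Fix positive integers $d,n$ and $\alpha\in(0,1)$. $\mathbb T^d$ is the flat torus ($[0,1)^d$ with periodic boundary conditions); $s_+=\max\{s,0\}$. Let $W(u)=u^2(1-u)^2$, $\phi(u)=\int_0^u\sqrt{2W(s)}\,ds$ for $u\in\mathbb R$, $\sigma=\phi(1)$, and for $\varepsilon\in(0,1]$, $\mathbf u=(u_1,\dots,u_n)\in\mathbb R^n$, $$F_\varepsilon(\mathbf u)=\frac1\varepsilon\sum_{i=1}^nW(u_i)+\frac1{2\varepsilon^\alpha}\Big(\sigma-\sum_{i=1}^n\phi(u_i)\Big)^2,\qquad E_\varepsilon(\mathbf u)=\int_{\mathbb T^d}\Big(\frac\varepsilon2|\nabla\mathbf u|^2+F_\varepsilon(\mathbf u)\Big)dx,$$ where $|\nabla \mathbf u|$ is the Frobenius norm of the Jacobian. Allen--Cahn system with parameter $\varepsilon$ and initial datum $\mathbf u_0$: for $1\le i\le n$, $$\varepsilon\partial_tu_i=\varepsilon\Delta u_i-\frac1\varepsilon W'(u_i)+\frac1{\varepsilon^\alpha}\sqrt{2W(u_i)}\Big(\sigma-\sum_{j=1}^n\phi(u_j)\Big)\ \text{in }\mathbb T^d\times(0,\infty),\qquad u_i(\cdot,0)=u_{0,i}.$$ Well-prepared initial data: a family $(\mathbf u_{\varepsilon,0})_{\varepsilon\in(0,1]}$, $\mathbf u_{\varepsilon,0}=(u_{0,\varepsilon,1},\dots,u_{0,\varepsilon,n})\colon\mathbb T^d\to\mathbb R^n$, such that (i) $0\le u_{0,\varepsilon,i}\le1$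 in $\mathbb T^d$ for all $i$; (ii) $E_0:=\sup_{\varepsilon\in(0,1]}E_\varepsilon(\mathbf u_{\varepsilon,0})<\infty$; (iii) $\sup_{\varepsilon\in(0,1]}\sup_{\mathbb T^d}\varepsilon|\nabla\mathbf u_{\varepsilon,0}|<\infty$; (iv) there is $C<\infty$ such that for all $i$ and all $\varepsilon\in(0,1]$, $\frac\varepsilon2|\nabla u_{0,\varepsilon,i}|^2-\frac1\varepsilon W(u_{0,\varepsilon,i})\le C\varepsilon^{-\frac{1+\alpha}2}$ in $\mathbb T^d$; (v) $D_0:=\sup_{\varepsilon\in(0,1]}\sup_{x\in\mathbb T^d,\,r\in(0,1]}\frac{\omega_0^\varepsilon(B_r(x))}{\varpi_{d-1}r^{d-1}}<\infty$, where $\omega_0^\varepsilon=(\frac\varepsilon2|\nabla\mathbf u_{\varepsilon,0}|^2+F_\varepsilon(\mathbf u_{\varepsilon,0}))\,dx$ and $\varpi_{d-1}$ is the volume of the unit ball of $\mathbb R^{d-1}$. Weak-$\ast$ convergence is that of Radon measures on space-time. *)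

theory Defs
  imports "HOL-Analysis.Analysis"
begin

text \<open>
  Functions on the flat torus are represented by functions on \<^typ>\<open>real ^ 'd\<close> that are periodic
  with respect to the integer lattice; measures on the torus live on the fundamental cell.
  The dimensions are \<open>d = CARD('d)\<close> and \<open>n = CARD('n)\<close>.  Integrals of nonnegative functions are
  taken in \<^typ>\<open>ennreal\<close>, so that they are never silently set to \<open>0\<close>.
\<close>

definition periodic :: "(real ^ 'd \<Rightarrow> 'b) \<Rightarrow> bool" where
  "periodic f \<longleftrightarrow> (\<forall>x k. f (x + axis k 1) = f x)"

definition torus_cell :: "(real ^ 'd) set" where
  "torus_cell = {x. \<forall>k. 0 \<le> x $ k \<and> x $ k < 1}"

definition torus_lborel :: "(real ^ 'd) measure" where
  "torus_lborel = restrict_space lborel torus_cell"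

text \<open>The geodesic ball of the torus (it wraps around for large radii), as a subset of the cell.\<close>

definition torus_ball :: "real ^ 'd \<Rightarrow> real \<Rightarrow> (real ^ 'd) set" where
  "torus_ball x r = {y \<in> torus_cell. \<exists>m. (\<forall>k. m $ k \<in> \<int>) \<and> dist x (y + m) < r}"

definition double_well :: "real \<Rightarrow> real" where
  "double_well s = s\<^sup>2 * (1 - s)\<^sup>2"

definition phi :: "real \<Rightarrow> real" where
  "phi s = (LBINT r=0..s. sqrt (2 * double_well r))"

definition surface_tension :: real where
  "surface_tension = phi 1"

definition F_eps :: "real \<Rightarrow> real \<Rightarrow> real ^ 'n \<Rightarrow> real" where
  "F_eps \<alpha> \<epsilon> v = 1 / \<epsilon> * (\<Sum>i\<in>UNIV. double_well (v $ i))
     + 1 / (2 * \<epsilon> powr \<alpha>) * (surface_tension - (\<Sum>i\<in>UNIV. phi (v $ i)))\<^sup>2"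

text \<open>
  The norm of a matrix of type \<^typ>\<open>real ^ 'd ^ 'n\<close> is the Frobenius norm, and the \<open>i\<close>-th row of
  \<open>jacobian v (at x)\<close> is the gradient of the \<open>i\<close>-th component of \<open>v\<close>.
\<close>

definition energy_density :: "real \<Rightarrow> real \<Rightarrow> (real ^ 'd \<Rightarrow> real ^ 'n) \<Rightarrow> real ^ 'd \<Rightarrow> real" where
  "energy_density \<alpha> \<epsilon> v x = \<epsilon> / 2 * (norm (jacobian v (at x)))\<^sup>2 + F_eps \<alpha> \<epsilon> (v x)"

definition discrepancy :: "real \<Rightarrow> real \<Rightarrow> (real ^ 'd \<Rightarrow> real ^ 'n) \<Rightarrow> real ^ 'd \<Rightarrow> real" where
  "discrepancy \<alpha> \<epsilon> v x = \<epsilon> / 2 * (norm (jacobian v (at x)))\<^sup>2 - F_eps \<alpha> \<epsilon> (v x)"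

definition energy :: "real \<Rightarrow> real \<Rightarrow> (real ^ 'd \<Rightarrow> real ^ 'n) \<Rightarrow> ennreal" where
  "energy \<alpha> \<epsilon> v = (\<integral>\<^sup>+x. ennreal (energy_density \<alpha> \<epsilon> v x) \<partial>torus_lborel)"

definition energy_measure ::
    "real \<Rightarrow> real \<Rightarrow> (real ^ 'd \<Rightarrow> real ^ 'n) \<Rightarrow> (real ^ 'd) measure" where
  "energy_measure \<alpha> \<epsilon> v = density torus_lborel (\<lambda>x. ennreal (energy_density \<alpha> \<epsilon> v x))"

text \<open>
  Differentiability everywhere is what the pointwise gradient conditions presuppose; no continuity
  of the gradient of the initial data is required.
\<close>

definition well_prepared :: "real \<Rightarrow> (real \<Rightarrow> real ^ 'd \<Rightarrow> real ^ 'n) \<Rightarrow> bool" where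
  "well_prepared \<alpha> u0 \<longleftrightarrow>
     (\<forall>\<epsilon>\<in>{0<..1}. periodic (u0 \<epsilon>) \<and> (\<forall>x. u0 \<epsilon> differentiable (at x))) \<and>
     (\<forall>\<epsilon>\<in>{0<..1}. \<forall>x i. 0 \<le> u0 \<epsilon> x $ i \<and> u0 \<epsilon> x $ i \<le> 1) \<and>
     (SUP \<epsilon>\<in>{0<..1}. energy \<alpha> \<epsilon> (u0 \<epsilon>)) < \<infinity> \<and>
     (SUP \<epsilon>\<in>{0<..1}. SUP x. ennreal (\<epsilon> * norm (jacobian (u0 \<epsilon>) (at x)))) < \<infinity> \<and>
     (\<exists>C. \<forall>i. \<forall>\<epsilon>\<in>{0<..1}. \<forall>x.
        \<epsilon> / 2 * (norm (jacobian (u0 \<epsilon>) (at x) $ i))\<^sup>2 - 1 / \<epsilon> * double_well (u0 \<epsilon> x $ i)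
          \<le> C * \<epsilon> powr (- ((1 + \<alpha>) / 2))) \<and>
     (SUP \<epsilon>\<in>{0<..1}. SUP x. SUP r\<in>{0<..1}.
        emeasure (energy_measure \<alpha> \<epsilon> (u0 \<epsilon>)) (torus_ball x r)
          / ennreal (unit_ball_vol (real (CARD('d) - 1)) * r ^ (CARD('d) - 1))) < \<infinity>"

definition partial :: "'d \<Rightarrow> (real ^ 'd \<Rightarrow> real ^ 'n) \<Rightarrow> real ^ 'd \<Rightarrow> real ^ 'n" where
  "partial k f x = frechet_derivative f (at x) (axis k 1)"

definition laplacian :: "(real ^ 'd \<Rightarrow> real ^ 'n) \<Rightarrow> real ^ 'd \<Rightarrow> real ^ 'n" where
  "laplacian f x = (\<Sum>k\<in>UNIV. partial k (partial k f) x)"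

definition dt :: "(real ^ 'd \<Rightarrow> real \<Rightarrow> real ^ 'n) \<Rightarrow> real ^ 'd \<Rightarrow> real \<Rightarrow> real ^ 'n" where
  "dt u x t = vector_derivative (u x) (at t)"

text \<open>Twice continuously differentiable in space and once in time, for positive times.\<close>

definition C21 :: "(real ^ 'd \<Rightarrow> real \<Rightarrow> real ^ 'n) \<Rightarrow> bool" where
  "C21 u \<longleftrightarrow>
     (\<forall>x. \<forall>t>0. u x differentiable (at t) \<and> (\<lambda>y. u y t) differentiable (at x) \<and>
        (\<forall>k. partial k (\<lambda>y. u y t) differentiable (at x))) \<and>
     continuous_on (UNIV \<times> {0<..}) (\<lambda>(x, t). dt u x t) \<and>
     (\<forall>k. continuous_on (UNIV \<times> {0<..}) (\<lambda>(x, t). partial k (\<lambda>y. u y t) x)) \<and>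
     (\<forall>k l. continuous_on (UNIV \<times> {0<..}) (\<lambda>(x, t). partial l (partial k (\<lambda>y. u y t)) x))"

text \<open>Classical solutions, attaining the initial datum continuously.\<close>

definition allen_cahn_solution ::
    "real \<Rightarrow> real \<Rightarrow> (real ^ 'd \<Rightarrow> real ^ 'n) \<Rightarrow> (real ^ 'd \<Rightarrow> real \<Rightarrow> real ^ 'n) \<Rightarrow> bool" where
  "allen_cahn_solution \<alpha> \<epsilon> v0 u \<longleftrightarrow>
     (\<forall>t\<ge>0. periodic (\<lambda>x. u x t)) \<and>
     continuous_on (UNIV \<times> {0..}) (\<lambda>(x, t). u x t) \<and> C21 u \<and>
     (\<forall>x. u x 0 = v0 x) \<and>
     (\<forall>x. \<forall>t>0. \<forall>i.
        \<epsilon> * dt u x t $ i =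
          \<epsilon> * laplacian (\<lambda>y. u y t) x $ i - 1 / \<epsilon> * deriv double_well (u x t $ i)
          + 1 / \<epsilon> powr \<alpha> * sqrt (2 * double_well (u x t $ i)) * (surface_tension - (\<Sum>j\<in>UNIV. phi (u x t $ j))))"

definition spacetime :: "((real ^ 'd) \<times> real) measure" where
  "spacetime = restrict_space lborel (torus_cell \<times> {0<..})"

definition xi_plus ::
    "real \<Rightarrow> real \<Rightarrow> (real ^ 'd \<Rightarrow> real \<Rightarrow> real ^ 'n) \<Rightarrow> ((real ^ 'd) \<times> real) measure" where
  "xi_plus \<alpha> \<epsilon> u =
     density spacetime (\<lambda>(x, t). ennreal (max (discrepancy \<alpha> \<epsilon> (\<lambda>y. u y t) x) 0))"

text \<open>
  Measures on the torus times \<open>[0,\<infinity>)\<close> that do not charge the initial time.  Compact sets are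
  contained in bounded time intervals, so finiteness on these makes such a Borel measure Radon.
\<close>

definition radon_spacetime :: "((real ^ 'd) \<times> real) measure \<Rightarrow> bool" where
  "radon_spacetime M \<longleftrightarrow>
     sets M = sets spacetime \<and> (\<forall>T. emeasure M (torus_cell \<times> {0<..T}) < \<infinity>)"

text \<open>Continuous functions with compact support on the torus times \<open>[0,\<infinity>)\<close>.\<close>

definition test_functions :: "((real ^ 'd) \<times> real \<Rightarrow> real) set" where
  "test_functions = {\<psi>. continuous_on (UNIV \<times> {0..}) \<psi> \<and>
     (\<forall>t\<ge>0. periodic (\<lambda>x. \<psi> (x, t))) \<and> (\<exists>T. \<forall>x. \<forall>t\<ge>T. \<psi> (x, t) = 0)}"

definition weak_star_tendsto ::
    "('a \<Rightarrow> ((real ^ 'd) \<times> real) measure) \<Rightarrow> ((real ^ 'd) \<times> real) measure \<Rightarrow> 'a filter \<Rightarrow> bool" where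
  "weak_star_tendsto \<mu> \<nu> A \<longleftrightarrow>
     (\<forall>\<^sub>F a in A. radon_spacetime (\<mu> a)) \<and> radon_spacetime \<nu> \<and>
     (\<forall>\<psi>\<in>test_functions. ((\<lambda>a. \<integral>z. \<psi> z \<partial>\<mu> a) \<longlongrightarrow> (\<integral>z. \<psi> z \<partial>\<nu>)) A)"

end

theory Submission
  imports Defs
begin

text \<open>
  Write \<open>s = u (1 - u)\<close>, so that \<open>W(u) = s\<^sup>2\<close> and \<open>\<phi>'(u) = \<surd>2 s\<close> on \<open>[0, 1]\<close>, put
  \<open>g = \<sigma> - \<Sum>\<^sub>j \<phi>(u\<^sub>j)\<close> and \<open>\<beta> = \<epsilon>\<^bsup>(1 - \<alpha>)/2\<^esup>\<close>.  The penalty in the potential only lowers the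
  discrepancy, so its positive part is at most the sum over the components of the positive parts of
  \<open>\<epsilon>/2 |\<nabla>u\<^sub>i|\<^sup>2 - W(u\<^sub>i)/\<epsilon>\<close>.  Each of these is controlled by different means away from the wells
  \<open>0\<close> and \<open>1\<close> and near them.

  Away from the wells a pointwise bound suffices.  Let \<open>q(u)\<^sup>2 = 2 (s\<^sup>2 + \<mu> (1 + s))\<close> with
  \<open>\<mu> = M \<beta>\<close>, and let \<open>P\<close> be a primitive of \<open>1/q\<close>.  The gradient condition on the initial data says
  that \<open>\<epsilon> P(u\<^sub>i)\<close> is \<open>1\<close>-Lipschitz at time zero, and it remains so.  Differentiating the equation,
  as in a Bernstein argument, would need third derivatives and the continuity of the gradient at time
  zero.  Instead the maximum principle is applied to
  \<open>\<epsilon> P(u\<^sub>i(x)) - \<epsilon> P(u\<^sub>i(y)) - |x - y|\<close>, for all components at once (\<open>two_point_bound\<close>).  At a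
  positive maximum the two gradients of \<open>\<epsilon> P(u\<^sub>i)\<close> are the same unit vector, so the contributions of
  \<open>W'\<close> cancel.  What remains of the reaction comes from \<open>\<mu> (1 + s)\<close> and, by concavity, has a sign: it
  is a damping of size \<open>2 \<mu>/\<epsilon>\<close> times \<open>P(u\<^sub>i(x)) - P(u\<^sub>i(y))\<close>.  The forcing contributes at most
  \<open>3 n \<epsilon>\<^bsup>-\<alpha>\<^esup>\<close> times the same increment, because maximality over all components bounds the
  increments of all \<open>\<phi>(u\<^sub>j)\<close>.  The damping wins since \<open>\<mu>\<close> is at least of order \<open>\<epsilon>\<^bsup>1 - \<alpha>\<^esup>\<close>.
  Consequently (\<open>gradient_bound\<close>) \<open>\<epsilon>/2 |\<nabla>u\<^sub>i|\<^sup>2 - W(u\<^sub>i)/\<epsilon> \<le> \<mu> (1 + s)/\<epsilon>\<close>, which where \<open>s \<ge> \<delta>\<close>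
  is at most \<open>5/4 \<mu>/\<delta>\<^sup>2\<close> times \<open>W(u\<^sub>i)/\<epsilon>\<close>.

  Near the wells there is little gradient energy.  Multiply the equation by
  \<open>\<eta>(u\<^sub>i)\<close> with \<open>\<eta>(u) = \<delta> (1 - 2 u) s / (\<delta> + s)\<close>.  This function satisfies \<open>\<eta> W' \<ge> 0\<close>, its
  derivative is bounded below by a positive constant near the wells, and the derivative is at least
  \<open>-2 \<delta>\<close> everywhere.  So the gradient energy near the wells is bounded by \<open>\<delta>\<close> times the energy, plus
  the forcing term, which is of size \<open>\<beta>\<close> times the energy, plus \<open>\<epsilon>\<close> times a total time derivative
  (\<open>discrepancy_plus_integral_le\<close>).

  Both steps use the bound of the energy by its initial value.  Solutions are only \<open>C\<^sup>2\<close> in space and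
  \<open>C\<^sup>1\<close> in time, so the Dirichlet energy is differentiated through the symmetric pairing
  \<open>\<integral> u(r) \<sqdot> \<Delta>u(s)\<close> (\<open>energy_dissipation\<close>).  They attain the initial data only uniformly, so that
  the energy does not jump up at time zero needs an argument of its own (\<open>dirichlet_small_time\<close>).

  With \<open>\<delta> = \<mu>\<^bsup>1/3\<^esup>\<close> everything adds up to \<open>\<delta> (17 E\<^sub>0 T + 2)\<close>, which tends to zero with \<open>\<epsilon>\<close>
  (\<open>flow_discrepancy_bound\<close>).
\<close>

section \<open>The double well and the primitive \<phi>\<close>

lemma double_well_eq: "double_well s = (s * (1 - s))\<^sup>2"
  by (simp add: double_well_def power_mult_distrib)

lemma double_well_has_derivative [derivative_intros]:
  "(double_well has_real_derivative 2 * (s * (1 - s)) * (1 - 2 * s)) (at s within A)"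
    unfolding double_well_def [abs_def]
    by (auto intro!: derivative_eq_intros simp: algebra_simps power2_eq_square)

lemma deriv_double_well: "deriv double_well s = 2 * (s * (1 - s)) * (1 - 2 * s)"
  by (rule DERIV_imp_deriv[OF double_well_has_derivative])

lemma sqrt_double_well: "sqrt (2 * double_well s) = sqrt 2 * \<bar>s * (1 - s)\<bar>"
  by (simp add: double_well_eq real_sqrt_mult)

lemma phi_has_derivative: "(phi has_real_derivative sqrt 2 * \<bar>s * (1 - s)\<bar>) (at s)"
proof -
  define c where "c = min 0 s - 1"
  define d where "d = max 0 s + 1"
  define f where "f = (\<lambda>r. sqrt (2 * double_well r))"
  have cf: "continuous_on A f" for A
    unfolding f_def double_well_def [abs_def] by (intro continuous_intros)
  have eq: "phi y = integral {c..y} f - integral {c..0} f" if y: "c \<le> y" "y \<le> d" for y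
  proof (cases "0 \<le> y")
    case True
    have "phi y = integral {0..y} f"
      unfolding phi_def f_def[symmetric] using True
      apply (subst zero_ereal_def)
      apply (subst interval_integral_eq_integral)
      by (auto intro!: borel_integrable_atLeastAtMost' cf)
    moreover have "integral {c..0} f + integral {0..y} f = integral {c..y} f"
      using True by (intro Henstock_Kurzweil_Integration.integral_combine integrable_continuous_real cf) (auto simp: c_def)
    ultimately show ?thesis by simp
  next
    case False
    have "phi y = - integral {y..0} f"
      unfolding phi_def f_def[symmetric] using False
      apply (subst interval_integral_endpoints_reverse)
      apply (subst zero_ereal_def)
      apply (subst interval_integral_eq_integral)
      by (auto intro!: borel_integrable_atLeastAtMost' cf)
    moreover have "integral {c..y} f + integral {y..0} f = integral {c..0} f"
      using False y by (intro Henstock_Kurzweil_Integration.integral_combine integrable_continuous_real cf) auto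
    ultimately show ?thesis by simp
  qed
  have "((\<lambda>y. integral {c..y} f) has_real_derivative f s) (at s within {c..d})"
    by (rule integral_has_real_derivative[OF cf]) (auto simp: c_def d_def)
  then have "((\<lambda>y. integral {c..y} f - integral {c..0} f) has_real_derivative f s) (at s within {c..d})"
    by (auto intro!: derivative_eq_intros)
  then have "((\<lambda>y. integral {c..y} f - integral {c..0} f) has_real_derivative f s) (at s)"
    by (subst (asm) at_within_interior) (auto simp: c_def d_def)
  moreover have "eventually (\<lambda>y. integral {c..y} f - integral {c..0} f = phi y) (nhds s)"
  proof -
    have "eventually (\<lambda>y. y \<in> {c<..<d}) (nhds s)"
      by (intro eventually_nhds_in_open) (auto simp: c_def d_def)
    then show ?thesis by eventually_elim (use eq in auto)
  qed
  ultimately have "(phi has_real_derivative f s) (at s)"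
    by (subst (asm) DERIV_cong_ev[OF refl _ refl])
  then show ?thesis by (simp add: f_def sqrt_double_well)
qed

lemma continuous_on_phi [continuous_intros]:
  "continuous_on A f \<Longrightarrow> continuous_on A (\<lambda>x. phi (f x))"
  using continuous_on_compose2[of UNIV phi A f] phi_has_derivative
  by (metis DERIV_isCont continuous_at_imp_continuous_on subset_UNIV UNIV_I)

lemma continuous_on_double_well [continuous_intros]:
  "continuous_on A f \<Longrightarrow> continuous_on A (\<lambda>x. double_well (f x))"
  unfolding double_well_def by (intro continuous_intros)

lemma well_factor_bounds:
  assumes "0 \<le> u" "u \<le> (1::real)"
  shows "0 \<le> u * (1 - u)" "u * (1 - u) \<le> 1/4"
proof -
  show "0 \<le> u * (1 - u)" using assms by simp
  have "0 \<le> (u - 1/2)\<^sup>2" by simp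
  then show "u * (1 - u) \<le> 1/4" by (simp add: power2_eq_square algebra_simps)
qed

lemma phi_bounds:
  assumes "0 \<le> s" "s \<le> 1"
  shows "0 \<le> phi s" "phi s \<le> 1"
proof -
  have p0: "phi 0 = 0" by (simp add: phi_def zero_ereal_def[symmetric])
  have "phi 0 \<le> phi s"
    using assms by (intro DERIV_nonneg_imp_nondecreasing[of 0 s phi]) (auto intro!: exI phi_has_derivative)
  then show "0 \<le> phi s" using p0 by simp
  have "phi s - s \<le> phi 0 - 0"
  proof (rule DERIV_nonpos_imp_nonincreasing[of 0 s "\<lambda>s. phi s - s"], fact)
    fix x assume x: "0 \<le> x" "x \<le> s"
    have "sqrt 2 * \<bar>x * (1 - x)\<bar> \<le> 1"
    proof -
      have "\<bar>x * (1 - x)\<bar> \<le> 1/4" using well_factor_bounds[of x] x assms by (simp add: abs_le_iff)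
      moreover have "sqrt 2 \<le> 2" using real_sqrt_le_mono[of 2 4] by simp
      ultimately have "sqrt 2 * \<bar>x * (1 - x)\<bar> \<le> 2 * (1/4)" by (intro mult_mono) auto
      then show ?thesis by simp
    qed
    then show "\<exists>y. ((\<lambda>s. phi s - s) has_real_derivative y) (at x) \<and> y \<le> 0"
      by (intro exI[of _ "sqrt 2 * \<bar>x * (1 - x)\<bar> - 1"]) (auto intro!: derivative_eq_intros phi_has_derivative)
  qed
  then show "phi s \<le> 1" using p0 assms by simp
qed

section \<open>The steepened transition profile\<close>

text \<open>
  The largest slope, in units of \<open>1/\<epsilon>\<close>, that a component with value \<open>u\<close> will be allowed to have.
  For \<open>\<mu> = 0\<close> it is \<open>sqrt (2 W)\<close>, the slope of the optimal profile.  The correction \<open>1 + u (1 - u)\<close>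
  is concave and its derivative has the sign of \<open>W'\<close>; both properties are needed for the damping.
\<close>
definition steepness :: "real \<Rightarrow> real \<Rightarrow> real" where
  "steepness \<mu> u = sqrt (2 * ((u * (1 - u))\<^sup>2 + \<mu> * (1 + u * (1 - u))))"

lemma steepness_arg_pos:
  fixes \<mu> u :: real
  assumes "0 < \<mu>" "-1/2 < u" "u < 3/2"
  shows "0 < (u * (1 - u))\<^sup>2 + \<mu> * (1 + u * (1 - u))"
proof -
  have "(u - 1/2)\<^sup>2 < 1\<^sup>2" by (rule power2_strict_mono) (use assms in auto)
  then have "0 < 1 + u * (1 - u)" by (simp add: power2_eq_square algebra_simps)
  then have "0 < \<mu> * (1 + u * (1 - u))" using assms by (intro mult_pos_pos) auto
  then show ?thesis by (intro add_nonneg_pos) simp_all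
qed

lemma steepness_pos: "0 < \<mu> \<Longrightarrow> -1/2 < u \<Longrightarrow> u < 3/2 \<Longrightarrow> 0 < steepness \<mu> u"
  unfolding steepness_def by (intro real_sqrt_gt_zero mult_pos_pos steepness_arg_pos) simp_all

lemma steepness_sq:
  assumes "0 < \<mu>" "-1/2 < u" "u < 3/2"
  shows "(steepness \<mu> u)\<^sup>2 = 2 * ((u * (1 - u))\<^sup>2 + \<mu> * (1 + u * (1 - u)))"
  unfolding steepness_def by (intro real_sqrt_pow2 mult_nonneg_nonneg less_imp_le[OF steepness_arg_pos[OF assms]]) simp

lemma steepness_has_derivative:
  assumes "0 < \<mu>" "-1/2 < u" "u < 3/2"
  shows "(steepness \<mu> has_real_derivative (1 - 2 * u) * (2 * (u * (1 - u)) + \<mu>) / steepness \<mu> u) (at u)"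
proof -
  let ?A = "\<lambda>u. 2 * ((u * (1 - u))\<^sup>2 + \<mu> * (1 + u * (1 - u)))"
  have pos: "0 < ?A u" using steepness_arg_pos[OF assms] by (intro mult_pos_pos) simp_all
  have "(?A has_real_derivative 2 * ((1 - 2 * u) * (2 * (u * (1 - u)) + \<mu>))) (at u)"
    by (auto intro!: derivative_eq_intros simp: algebra_simps power2_eq_square)
  then have D: "((\<lambda>u. sqrt (?A u)) has_real_derivative
      (inverse (sqrt (?A u)) / 2) * (2 * ((1 - 2 * u) * (2 * (u * (1 - u)) + \<mu>)))) (at u)"
    by (rule DERIV_chain2[where f = sqrt, rotated]) (rule DERIV_real_sqrt[OF pos])
  have e: "inverse r / 2 * (2 * b) = b / r" for r b :: real by (simp add: field_simps)
  show ?thesis using D unfolding steepness_def [abs_def] e .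
qed

text \<open>
  The primitive is needed on a neighbourhood of \<open>[0, 1]\<close>, so that it is differentiable at the wells.
\<close>
lemma steepness_antiderivative:
  assumes "0 < \<mu>"
  obtains P where "\<And>u. -1/2 < u \<Longrightarrow> u < 3/2 \<Longrightarrow> (P has_real_derivative 1 / steepness \<mu> u) (at u)"
proof -
  have cont: "continuous_on {-1/2<..<3/2} (\<lambda>u. 1 / steepness \<mu> u)"
    using steepness_pos[OF assms] steepness_has_derivative[OF assms]
    by (intro continuous_intros continuous_at_imp_continuous_on ballI)
       (force intro: DERIV_isCont, force)
  define P where "P = (\<lambda>u::real. LBINT y=ereal (1/2)..ereal u. 1 / steepness \<mu> y)"
  have "(P has_real_derivative 1 / steepness \<mu> u) (at u)" if u: "-1/2 < u" "u < 3/2" for u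
  proof -
    define a where "a = (min (1/2) u - 1/2) / 2" 
    define b where "b = (max (1/2) u + 3/2) / 2" 
    have ab: "-1/2 < a" "a < 1/2" "1/2 < b" "b < 3/2" "a < u" "u < b" using u by (auto simp: a_def b_def)
    have "(P has_vector_derivative 1 / steepness \<mu> u) (at u within {a..b})"
      unfolding P_def
      by (rule interval_integral_FTC2[of a "1/2" b]) (use ab in \<open>auto intro!: continuous_on_subset[OF cont]\<close>)
    then have "(P has_real_derivative 1 / steepness \<mu> u) (at u within {a..b})"
      by (simp only: has_real_derivative_iff_has_vector_derivative)
    moreover have "at u within {a..b} = at u" using ab by (intro at_within_interior) simp
    ultimately show ?thesis by simp
  qed
  then show ?thesis using that by blast
qed

lemma increment_le_of_deriv_le:
  fixes f h :: "real \<Rightarrow> real"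
  assumes "v \<le> u"
    and f: "\<And>x. v \<le> x \<Longrightarrow> x \<le> u \<Longrightarrow> (f has_real_derivative f' x) (at x)"
    and h: "\<And>x. v \<le> x \<Longrightarrow> x \<le> u \<Longrightarrow> (h has_real_derivative h' x) (at x)"
    and le: "\<And>x. v \<le> x \<Longrightarrow> x \<le> u \<Longrightarrow> f' x \<le> h' x"
  shows "f u - f v \<le> h u - h v"
proof -
  have "f u - h u \<le> f v - h v"
    by (rule DERIV_nonpos_imp_nonincreasing[of v u "\<lambda>x. f x - h x"])
       (use assms(1) in \<open>auto intro!: exI derivative_eq_intros f h le[unfolded diff_le_0_iff_le] simp: le\<close>)
  then show ?thesis by simp
qed

text \<open>
  Three quantities in the equation for \<open>P(u)\<close> are compared with increments of \<open>P\<close> itself: the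
  remainder of the reaction, the factor in front of the forcing, and \<open>\<phi>\<close>.
\<close>
context
  fixes \<mu> :: real and P :: "real \<Rightarrow> real" and u v :: real
  assumes mu: "0 < \<mu>" "\<mu> \<le> 1"
    and P: "\<And>u. -1/2 < u \<Longrightarrow> u < 3/2 \<Longrightarrow> (P has_real_derivative 1 / steepness \<mu> u) (at u)"
    and uv: "0 \<le> v" "v \<le> u" "u \<le> 1"
begin

lemma profile_mono: "P v \<le> P u"
  using increment_le_of_deriv_le[of v u "\<lambda>_. 0" "\<lambda>_. 0" P "\<lambda>u. 1 / steepness \<mu> u"] uv P mu steepness_pos[of \<mu>]
  by (force intro: less_imp_le)

text \<open>
  The term \<open>(1 - 2 u)/q\<close> is what is left of the reaction after \<open>W'\<close> has cancelled.  Its numerator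
  decreases with slope \<open>-2\<close>, and \<open>q\<close> grows where the numerator is positive and shrinks where it is
  negative, so the quotient decreases with slope at most \<open>-2/q\<close>, that is, at least twice as fast as
  \<open>P\<close> grows.
\<close>
lemma damping_increment:
  "(1 - 2 * u) / steepness \<mu> u - (1 - 2 * v) / steepness \<mu> v \<le> - 2 * (P u - P v)"
proof -
  have "(1 - 2 * u) / steepness \<mu> u - (1 - 2 * v) / steepness \<mu> v \<le> - 2 * P u - (- 2 * P v)"
  proof (rule increment_le_of_deriv_le[where f="\<lambda>u. (1 - 2 * u) / steepness \<mu> u" and h="\<lambda>u. - 2 * P u"
      and h'="\<lambda>x. - 2 * (1 / steepness \<mu> x)" and
      f'="\<lambda>x. (- 2 * steepness \<mu> x - (1 - 2 * x) * ((1 - 2 * x) * (2 * (x * (1 - x)) + \<mu>) / steepness \<mu> x)) / (steepness \<mu> x * steepness \<mu> x)"])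
    fix x assume x: "v \<le> x" "x \<le> u"
    then have x': "-1/2 < x" "x < 3/2" "0 \<le> x" "x \<le> 1" using uv by auto
    note q = steepness_pos[OF mu(1) x'(1,2)]
    show "((\<lambda>u. (1 - 2 * u) / steepness \<mu> u) has_real_derivative
          (- 2 * steepness \<mu> x - (1 - 2 * x) * ((1 - 2 * x) * (2 * (x * (1 - x)) + \<mu>) / steepness \<mu> x)) / (steepness \<mu> x * steepness \<mu> x)) (at x)"
      using q by (auto intro!: derivative_eq_intros steepness_has_derivative[OF mu(1) x'(1,2)])
    show "((\<lambda>u. - 2 * P u) has_real_derivative - 2 * (1 / steepness \<mu> x)) (at x)"
      by (rule DERIV_cmult[OF P[OF x'(1,2)]])
    have "0 \<le> (1 - 2 * x) * ((1 - 2 * x) * (2 * (x * (1 - x)) + \<mu>) / steepness \<mu> x)"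
    proof -
      have "(1 - 2 * x) * ((1 - 2 * x) * (2 * (x * (1 - x)) + \<mu>) / steepness \<mu> x)
          = (1 - 2 * x)\<^sup>2 * ((2 * (x * (1 - x)) + \<mu>) / steepness \<mu> x)" by (simp add: power2_eq_square)
      also have "\<dots> \<ge> 0" using q mu x' by (intro mult_nonneg_nonneg divide_nonneg_pos) auto
      finally show ?thesis .
    qed
    then have "(- 2 * steepness \<mu> x - (1 - 2 * x) * ((1 - 2 * x) * (2 * (x * (1 - x)) + \<mu>) / steepness \<mu> x)) / (steepness \<mu> x * steepness \<mu> x)
      \<le> (- 2 * steepness \<mu> x) / (steepness \<mu> x * steepness \<mu> x)"
      using q by (intro divide_right_mono) auto
    also have "\<dots> = - 2 * (1 / steepness \<mu> x)" using q by simp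
    finally show "(- 2 * steepness \<mu> x - (1 - 2 * x) * ((1 - 2 * x) * (2 * (x * (1 - x)) + \<mu>) / steepness \<mu> x)) / (steepness \<mu> x * steepness \<mu> x) \<le> - 2 * (1 / steepness \<mu> x)" .
  qed (use uv in auto)
  then show ?thesis by simp
qed

text \<open>
  In the equation for \<open>P(u)\<close> the forcing carries the factor \<open>sqrt (2 W)/q\<close>.  This factor varies
  quickly near the wells if \<open>\<mu>\<close> is small, but measured with \<open>P\<close> its slope is bounded uniformly in
  \<open>\<mu>\<close>.
\<close>
lemma forcing_weight_increment:
  "\<bar>sqrt 2 * (u * (1 - u)) / steepness \<mu> u - sqrt 2 * (v * (1 - v)) / steepness \<mu> v\<bar> \<le> sqrt 2 * (P u - P v)"
proof -
  let ?b = "\<lambda>u. sqrt 2 * (u * (1 - u)) / steepness \<mu> u"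
  let ?b' = "\<lambda>x. sqrt 2 * ((1 - 2 * x) * (\<mu> * (2 + x * (1 - x)))) / steepness \<mu> x ^ 3"
  have der: "(?b has_real_derivative ?b' x) (at x)" and bd: "\<bar>?b' x\<bar> \<le> sqrt 2 * (1 / steepness \<mu> x)"
    if x: "v \<le> x" "x \<le> u" for x
  proof -
    have x': "-1/2 < x" "x < 3/2" "0 \<le> x" "x \<le> 1" using uv x by auto
    note q = steepness_pos[OF mu(1) x'(1,2)]
    note q2 = steepness_sq[OF mu(1) x'(1,2)]
    let ?q = "steepness \<mu> x" and ?s = "x * (1 - x)"
    have "(?b has_real_derivative (sqrt 2 * (1 - 2 * x) * ?q - sqrt 2 * ?s * ((1 - 2 * x) * (2 * ?s + \<mu>) / ?q)) / (?q * ?q)) (at x)"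
      using q by (auto intro!: derivative_eq_intros steepness_has_derivative[OF mu(1) x'(1,2)] simp: algebra_simps)
    also have "(sqrt 2 * (1 - 2 * x) * ?q - sqrt 2 * ?s * ((1 - 2 * x) * (2 * ?s + \<mu>) / ?q)) / (?q * ?q)
       = sqrt 2 * (1 - 2 * x) * (?q\<^sup>2 - ?s * (2 * ?s + \<mu>)) / ?q ^ 3"
      using q by (simp add: field_simps power2_eq_square power3_eq_cube)
    also have "?q\<^sup>2 - ?s * (2 * ?s + \<mu>) = \<mu> * (2 + ?s)" unfolding q2 by (simp add: algebra_simps power2_eq_square)
    finally show "(?b has_real_derivative ?b' x) (at x)" by (simp add: mult.assoc)
    note s = well_factor_bounds[OF x'(3,4)]
    have "\<bar>(1 - 2 * x) * (\<mu> * (2 + ?s))\<bar> \<le> 1 * (\<mu> * (2 + ?s))"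
      unfolding abs_mult using x' s mu by (intro mult_mono) auto
    also have "1 * (\<mu> * (2 + r)) \<le> 2 * (r\<^sup>2 + \<mu> * (1 + r))" if "0 \<le> r" for r
      using that mu by (simp add: algebra_simps)
    from this[OF s(1)] have "1 * (\<mu> * (2 + ?s)) \<le> ?q\<^sup>2" unfolding q2 .
    finally have "\<bar>(1 - 2 * x) * (\<mu> * (2 + ?s))\<bar> \<le> ?q\<^sup>2" .
    then have "sqrt 2 * \<bar>(1 - 2 * x) * (\<mu> * (2 + ?s))\<bar> / ?q ^ 3 \<le> sqrt 2 * ?q\<^sup>2 / ?q ^ 3"
      using q by (intro divide_right_mono mult_left_mono) auto
    also have "\<dots> = sqrt 2 * (1 / ?q)" using q by (simp add: field_simps power2_eq_square power3_eq_cube)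
    finally show "\<bar>?b' x\<bar> \<le> sqrt 2 * (1 / ?q)" using q by (simp add: abs_mult)
  qed
  have dP: "((\<lambda>x. sqrt 2 * P x) has_real_derivative sqrt 2 * (1 / steepness \<mu> x)) (at x)" if "v \<le> x" "x \<le> u" for x
    by (rule DERIV_cmult[OF P]) (use that uv in auto)
  have "?b u - ?b v \<le> sqrt 2 * P u - sqrt 2 * P v"
    by (rule increment_le_of_deriv_le[OF uv(2) der dP abs_le_D1[OF bd]])
  moreover have "- ?b u - (- ?b v) \<le> sqrt 2 * P u - sqrt 2 * P v"
    by (rule increment_le_of_deriv_le[OF uv(2) DERIV_minus[OF der] dP abs_le_D2[OF bd]])
  ultimately show ?thesis by (simp add: algebra_simps abs_le_iff)
qed

lemma phi_increment: "\<bar>phi u - phi v\<bar> \<le> P u - P v"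
proof -
  have mono: "phi v \<le> phi u"
    by (rule DERIV_nonneg_imp_nondecreasing[OF uv(2)]) (meson phi_has_derivative mult_nonneg_nonneg real_sqrt_ge_zero abs_ge_zero zero_le_numeral)
  have "phi u - phi v \<le> P u - P v"
  proof (rule increment_le_of_deriv_le[OF uv(2) phi_has_derivative P])
    fix x assume x: "v \<le> x" "x \<le> u"
    then have x': "-1/2 < x" "x < 3/2" "0 \<le> x" "x \<le> 1" using uv by auto
    note q = steepness_pos[OF mu(1) x'(1,2)]
    note q2 = steepness_sq[OF mu(1) x'(1,2)]
    note s = well_factor_bounds[OF x'(3,4)]
    let ?q = "steepness \<mu> x" and ?s = "x * (1 - x)"
    have "?s\<^sup>2 \<le> (1/4)\<^sup>2" using s by (intro power_mono) auto
    moreover have "\<mu> * (1 + ?s) \<le> 1 * (5/4)" using mu s by (intro mult_mono) auto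
    ultimately have "?q\<^sup>2 \<le> 2\<^sup>2" unfolding q2 by (auto simp: power2_eq_square)
    then have "?q \<le> 2" by (rule power2_le_imp_le) auto
    moreover have "sqrt 2 \<le> 2" using real_sqrt_le_mono[of 2 4] by simp
    ultimately have "sqrt 2 * ?s * ?q \<le> 2 * (1/4) * 2" using s q by (intro mult_mono) auto
    then show "sqrt 2 * \<bar>?s\<bar> \<le> 1 / ?q" using q s by (simp add: field_simps)
  qed (use uv in auto)
  with mono show ?thesis by simp
qed

end

lemma forcing_weight_le_1:
  assumes "0 < \<mu>" "0 \<le> u" "u \<le> 1"
  shows "\<bar>sqrt 2 * (u * (1 - u)) / steepness \<mu> u\<bar> \<le> 1"
proof -
  have u': "-1/2 < u" "u < 3/2" using assms by auto
  note s = well_factor_bounds[OF assms(2,3)]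
  have "sqrt 2 * (u * (1 - u)) = sqrt (2 * (u * (1 - u))\<^sup>2)" using s by (simp add: real_sqrt_mult)
  also have "\<dots> \<le> steepness \<mu> u" unfolding steepness_def using s assms by simp
  finally show ?thesis using s steepness_pos[OF assms(1) u'] by simp
qed

section \<open>Maximum principles\<close>

text \<open>
  Consider the maximum of \<open>exp (- (K + 1) t) w\<^sub>i(z, t)\<close> over all \<open>i\<close>, \<open>z\<close> and \<open>t\<close>.  If it were
  positive, it would be attained at a positive time, where the assumed bound on the time derivative
  makes the function strictly decreasing in time, a contradiction.  Several functions are treated
  together because the bound for one of them may use that none of the others is larger.
\<close>
lemma comparison_principle:
  fixes w :: "'i \<Rightarrow> 'a::topological_space \<Rightarrow> real \<Rightarrow> real"
  assumes "finite I" "compact S"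
    and cont: "\<And>i. i \<in> I \<Longrightarrow> continuous_on (S \<times> {0..T}) (\<lambda>(z, t). w i z t)"
    and init: "\<And>i z. i \<in> I \<Longrightarrow> z \<in> S \<Longrightarrow> w i z 0 \<le> 0"
    and at_max: "\<And>i z t. i \<in> I \<Longrightarrow> z \<in> S \<Longrightarrow> 0 < t \<Longrightarrow> t \<le> T \<Longrightarrow> 0 < w i z t \<Longrightarrow>
      (\<And>j y. j \<in> I \<Longrightarrow> y \<in> S \<Longrightarrow> w j y t \<le> w i z t) \<Longrightarrow>
      \<exists>D. (w i z has_real_derivative D) (at t) \<and> D \<le> K * w i z t"
    and "i \<in> I" "z \<in> S" "0 \<le> t" "t \<le> T"
  shows "w i z t \<le> 0"
proof (rule ccontr)
  assume neg: "\<not> w i z t \<le> 0"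
  define v where "v = (\<lambda>j p. exp (- (K + 1) * snd p) * w j (fst p) (snd p))"
  let ?C = "S \<times> {0..T}"
  have "compact ?C" "?C \<noteq> {}" using assms by (auto intro!: compact_Times)
  moreover have "continuous_on ?C (v j)" if "j \<in> I" for j
    using cont[OF that] unfolding v_def by (auto intro!: continuous_intros simp: case_prod_unfold)
  ultimately have "\<exists>p\<in>?C. \<forall>q\<in>?C. v j q \<le> v j p" if "j \<in> I" for j
    using continuous_attains_sup that by blast
  then obtain p where p: "\<And>j. j \<in> I \<Longrightarrow> p j \<in> ?C" "\<And>j q. j \<in> I \<Longrightarrow> q \<in> ?C \<Longrightarrow> v j q \<le> v j (p j)"
    by metis
  define m where "m = Max ((\<lambda>j. v j (p j)) ` I)"
  have "m \<in> (\<lambda>j. v j (p j)) ` I" unfolding m_def using assms by (intro Max_in) auto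
  then obtain j where j: "j \<in> I" "v j (p j) = m" by auto
  have le: "v k q \<le> v j (p j)" if "k \<in> I" "q \<in> ?C" for k q
  proof -
    have "v k (p k) \<le> m" unfolding m_def using assms(1) that by (intro Max_ge) auto
    then show ?thesis using p(2)[OF that] j by simp
  qed
  obtain z0 t0 where zt: "p j = (z0, t0)" by force
  have zt': "z0 \<in> S" "0 \<le> t0" "t0 \<le> T" using p(1)[OF j(1)] zt by auto
  have "0 < v i (z, t)" using neg by (simp add: v_def)
  also have "\<dots> \<le> v j (z0, t0)" using le[of i "(z, t)"] assms zt by auto
  finally have pos: "0 < w j z0 t0" by (simp add: v_def zero_less_mult_iff)
  then have "t0 \<noteq> 0" using init[OF j(1) zt'(1)] by auto
  then have t0: "0 < t0" using zt' by simp
  have "w k y t0 \<le> w j z0 t0" if "k \<in> I" "y \<in> S" for k y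
    using le[of k "(y, t0)"] that zt zt' by (simp add: v_def)
  then obtain D where D: "(w j z0 has_real_derivative D) (at t0)" "D \<le> K * w j z0 t0"
    using at_max[OF j(1) zt'(1) t0 zt'(3) pos] by blast
  have "((\<lambda>s. exp (- (K + 1) * s) * w j z0 s) has_real_derivative
      exp (- (K + 1) * t0) * (D - (K + 1) * w j z0 t0)) (at t0)"
    by (rule derivative_eq_intros D refl | simp)+ (simp add: algebra_simps)
  moreover have "exp (- (K + 1) * t0) * (D - (K + 1) * w j z0 t0) < 0"
    using D(2) pos by (intro mult_pos_neg) (auto simp: algebra_simps)
  ultimately obtain d where d: "0 < d"
    "\<And>h. 0 < h \<Longrightarrow> h < d \<Longrightarrow> exp (- (K + 1) * t0) * w j z0 t0 < exp (- (K + 1) * (t0 - h)) * w j z0 (t0 - h)"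
    using DERIV_neg_dec_left by blast
  define h where "h = min (d / 2) t0"
  have h: "0 < h" "h < d" "h \<le> t0" using d t0 by (auto simp: h_def)
  have "v j (z0, t0 - h) \<le> v j (z0, t0)" using le[of j "(z0, t0 - h)"] j zt zt' h by auto
  with d(2)[OF h(1,2)] show False by (simp add: v_def)
qed

lemma derivative_test_at_max:
  fixes f :: "real \<Rightarrow> real"
  assumes f: "\<And>s. (f has_real_derivative f' s) (at s)"
    and f': "(f' has_real_derivative f'') (at 0)"
    and max: "\<And>s. f s \<le> f 0"
  shows "f' 0 = 0" "f'' \<le> 0"
proof -
  show 0: "f' 0 = 0" by (rule DERIV_local_max[OF f zero_less_one]) (use max in auto)
  show "f'' \<le> 0"
  proof (rule ccontr)
    assume "\<not> f'' \<le> 0"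
    then obtain d where d: "0 < d" "\<And>h. 0 < h \<Longrightarrow> h < d \<Longrightarrow> f' 0 < f' (0 + h)"
      using DERIV_pos_inc_right[OF f'] by force
    obtain z where z: "0 < z" "z < d / 2" "f (d/2) - f 0 = (d/2 - 0) * f' z"
      using MVT2[of 0 "d/2" f f'] f d by auto
    have "0 < (d/2 - 0) * f' z" using d z 0 d(2)[of z] by (intro mult_pos_pos) auto
    then show False using z max[of "d/2"] by linarith
  qed
qed

section \<open>Periodic functions and their integrals over a cell\<close>

text \<open>
  Directional differentiability at every point.  For initial data and products with them the partial
  derivatives need not be continuous, so the derivative is an arbitrary function.
\<close>
definition has_partial :: "'d \<Rightarrow> (real ^ 'd \<Rightarrow> real) \<Rightarrow> (real ^ 'd \<Rightarrow> real) \<Rightarrow> bool" where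
  "has_partial k f f' \<longleftrightarrow>
     (\<forall>x. ((\<lambda>s. f (x + s *\<^sub>R axis k 1)) has_real_derivative f' x) (at 0))"

lemma has_partialD:
  assumes "has_partial k f f'"
  shows "((\<lambda>s. f (x + s *\<^sub>R axis k 1)) has_real_derivative f' (x + s *\<^sub>R axis k 1)) (at s)"
proof -
  have "((\<lambda>r. f ((x + s *\<^sub>R axis k 1) + r *\<^sub>R axis k 1)) has_real_derivative f' (x + s *\<^sub>R axis k 1)) (at 0)"
    using assms by (simp add: has_partial_def)
  then have "((\<lambda>r. (\<lambda>r. f (x + r *\<^sub>R axis k 1)) (r + s)) has_real_derivative f' (x + s *\<^sub>R axis k 1)) (at 0)"
    by (simp add: algebra_simps)
  then show ?thesis using DERIV_shift[where z = s and x = 0 and f = "\<lambda>r. f (x + r *\<^sub>R axis k 1)"] by simp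
qed

lemma has_partial_mult:
  assumes "has_partial k f f'" "has_partial k g g'"
  shows "has_partial k (\<lambda>x. f x * g x) (\<lambda>x. f' x * g x + f x * g' x)"
  using assms unfolding has_partial_def by (auto intro!: derivative_eq_intros)

lemma has_partial_diff:
  assumes "has_partial k f f'" "has_partial k g g'"
  shows "has_partial k (\<lambda>x. f x - g x) (\<lambda>x. f' x - g' x)"
  using assms unfolding has_partial_def by (auto intro!: derivative_eq_intros)

lemma has_partial_compose:
  assumes "has_partial k f f'" "\<And>x. (h has_real_derivative h' (f x)) (at (f x))"
  shows "has_partial k (\<lambda>x. h (f x)) (\<lambda>x. h' (f x) * f' x)"
  unfolding has_partial_def
proof
  fix x
  have "((\<lambda>s. f (x + s *\<^sub>R axis k 1)) has_real_derivative f' x) (at 0)"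
    using assms(1) by (simp add: has_partial_def)
  then show "((\<lambda>s. h (f (x + s *\<^sub>R axis k 1))) has_real_derivative h' (f x) * f' x) (at 0)"
    by (rule DERIV_chain2[where f = h, rotated]) (use assms(2) in simp)
qed

lemma periodic_partial:
  assumes "has_partial k f f'" "periodic f"
  shows "periodic f'"
  unfolding periodic_def
proof (intro allI)
  fix x j
  have "((\<lambda>s. f (x + axis j 1 + s *\<^sub>R axis k 1)) has_real_derivative f' (x + axis j 1)) (at 0)"
    using assms(1) unfolding has_partial_def by blast
  also have "(\<lambda>s. f (x + axis j 1 + s *\<^sub>R axis k 1)) = (\<lambda>s. f (x + s *\<^sub>R axis k 1))"
    using assms(2) unfolding periodic_def by (metis add.commute add.left_commute)
  finally show "f' (x + axis j 1) = f' x"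
    using assms(1) unfolding has_partial_def by (metis DERIV_unique)
qed

lemma periodic_integer_shift:
  fixes m :: "real ^ 'd"
  assumes "periodic f" "\<And>k. m $ k \<in> \<int>"
  shows "f (x + m) = f x"
proof -
  have one: "f (x + of_int z *\<^sub>R axis k 1) = f x" for x k z
  proof (induction z rule: int_induct[where k = 0])
    case (step1 i)
    have "f (x + of_int (i + 1) *\<^sub>R axis k 1) = f ((x + of_int i *\<^sub>R axis k 1) + axis k 1)"
      by (simp add: algebra_simps)
    then show ?case using step1 assms(1) by (simp add: periodic_def)
  next
    case (step2 i)
    have "f (x + of_int i *\<^sub>R axis k 1) = f ((x + of_int (i - 1) *\<^sub>R axis k 1) + axis k 1)"
      by (simp add: algebra_simps)
    then show ?case using step2 assms(1) by (simp add: periodic_def)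
  qed simp
  have "f (x + (\<Sum>k\<in>A. (m $ k) *\<^sub>R axis k 1)) = f x" if "finite A" for A
    using that
  proof (induction A)
    case (insert k A)
    obtain z where z: "m $ k = of_int z" using assms(2)[of k] by (auto elim: Ints_cases)
    have "f (x + (\<Sum>k\<in>insert k A. (m $ k) *\<^sub>R axis k 1)) = f ((x + (\<Sum>k\<in>A. (m $ k) *\<^sub>R axis k 1)) + of_int z *\<^sub>R axis k 1)"
      using insert z by (simp add: algebra_simps)
    then show ?case using insert one by simp
  qed simp
  from this[of UNIV] show ?thesis
    using basis_expansion[of m] by (simp add: scalar_mult_eq_scaleR)
qed

lemma integer_translate_in_cell:
  fixes x :: "real ^ 'd"
  obtains m where "\<And>k. m $ k \<in> \<int>" "x + m \<in> torus_cell"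
proof
  show "(\<chi> k. - of_int \<lfloor>x $ k\<rfloor>) $ k \<in> \<int>" for k by simp
  show "x + (\<chi> k. - of_int \<lfloor>x $ k\<rfloor>) \<in> torus_cell"
    by (simp add: torus_cell_def) linarith
qed

lemma torus_cell_subset_cbox: "torus_cell \<subseteq> cbox 0 (1 :: real ^ 'd)"
  by (auto simp: torus_cell_def mem_box_cart order.strict_implies_order)

lemma box_subset_torus_cell: "box 0 (1 :: real ^ 'd) \<subseteq> torus_cell"
  by (auto simp: torus_cell_def mem_box_cart intro: less_imp_le)

text \<open>
  Extend the cell by length \<open>h\<close> in direction \<open>k\<close>.  The extended box is the cell plus a slab on one
  side, and the translated cell plus a slab on the other side; the two slabs are translates of each
  other by a period.
\<close>
lemma integral_translate_periodic:
  fixes f :: "real ^ 'd \<Rightarrow> real"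
  assumes per: "periodic f" and cont: "continuous_on UNIV f" and h: "0 \<le> h" "h \<le> 1"
  shows "integral (cbox 0 1) (\<lambda>x. f (x + h *\<^sub>R axis k 1)) = integral (cbox 0 1) f"
proof -
  let ?e = "axis k 1 :: real ^ 'd"
  have int: "f integrable_on cbox a b" for a b
    by (rule integrable_continuous) (rule continuous_on_subset[OF cont subset_UNIV])
  have tr: "integral (cbox a b) (\<lambda>x. f (x + c)) = integral (cbox (a + c) (b + c)) f" for a b c
    using has_integral_shift_cbox[where f = f and c = c and a = "a + c" and b = "b + c", OF integrable_integral[OF int]]
    by (simp add: integral_unique)
  have e: "?e \<in> Basis" by (simp add: axis_in_Basis_iff)
  let ?Q = "cbox 0 (1 + h *\<^sub>R ?e)"
  have ip: "x \<bullet> ?e = x $ k" and ei: "?e $ i = (if i = k then 1 else 0)" for x i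
    by (simp add: inner_axis, simp add: axis_def)
  have corners: "(\<chi> i. if i = k then min ((1 + h *\<^sub>R ?e) $ k) 1 else (1 + h *\<^sub>R ?e) $ i) = 1"
    "(\<chi> i. if i = k then max ((0 :: real ^ 'd) $ k) 1 else (0 :: real ^ 'd) $ i) = ?e"
    "(\<chi> i. if i = k then min ((1 + h *\<^sub>R ?e) $ k) h else (1 + h *\<^sub>R ?e) $ i) = 1 + (h - 1) *\<^sub>R ?e"
    "(\<chi> i. if i = k then max ((0 :: real ^ 'd) $ k) h else (0 :: real ^ 'd) $ i) = h *\<^sub>R ?e"
    using h by (simp_all add: vec_eq_iff ei)
  have s1: "?Q \<inter> {x. x \<bullet> ?e \<le> 1} = cbox 0 1" "?Q \<inter> {x. 1 \<le> x \<bullet> ?e} = cbox ?e (1 + h *\<^sub>R ?e)"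
    and s2: "?Q \<inter> {x. x \<bullet> ?e \<le> h} = cbox 0 (1 + (h - 1) *\<^sub>R ?e)" "?Q \<inter> {x. h \<le> x \<bullet> ?e} = cbox (h *\<^sub>R ?e) (1 + h *\<^sub>R ?e)"
    unfolding ip interval_split_cart [unfolded interval_cbox_cart] corners by simp_all
  have "integral ?Q f = integral (cbox 0 1) f + integral (cbox ?e (1 + h *\<^sub>R ?e)) f"
    using integral_split[OF int e, of 0 "1 + h *\<^sub>R ?e" 1] unfolding s1 .
  moreover have "integral ?Q f = integral (cbox 0 (1 + (h - 1) *\<^sub>R ?e)) f + integral (cbox (h *\<^sub>R ?e) (1 + h *\<^sub>R ?e)) f"
    using integral_split[OF int e, of 0 "1 + h *\<^sub>R ?e" h] unfolding s2 .
  moreover have "integral (cbox 0 (1 + (h - 1) *\<^sub>R ?e)) f = integral (cbox ?e (1 + h *\<^sub>R ?e)) f"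
    using tr[of 0 "1 + (h - 1) *\<^sub>R ?e" ?e] per by (simp add: periodic_def algebra_simps)
  ultimately show ?thesis using tr[of 0 1 "h *\<^sub>R ?e"] by simp
qed

text \<open>
  The difference quotients have integral zero by translation invariance, and they converge boundedly
  to the partial derivative.  Continuity of the derivative is avoided, so the initial data qualify.
\<close>
lemma integral_partial_periodic:
  fixes f :: "real ^ 'd \<Rightarrow> real"
  assumes per: "periodic f" and cont: "continuous_on UNIV f" and der: "has_partial k f f'"
    and bound: "\<And>x. x \<in> cbox 0 2 \<Longrightarrow> \<bar>f' x\<bar> \<le> B"
  shows "(f' has_integral 0) (cbox 0 1)"
proof -
  let ?e = "axis k 1 :: real ^ 'd"
  define h where "h = (\<lambda>n::nat. inverse (real (Suc n)))"
  have h: "0 < h n" "h n \<le> 1" for n by (auto simp: h_def field_simps)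
  define q where "q = (\<lambda>n x. (f (x + h n *\<^sub>R ?e) - f x) / h n)"
  have cq: "continuous_on (cbox 0 1) (q n)" and cf: "continuous_on (cbox 0 1) (\<lambda>x. f (x + h n *\<^sub>R ?e))"
    "continuous_on (cbox 0 1) f" for n
    using h[of n] unfolding q_def by (auto intro!: continuous_intros continuous_on_compose2[OF cont])
  have "integral (cbox 0 1) (q n) = 0" for n
  proof -
    have "integral (cbox 0 1) (q n) = integral (cbox 0 1) (\<lambda>x. f (x + h n *\<^sub>R ?e) - f x) / h n"
      unfolding q_def by simp
    also have "integral (cbox 0 1) (\<lambda>x. f (x + h n *\<^sub>R ?e) - f x)
        = integral (cbox 0 1) (\<lambda>x. f (x + h n *\<^sub>R ?e)) - integral (cbox 0 1) f"
      by (intro Henstock_Kurzweil_Integration.integral_diff integrable_continuous cf)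
    finally show ?thesis using integral_translate_periodic[OF per cont, of "h n" k] h[of n] by simp
  qed
  moreover have lim: "(\<lambda>n. q n x) \<longlonglongrightarrow> f' x" for x
  proof -
    have "((\<lambda>r. (f (x + (0 + r) *\<^sub>R ?e) - f (x + 0 *\<^sub>R ?e)) / r) \<longlongrightarrow> f' x) (at 0)"
      using der unfolding has_partial_def DERIV_def by blast
    moreover have "filterlim h (at 0) sequentially"
      unfolding filterlim_at using LIMSEQ_inverse_real_of_nat h(1) by (auto simp: h_def)
    ultimately show ?thesis unfolding q_def using filterlim_compose by fastforce
  qed
  moreover have bq: "norm (q n x) \<le> B" if x: "x \<in> cbox 0 1" for n x
  proof -
    obtain z where z: "0 < z" "z < h n" "f (x + h n *\<^sub>R ?e) - f (x + 0 *\<^sub>R ?e) = (h n - 0) * f' (x + z *\<^sub>R ?e)"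
      using MVT2[of 0 "h n" "\<lambda>s. f (x + s *\<^sub>R ?e)" "\<lambda>s. f' (x + s *\<^sub>R ?e)"] has_partialD[OF der] h[of n] by auto
    have "x + z *\<^sub>R ?e \<in> cbox 0 2"
      using x z h[of n] by (auto simp: mem_box_cart axis_def) (smt (verit))+
    then show ?thesis using bound z h[of n] by (auto simp: q_def)
  qed
  ultimately have "f' integrable_on cbox 0 1" "(\<lambda>n. 0) \<longlonglongrightarrow> integral (cbox 0 1) f'"
    using dominated_convergence[of q "cbox 0 1" "\<lambda>_. B" f'] integrable_continuous[OF cq] by auto
  moreover from this have "integral (cbox 0 1) f' = 0" using LIMSEQ_unique tendsto_const by metis
  ultimately show ?thesis by (metis integrable_integral)
qed

lemma torus_integral_continuous:
  fixes h :: "real ^ 'd \<Rightarrow> 'a::topological_space \<Rightarrow> real"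
  assumes "continuous_on (UNIV \<times> A) (\<lambda>(x, t). h x t)"
  shows "continuous_on A (\<lambda>t. integral (cbox 0 1) (\<lambda>x. h x t))"
proof (rule integral_continuous_on_param)
  have "continuous_on (A \<times> cbox 0 1) (\<lambda>p. (\<lambda>(x, t). h x t) (snd p, fst p))"
    by (rule continuous_on_compose2[OF assms]) (auto intro!: continuous_intros)
  then show "continuous_on (A \<times> cbox 0 1) (\<lambda>(t, x). h x t)" by (simp add: case_prod_unfold)
qed

lemma torus_integral_has_derivative:
  fixes h :: "real ^ 'd \<Rightarrow> real \<Rightarrow> real"
  assumes der: "\<And>x t. 0 < t \<Longrightarrow> (h x has_real_derivative h' x t) (at t)"
    and cont: "continuous_on (UNIV \<times> {0<..}) (\<lambda>(x, t). h x t)"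
    and cont': "continuous_on (UNIV \<times> {0<..}) (\<lambda>(x, t). h' x t)"
    and t: "0 < t"
  shows "((\<lambda>t. integral (cbox 0 1) (\<lambda>x. h x t)) has_real_derivative integral (cbox 0 1) (\<lambda>x. h' x t)) (at t)"
proof -
  have "((\<lambda>t. integral (cbox 0 1) (\<lambda>x. h x t)) has_real_derivative integral (cbox 0 1) (\<lambda>x. h' x t)) (at t within {0<..})"
  proof (rule leibniz_rule_field_derivative)
    show "((\<lambda>t. h x t) has_real_derivative h' x t) (at t within {0<..})" if "t \<in> {0<..}" for t x
      using der that by (auto intro: has_field_derivative_at_within)
    show "(\<lambda>x. h x t) integrable_on cbox 0 1" if "t \<in> {0<..}" for t
      by (rule integrable_continuous, rule continuous_on_compose2[OF cont, of _ "\<lambda>x. (x, t)", simplified])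
         (use that in \<open>auto intro!: continuous_intros\<close>)
    have "continuous_on ({0<..} \<times> cbox 0 1) (\<lambda>p. (\<lambda>(x, t). h' x t) (snd p, fst p))"
      by (rule continuous_on_compose2[OF cont']) (auto intro!: continuous_intros)
    then show "continuous_on ({0<..} \<times> cbox 0 1) (\<lambda>(t, x). h' x t)" by (simp add: case_prod_unfold)
  qed (use t in auto)
  then show ?thesis using t by (simp add: at_within_open[OF _ open_greaterThan])
qed

lemma norm_vec_squared: "(norm v)\<^sup>2 = (\<Sum>k\<in>UNIV. (v $ k)\<^sup>2)" for v :: "real ^ 'd"
  unfolding power2_norm_eq_inner inner_vec_def by (simp add: power2_eq_square)

lemma has_derivative_imp_has_partial:
  fixes f :: "real ^ 'd \<Rightarrow> real"
  assumes "\<And>x. (f has_derivative (\<lambda>h. \<Sum>j\<in>UNIV. f' j x * h $ j)) (at (x :: real ^ 'd))"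
  shows "has_partial k f (f' k)"
  unfolding has_partial_def
proof
  fix x :: "real ^ 'd"
  have "((\<lambda>s::real. x + s *\<^sub>R axis k 1) has_derivative (\<lambda>s. s *\<^sub>R axis k 1)) (at 0)"
    by (auto intro!: derivative_eq_intros)
  moreover have "(f has_derivative (\<lambda>h. \<Sum>j\<in>UNIV. f' j x * h $ j)) (at (x + 0 *\<^sub>R axis k 1))"
    using assms by simp
  ultimately have "((\<lambda>s. f (x + s *\<^sub>R axis k 1)) has_derivative
      (\<lambda>s. \<Sum>j\<in>UNIV. f' j x * (s *\<^sub>R axis k 1 :: real ^ 'd) $ j)) (at 0)"
    by (rule has_derivative_compose)
  moreover have "(\<Sum>j\<in>UNIV. f' j x * (s *\<^sub>R axis k 1 :: real ^ 'd) $ j) = f' k x * s" for s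
    by (simp add: axis_def if_distrib [of "\<lambda>z. _ * z"] cong: if_cong)
  ultimately show "((\<lambda>s. f (x + s *\<^sub>R axis k 1)) has_real_derivative f' k x) (at 0)"
    by (simp add: has_field_derivative_def)
qed

section \<open>Solutions in components, and the invariant region\<close>

text \<open>
  The system in components: \<open>Ut\<close>, \<open>U1\<close>, \<open>U2\<close> stand for \<open>\<partial>\<^sub>t u\<^sub>i\<close>, \<open>\<partial>\<^sub>k u\<^sub>i\<close>, \<open>\<partial>\<^sub>k\<^sub>k u\<^sub>i\<close> at positive times
  and \<open>V1\<close> for the first derivatives of the initial data, about whose continuity nothing is known.
\<close>
locale allen_cahn_flow =
  fixes \<alpha> \<epsilon> :: real
    and U Ut :: "'n::finite \<Rightarrow> real ^ 'd::finite \<Rightarrow> real \<Rightarrow> real"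
    and U1 U2 :: "'n \<Rightarrow> 'd \<Rightarrow> real ^ 'd \<Rightarrow> real \<Rightarrow> real"
    and V1 :: "'n \<Rightarrow> 'd \<Rightarrow> real ^ 'd \<Rightarrow> real"
  assumes alpha: "0 < \<alpha>" "\<alpha> < 1"
    and eps: "0 < \<epsilon>" "\<epsilon> \<le> 1"
    and U_periodic: "\<And>i t. 0 \<le> t \<Longrightarrow> periodic (\<lambda>x. U i x t)"
    and U_continuous: "\<And>i. continuous_on (UNIV \<times> {0..}) (\<lambda>(x, t). U i x t)"
    and Ut: "\<And>i x t. 0 < t \<Longrightarrow> (U i x has_real_derivative Ut i x t) (at t)"
    and U1: "\<And>i x t. 0 < t \<Longrightarrow>
      ((\<lambda>y. U i y t) has_derivative (\<lambda>h. \<Sum>k\<in>UNIV. U1 i k x t * h $ k)) (at x)"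
    and U2: "\<And>i k t. 0 < t \<Longrightarrow> has_partial k (\<lambda>y. U1 i k y t) (\<lambda>y. U2 i k y t)"
    and Ut_continuous: "\<And>i. continuous_on (UNIV \<times> {0<..}) (\<lambda>(x, t). Ut i x t)"
    and U1_continuous: "\<And>i k. continuous_on (UNIV \<times> {0<..}) (\<lambda>(x, t). U1 i k x t)"
    and U2_continuous: "\<And>i k. continuous_on (UNIV \<times> {0<..}) (\<lambda>(x, t). U2 i k x t)"
    and V1: "\<And>i x. ((\<lambda>y. U i y 0) has_derivative (\<lambda>h. \<Sum>k\<in>UNIV. V1 i k x * h $ k)) (at x)"
    and initial_range: "\<And>i x. 0 \<le> U i x 0" "\<And>i x. U i x 0 \<le> 1"
    and equation: "\<And>i x t. 0 < t \<Longrightarrow>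
      \<epsilon> * Ut i x t = \<epsilon> * (\<Sum>k\<in>UNIV. U2 i k x t) - 1 / \<epsilon> * deriv double_well (U i x t)
        + 1 / \<epsilon> powr \<alpha> * sqrt (2 * double_well (U i x t)) * (surface_tension - (\<Sum>j\<in>UNIV. phi (U j x t)))"
begin

definition lack :: "real ^ 'd \<Rightarrow> real \<Rightarrow> real" where
  "lack x t = surface_tension - (\<Sum>j\<in>UNIV. phi (U j x t))"

lemma U1_partial: "0 < t \<Longrightarrow> has_partial k (\<lambda>y. U i y t) (\<lambda>y. U1 i k y t)"
  using has_derivative_imp_has_partial[of "\<lambda>y. U i y t" "\<lambda>k y. U1 i k y t"] U1 by blast

lemma V1_partial: "has_partial k (\<lambda>y. U i y 0) (\<lambda>y. V1 i k y)"
  using has_derivative_imp_has_partial[of "\<lambda>y. U i y 0" "\<lambda>k y. V1 i k y"] V1 by blast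

lemma U_continuous' [continuous_intros]:
  assumes "continuous_on A f" "continuous_on A g" "\<And>z. z \<in> A \<Longrightarrow> 0 \<le> g z"
  shows "continuous_on A (\<lambda>z. U i (f z) (g z))"
  using continuous_on_compose2[OF U_continuous, of A "\<lambda>z. (f z, g z)"] assms
  by (auto intro: continuous_on_Pair)

lemma Ut_continuous' [continuous_intros]:
  assumes "continuous_on A f" "continuous_on A g" "\<And>z. z \<in> A \<Longrightarrow> 0 < g z"
  shows "continuous_on A (\<lambda>z. Ut i (f z) (g z))"
  using continuous_on_compose2[OF Ut_continuous, of A "\<lambda>z. (f z, g z)"] assms
  by (auto intro: continuous_on_Pair)

lemma U1_continuous' [continuous_intros]:
  assumes "continuous_on A f" "continuous_on A g" "\<And>z. z \<in> A \<Longrightarrow> 0 < g z"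
  shows "continuous_on A (\<lambda>z. U1 i k (f z) (g z))"
  using continuous_on_compose2[OF U1_continuous, of A "\<lambda>z. (f z, g z)"] assms
  by (auto intro: continuous_on_Pair)

lemma U2_continuous' [continuous_intros]:
  assumes "continuous_on A f" "continuous_on A g" "\<And>z. z \<in> A \<Longrightarrow> 0 < g z"
  shows "continuous_on A (\<lambda>z. U2 i k (f z) (g z))"
  using continuous_on_compose2[OF U2_continuous, of A "\<lambda>z. (f z, g z)"] assms
  by (auto intro: continuous_on_Pair)

lemma lack_continuous' [continuous_intros]:
  assumes "continuous_on A f" "continuous_on A g" "\<And>z. z \<in> A \<Longrightarrow> 0 \<le> g z"
  shows "continuous_on A (\<lambda>z. lack (f z) (g z))"
  unfolding lack_def using assms by (intro continuous_intros) auto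

lemma periodic_representative:
  assumes "0 \<le> t"
  obtains m where "x + m \<in> cbox 0 1" "\<And>i y. U i (y + m) t = U i y t"
proof -
  obtain m where m: "\<And>k. m $ k \<in> \<int>" "x + m \<in> torus_cell" using integer_translate_in_cell[of x] by blast
  show ?thesis
    using that[of m] m torus_cell_subset_cbox periodic_integer_shift[OF U_periodic[OF assms] m(1)] by blast
qed

lemma laplacian_nonpos_at_max:
  assumes "0 < t" "\<And>y. c * U i y t \<le> c * U i x t"
  shows "c * (\<Sum>k\<in>UNIV. U2 i k x t) \<le> 0"
proof -
  have "c * U2 i k x t \<le> 0" for k
  proof (rule derivative_test_at_max(2)[of "\<lambda>s. c * U i (x + s *\<^sub>R axis k 1) t" "\<lambda>s. c * U1 i k (x + s *\<^sub>R axis k 1) t"])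
    show "((\<lambda>s. c * U i (x + s *\<^sub>R axis k 1) t) has_real_derivative c * U1 i k (x + s *\<^sub>R axis k 1) t) (at s)" for s
      by (rule DERIV_cmult[OF has_partialD[OF U1_partial[OF assms(1)]]])
    show "((\<lambda>s. c * U1 i k (x + s *\<^sub>R axis k 1) t) has_real_derivative c * U2 i k x t) (at 0)"
      using DERIV_cmult[OF has_partialD[OF U2[OF assms(1)], where s = 0]] by simp
  qed (use assms(2) in simp)
  then show ?thesis by (simp add: sum_distrib_left sum_nonpos)
qed

lemma equation':
  assumes "0 < t"
  shows "\<epsilon> * Ut i x t = \<epsilon> * (\<Sum>k\<in>UNIV. U2 i k x t) - 1 / \<epsilon> * (2 * (U i x t * (1 - U i x t)) * (1 - 2 * U i x t))
        + 1 / \<epsilon> powr \<alpha> * (sqrt 2 * \<bar>U i x t * (1 - U i x t)\<bar>) * lack x t"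
  using equation[OF assms] by (simp add: deriv_double_well sqrt_double_well lack_def)

text \<open>
  Both wells are handled at once by the choice of a sign \<open>c\<close> and the corresponding well \<open>a\<close>.  Outside
  \<open>[0, 1]\<close> the term \<open>W'\<close> pushes back towards the interval, and the forcing is bounded by a multiple
  of the distance to the well, since \<open>sqrt (2 W)\<close> vanishes there.
\<close>
lemma U_range_aux:
  assumes c: "(c = -1 \<and> a = 0) \<or> (c = 1 \<and> a = (1::real))" and T: "0 \<le> T"
  shows "c * (U i x T - a) \<le> 0"
proof -
  obtain B where B: "\<And>z. z \<in> cbox 0 1 \<times> {0..T} \<Longrightarrow>
      norm ((\<Sum>j\<in>UNIV. \<bar>U j (fst z) (snd z)\<bar>) + \<bar>lack (fst z) (snd z)\<bar>) \<le> B"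
    by (rule continuous_on_compact_bound[of "cbox 0 1 \<times> {0..T}"
          "\<lambda>z. (\<Sum>j\<in>UNIV. \<bar>U j (fst z) (snd z)\<bar>) + \<bar>lack (fst z) (snd z)\<bar>"])
       (auto intro!: continuous_intros compact_Times)
  have B1: "\<bar>U j x t\<bar> \<le> B" "\<bar>lack x t\<bar> \<le> B" if "x \<in> cbox 0 1" "0 \<le> t" "t \<le> T" for j x t
  proof -
    have "\<bar>U j x t\<bar> \<le> (\<Sum>j\<in>UNIV. \<bar>U j x t\<bar>)" by (rule member_le_sum) auto
    moreover have "0 \<le> (\<Sum>j\<in>UNIV. \<bar>U j x t\<bar>)" by (rule sum_nonneg) auto
    ultimately show "\<bar>U j x t\<bar> \<le> B" "\<bar>lack x t\<bar> \<le> B" using B[of "(x, t)"] that by (auto simp: abs_le_iff)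
  qed
  define K where "K = 1 / \<epsilon> powr \<alpha> * (sqrt 2 * (1 + B)) * B"
  obtain m where m: "x + m \<in> cbox 0 1" "\<And>i y. U i (y + m) T = U i y T"
    using periodic_representative[OF T] by blast
  have "c * (U i (x + m) T - a) \<le> 0"
  proof (rule comparison_principle[where w = "\<lambda>i x t. c * (U i x t - a)" and I = UNIV and S = "cbox 0 1" and T = T and K = "K / \<epsilon>"])
    show "continuous_on (cbox 0 1 \<times> {0..T}) (\<lambda>(z, t). c * (U i z t - a))" for i
      by (auto intro!: continuous_intros simp: case_prod_unfold)
    show "c * (U i z 0 - a) \<le> 0" for i z using c initial_range[of i z] by auto
    fix i x t
    assume x: "x \<in> cbox 0 1" and t: "0 < t" "t \<le> T" and pos: "0 < c * (U i x t - a)"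
      and max: "\<And>j y. j \<in> UNIV \<Longrightarrow> y \<in> cbox 0 1 \<Longrightarrow> c * (U j y t - a) \<le> c * (U i x t - a)"
    have "c * U i y t \<le> c * U i x t" for y
    proof -
      obtain m where m: "y + m \<in> cbox 0 1" "\<And>i y. U i (y + m) t = U i y t"
        using periodic_representative[of t y] t by auto
      then show ?thesis using max[OF UNIV_I m(1), of i] m(2)[of i y] by (simp add: right_diff_distrib)
    qed
    from laplacian_nonpos_at_max[OF t(1) this] have lap: "c * (\<Sum>k\<in>UNIV. U2 i k x t) \<le> 0" .
    have Bx: "\<bar>U i x t\<bar> \<le> B" "\<bar>lack x t\<bar> \<le> B" using B1[OF x] t by auto
    let ?v = "U i x t"
    have well: "0 \<le> c * ((?v * (1 - ?v)) * (1 - 2 * ?v))"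
      using c pos by (auto simp: mult_nonpos_nonpos mult_nonneg_nonneg mult_nonpos_nonneg mult_nonneg_nonpos)
    have "\<bar>?v * (1 - ?v)\<bar> \<le> (1 + B) * (c * (?v - a))"
    proof (cases "c = 1")
      case True
      then have "a = 1" "1 < ?v" using c pos by auto
      then have "\<bar>?v * (1 - ?v)\<bar> = ?v * (?v - 1)" by (simp add: abs_mult)
      also have "\<dots> \<le> (1 + B) * (?v - 1)" using Bx \<open>1 < ?v\<close> by (intro mult_right_mono) auto
      finally show ?thesis using True \<open>a = 1\<close> by simp
    next
      case False
      then have "c = -1" "a = 0" "?v < 0" using c pos by auto
      then have "\<bar>?v * (1 - ?v)\<bar> = (1 - ?v) * (- ?v)" by (simp add: abs_mult)
      also have "\<dots> \<le> (1 + B) * (- ?v)" using Bx \<open>?v < 0\<close> by (intro mult_right_mono) auto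
      finally show ?thesis using \<open>c = -1\<close> \<open>a = 0\<close> by simp
    qed
    moreover have gen: "p * (sqrt 2 * X) * G \<le> p * (sqrt 2 * Y) * B"
      if "0 \<le> p" "X \<le> Y" "0 \<le> Y" "0 \<le> G" "G \<le> B" for p X Y G :: real
      using that by (intro mult_mono mult_left_mono mult_nonneg_nonneg) auto
    ultimately have "1 / \<epsilon> powr \<alpha> * (sqrt 2 * \<bar>?v * (1 - ?v)\<bar>) * \<bar>lack x t\<bar> \<le> 1 / \<epsilon> powr \<alpha> * (sqrt 2 * ((1 + B) * (c * (?v - a)))) * B"
      using Bx(2) by (intro gen) (simp | assumption | rule order_trans[OF abs_ge_zero])+
    moreover have "c * (1 / \<epsilon> powr \<alpha> * (sqrt 2 * \<bar>?v * (1 - ?v)\<bar>) * lack x t) \<le> 1 / \<epsilon> powr \<alpha> * (sqrt 2 * \<bar>?v * (1 - ?v)\<bar>) * \<bar>lack x t\<bar>"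
    proof -
      have "c * lack x t \<le> \<bar>lack x t\<bar>" using c by auto
      then have "1 / \<epsilon> powr \<alpha> * (sqrt 2 * \<bar>?v * (1 - ?v)\<bar>) * (c * lack x t) \<le> 1 / \<epsilon> powr \<alpha> * (sqrt 2 * \<bar>?v * (1 - ?v)\<bar>) * \<bar>lack x t\<bar>"
        by (intro mult_left_mono) auto
      then show ?thesis by (simp add: mult_ac)
    qed
    moreover have "c * (\<epsilon> * Ut i x t) = \<epsilon> * (c * (\<Sum>k\<in>UNIV. U2 i k x t)) - 2 / \<epsilon> * (c * ((?v * (1 - ?v)) * (1 - 2 * ?v)))
        + c * (1 / \<epsilon> powr \<alpha> * (sqrt 2 * \<bar>?v * (1 - ?v)\<bar>) * lack x t)"
      unfolding equation'[OF t(1)] by (simp add: algebra_simps)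
    moreover have "\<epsilon> * (c * (\<Sum>k\<in>UNIV. U2 i k x t)) \<le> 0" using lap eps by (simp add: mult_nonneg_nonpos)
    moreover have "0 \<le> 2 / \<epsilon> * (c * ((?v * (1 - ?v)) * (1 - 2 * ?v)))" using mult_nonneg_nonneg[OF _ well, of "2 / \<epsilon>"] eps by simp
    ultimately have "c * (\<epsilon> * Ut i x t) \<le> 1 / \<epsilon> powr \<alpha> * (sqrt 2 * ((1 + B) * (c * (?v - a)))) * B" by linarith
    also have "\<dots> = K * (c * (?v - a))" by (simp add: K_def)
    finally have "c * Ut i x t \<le> K / \<epsilon> * (c * (?v - a))" using eps by (simp add: field_simps)
    moreover have "((\<lambda>t. c * (U i x t - a)) has_real_derivative c * Ut i x t) (at t)"
      by (auto intro!: derivative_eq_intros Ut t)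
    ultimately show "\<exists>D. ((\<lambda>t. c * (U i x t - a)) has_real_derivative D) (at t) \<and> D \<le> K / \<epsilon> * (c * (U i x t - a))"
      by blast
  qed (use m T in auto)
  then show ?thesis using m by simp
qed

lemma U_range: assumes "0 \<le> t" shows "0 \<le> U i x t" "U i x t \<le> 1"
  using U_range_aux[of "-1" 0 t i x] U_range_aux[of 1 1 t i x] assms by auto

lemma lack_bound: assumes "0 \<le> t" shows "\<bar>lack x t\<bar> \<le> real CARD('n)"
proof -
  have "(\<Sum>j\<in>UNIV. phi (U j x t)) \<le> of_nat (card (UNIV :: 'n set)) * 1"
    by (rule sum_bounded_above) (use phi_bounds U_range assms in auto)
  moreover have "0 \<le> (\<Sum>j\<in>UNIV. phi (U j x t))"
    by (rule sum_nonneg) (use phi_bounds U_range assms in auto)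
  moreover have "0 \<le> surface_tension" "surface_tension \<le> 1"
    unfolding surface_tension_def using phi_bounds[of 1] by auto
  moreover have "1 \<le> real CARD('n)" using zero_less_card_finite[where 'a='n] by linarith
  ultimately show ?thesis unfolding lack_def by linarith
qed

section \<open>The gradient bound by doubling the space variable\<close>

text \<open>
  The assumption \<open>mu_large\<close> says that the damping, of size \<open>2 \<mu>/\<epsilon>\<close>, dominates the forcing, of size
  \<open>3 n \<epsilon>\<^bsup>-\<alpha>\<^esup>\<close>.
\<close>
context
  fixes \<mu> :: real and P :: "real \<Rightarrow> real"
  assumes mu: "0 < \<mu>" "\<mu> \<le> 1"
    and mu_large: "3 * real CARD('n) * \<epsilon> \<le> 2 * \<mu> * \<epsilon> powr \<alpha>"
    and P: "\<And>u. -1/2 < u \<Longrightarrow> u < 3/2 \<Longrightarrow> (P has_real_derivative 1 / steepness \<mu> u) (at u)"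
    and initial_steepness: "\<And>i x. (\<Sum>k\<in>UNIV. (\<epsilon> * V1 i k x)\<^sup>2) \<le> (steepness \<mu> (U i x 0))\<^sup>2"
begin

lemma U_range': assumes "0 \<le> t" shows "-1/2 < U i x t" "U i x t < 3/2"
  using U_range[OF assms, of i x] by auto

lemma steepness_U_pos: "0 \<le> t \<Longrightarrow> 0 < steepness \<mu> (U i x t)"
  by (rule steepness_pos[OF mu(1) U_range'])

lemma profile_continuous:
  assumes "continuous_on A f" "\<And>z. z \<in> A \<Longrightarrow> 0 \<le> f z \<and> f z \<le> 1"
  shows "continuous_on A (\<lambda>z. P (f z))"
proof (rule continuous_on_compose2[OF _ assms(1), of "{0..1}"])
  show "continuous_on {0..1} P"
    by (intro continuous_at_imp_continuous_on ballI DERIV_isCont[OF P]) auto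
qed (use assms(2) in auto)

lemma initial_two_point:
  "\<epsilon> * P (U i x 0) - \<epsilon> * P (U i y 0) \<le> norm (x - y)"
proof -
  let ?z = "\<lambda>s. y + s *\<^sub>R (x - y)"
  let ?D = "\<lambda>s. \<epsilon> * (1 / steepness \<mu> (U i (?z s) 0) * (\<Sum>k\<in>UNIV. V1 i k (?z s) * (x - y) $ k))"
  have "\<epsilon> * P (U i (?z 1) 0) - \<epsilon> * P (U i (?z 0) 0) \<le> 1 * norm (x - y) - 0 * norm (x - y)"
  proof (rule increment_le_of_deriv_le[where f' = ?D and h = "\<lambda>s. s * norm (x - y)" and h' = "\<lambda>_. norm (x - y)"])
    fix s :: real
    have "(?z has_derivative (\<lambda>r. r *\<^sub>R (x - y))) (at s)" by (auto intro!: derivative_eq_intros)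
    from has_derivative_compose[OF this V1]
    have "((\<lambda>s. U i (?z s) 0) has_derivative (\<lambda>r. \<Sum>k\<in>UNIV. V1 i k (?z s) * (r *\<^sub>R (x - y)) $ k)) (at s)" .
    then have "((\<lambda>s. U i (?z s) 0) has_real_derivative (\<Sum>k\<in>UNIV. V1 i k (?z s) * (x - y) $ k)) (at s)"
      by (rule has_derivative_imp_has_field_derivative) (simp add: sum_distrib_right sum_distrib_left mult_ac)
    from DERIV_cmult[OF DERIV_chain2[where f = P, OF P[OF U_range'[OF order_refl]] this]]
    show "((\<lambda>s. \<epsilon> * P (U i (?z s) 0)) has_real_derivative ?D s) (at s)" .
    show "((\<lambda>s. s * norm (x - y)) has_real_derivative norm (x - y)) (at s)"
      by (auto intro!: derivative_eq_intros)
    let ?q = "steepness \<mu> (U i (?z s) 0)" and ?g = "(\<chi> k. \<epsilon> * V1 i k (?z s)) :: real ^ 'd"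
    have q: "0 < ?q" by (rule steepness_U_pos) simp
    have "(norm ?g)\<^sup>2 \<le> ?q\<^sup>2"
      using initial_steepness[of i "?z s"] by (simp add: norm_vec_squared)
    then have "norm ?g \<le> ?q" by (rule power2_le_imp_le[OF _ less_imp_le[OF q]])
    then have "?g \<bullet> (x - y) \<le> ?q * norm (x - y)"
      by (rule order_trans[OF norm_cauchy_schwarz mult_right_mono[OF _ norm_ge_zero]])
    then have "(?g \<bullet> (x - y)) / ?q \<le> norm (x - y)" using q by (simp add: field_simps)
    moreover have "?D s = (?g \<bullet> (x - y)) / ?q" by (simp add: inner_vec_def sum_distrib_left sum_divide_distrib mult_ac)
    ultimately show "?D s \<le> norm (x - y)" by linarith
  qed simp
  then show ?thesis by simp
qed

lemma phi_le_profile: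
  assumes "0 \<le> u" "u \<le> 1" "0 \<le> v" "v \<le> 1"
  shows "\<bar>phi u - phi v\<bar> \<le> \<bar>P u - P v\<bar>"
proof (cases "v \<le> u")
  case True
  then show ?thesis using phi_increment[OF mu P, of v u] assms by auto
next
  case False
  then show ?thesis using phi_increment[OF mu P, of u v] assms by auto
qed

lemma profile_partial:
  assumes "0 < t"
  shows "has_partial k (\<lambda>y. \<epsilon> * P (U i y t)) (\<lambda>y. \<epsilon> * U1 i k y t / steepness \<mu> (U i y t))"
  unfolding has_partial_def
proof
  fix x
  have "((\<lambda>s. U i (x + s *\<^sub>R axis k 1) t) has_real_derivative U1 i k x t) (at 0)"
    using U1_partial[OF assms] unfolding has_partial_def by blast
  moreover have "(P has_real_derivative 1 / steepness \<mu> (U i x t)) (at (U i (x + 0 *\<^sub>R axis k 1) t))"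
    using P[OF U_range', of t i x] assms by simp
  ultimately have "((\<lambda>s. P (U i (x + s *\<^sub>R axis k 1) t)) has_real_derivative 1 / steepness \<mu> (U i x t) * U1 i k x t) (at 0)"
    by (rule DERIV_chain2[where f = P, rotated])
  from DERIV_cmult[OF this, of \<epsilon>]
  show "((\<lambda>s. \<epsilon> * P (U i (x + s *\<^sub>R axis k 1) t)) has_real_derivative \<epsilon> * U1 i k x t / steepness \<mu> (U i x t)) (at 0)"
    by simp
qed

definition steepness_slope :: "real \<Rightarrow> real" where
  "steepness_slope u = (1 - 2 * u) * (2 * (u * (1 - u)) + \<mu>) / steepness \<mu> u"

lemma profile_second_partial:
  assumes "0 < t"
  shows "has_partial k (\<lambda>y. \<epsilon> * U1 i k y t / steepness \<mu> (U i y t))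
    (\<lambda>y. \<epsilon> * U2 i k y t / steepness \<mu> (U i y t)
       - \<epsilon> * (U1 i k y t)\<^sup>2 * steepness_slope (U i y t) / (steepness \<mu> (U i y t))\<^sup>2)"
  unfolding has_partial_def
proof
  fix x
  note q = steepness_U_pos[of t i x]
  have "((\<lambda>s. U i (x + s *\<^sub>R axis k 1) t) has_real_derivative U1 i k x t) (at 0)"
    using U1_partial[OF assms] unfolding has_partial_def by blast
  moreover have "(steepness \<mu> has_real_derivative steepness_slope (U i x t)) (at (U i (x + 0 *\<^sub>R axis k 1) t))"
    using steepness_has_derivative[OF mu(1) U_range', of t i x] assms by (simp add: steepness_slope_def)
  ultimately have d1: "((\<lambda>s. steepness \<mu> (U i (x + s *\<^sub>R axis k 1) t)) has_real_derivative steepness_slope (U i x t) * U1 i k x t) (at 0)"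
    by (rule DERIV_chain2[where f = "steepness \<mu>", rotated])
  have d2: "((\<lambda>s. \<epsilon> * U1 i k (x + s *\<^sub>R axis k 1) t) has_real_derivative \<epsilon> * U2 i k x t) (at 0)"
    using U2[OF assms] unfolding has_partial_def by (intro DERIV_cmult) blast
  show "((\<lambda>s. \<epsilon> * U1 i k (x + s *\<^sub>R axis k 1) t / steepness \<mu> (U i (x + s *\<^sub>R axis k 1) t)) has_real_derivative
     \<epsilon> * U2 i k x t / steepness \<mu> (U i x t)
       - \<epsilon> * (U1 i k x t)\<^sup>2 * steepness_slope (U i x t) / (steepness \<mu> (U i x t))\<^sup>2) (at 0)"
    by (rule DERIV_cong[OF DERIV_divide[OF d2 d1]])
      (use q assms in \<open>auto simp: field_simps power2_eq_square\<close>)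
qed

text \<open>
  The second point is written as \<open>x + v\<close>: this makes the doubled function periodic in \<open>x\<close>, and it is
  not positive for large \<open>v\<close>, so the maximum principle applies on a compact set of pairs \<open>(x, v)\<close>.  All
  components enter simultaneously because the forcing couples them.
\<close>
lemma two_point_bound:
  assumes "0 \<le> T"
  shows "\<epsilon> * P (U i x T) - \<epsilon> * P (U i y T) \<le> norm (x - y)"
proof -
  define R where "R = \<epsilon> * (P 1 - P 0)"
  have R: "\<epsilon> * P (U i x t) - \<epsilon> * P (U i y t) \<le> R" if "0 \<le> t" for i x y t
  proof -
    have "P (U i x t) \<le> P 1" "P 0 \<le> P (U i y t)"
      using U_range[OF that] by (intro profile_mono[OF mu P]; simp)+
    then have "\<epsilon> * (P (U i x t) - P (U i y t)) \<le> R"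
      unfolding R_def using eps by (intro mult_left_mono) auto
    then show ?thesis by (simp add: algebra_simps)
  qed
  define w where "w = (\<lambda>i (p :: (real ^ 'd) \<times> (real ^ 'd)) t.
    \<epsilon> * P (U i (fst p) t) - \<epsilon> * P (U i (fst p + snd p) t) - norm (snd p))"
  have main: "w i p T \<le> 0" if "p \<in> cbox 0 1 \<times> cball 0 R" for i p
  proof (rule comparison_principle[where w = w and I = UNIV and S = "cbox 0 1 \<times> cball 0 R" and T = T and K = 0])
    show "continuous_on ((cbox 0 1 \<times> cball 0 R) \<times> {0..T}) (\<lambda>(z, t). w i z t)" for i
      unfolding w_def using U_range
      by (auto intro!: continuous_intros profile_continuous simp: case_prod_unfold)
    show "w i z 0 \<le> 0" for i z
      using initial_two_point[of i "fst z" "fst z + snd z"] by (simp add: w_def)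
  next
    fix i p t
    assume t: "0 < t" "t \<le> T" and pos: "0 < w i p t"
      and "\<And>j q. j \<in> UNIV \<Longrightarrow> q \<in> cbox 0 1 \<times> cball 0 R \<Longrightarrow> w j q t \<le> w i p t"
    then have max0: "w j (y, v) t \<le> w i p t" if "y \<in> cbox 0 1" "norm v \<le> R" for j y v
      using that by auto
    \<comment> \<open>by periodicity and the choice of the radius, the maximum over the compact set is global\<close>
    have max: "w j (y, v) t \<le> w i p t" for j y v
    proof (cases "norm v \<le> R")
      case True
      obtain m where m: "y + m \<in> cbox 0 1" "\<And>i y. U i (y + m) t = U i y t"
        using periodic_representative[of t y] t by auto
      have "y + m + v = (y + v) + m" by simp
      then have "w j (y + m, v) t = w j (y, v) t" unfolding w_def using m(2) by (metis fst_conv snd_conv)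
      then show ?thesis using max0[OF m(1) True, of j] by simp
    next
      case False
      then have "w j (y, v) t \<le> 0" using R[of t j y "y + v"] t by (simp add: w_def)
      then show ?thesis using pos by simp
    qed
    obtain x v where p: "p = (x, v)" by force
    define y where "y = x + v"
    let ?ux = "U i x t" and ?uy = "U i y t"
    let ?qx = "steepness \<mu> ?ux" and ?qy = "steepness \<mu> ?uy"
    have q: "0 < ?qx" "0 < ?qy" using steepness_U_pos t by auto
    note rg = U_range[of t i x] U_range[of t i y]
    have wp: "w i p t = \<epsilon> * P ?ux - \<epsilon> * P ?uy - norm v" by (simp add: w_def p y_def)
    define l where "l = P ?ux - P ?uy"
    have "v \<noteq> 0" using pos by (auto simp: wp y_def)
    have l: "0 < l"
    proof -
      have "0 < \<epsilon> * l" using pos norm_ge_zero[of v] unfolding wp l_def right_diff_distrib by linarith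
      then show ?thesis using eps by (simp add: zero_less_mult_iff)
    qed
    have uxy: "?uy \<le> ?ux"
    proof (rule ccontr)
      assume "\<not> ?uy \<le> ?ux"
      then have "P ?ux \<le> P ?uy" using rg t by (intro profile_mono[OF mu P]) auto
      then show False using l by (simp add: l_def)
    qed

    have dnorm: "((\<lambda>s. norm (v + s *\<^sub>R axis k c)) has_real_derivative (v $ k * c) / norm v) (at 0)" for k and c :: real
    proof -
      have "((\<lambda>s. v + s *\<^sub>R axis k c) has_derivative (\<lambda>s. s *\<^sub>R axis k c)) (at (0 :: real))"
        by (auto intro!: derivative_eq_intros)
      moreover have "(norm has_derivative (\<lambda>h. h \<bullet> sgn v)) (at (v + 0 *\<^sub>R axis k c))"
        using has_derivative_norm[OF \<open>v \<noteq> 0\<close>] by simp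
      ultimately have "((\<lambda>s. norm (v + s *\<^sub>R axis k c)) has_derivative (\<lambda>s. (s *\<^sub>R axis k c) \<bullet> sgn v)) (at 0)"
        by (rule has_derivative_compose)
      then show ?thesis
        by (rule has_derivative_imp_has_field_derivative)
           (simp add: sgn_div_norm inner_axis' field_simps)
    qed
    \<comment> \<open>move \<open>x\<close> and keep the second point fixed\<close>
    have gradx: "\<epsilon> * U1 i k x t / ?qx = - (v $ k) / norm v" for k
    proof -
      let ?f = "\<lambda>s. \<epsilon> * P (U i (x + s *\<^sub>R axis k 1) t) - \<epsilon> * P ?uy - norm (v + s *\<^sub>R axis k (-1))"
      have "((\<lambda>s. \<epsilon> * P (U i (x + s *\<^sub>R axis k 1) t)) has_real_derivative \<epsilon> * U1 i k x t / ?qx) (at 0)"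
        using profile_partial[OF t(1)] unfolding has_partial_def by blast
      then have "(?f has_real_derivative (\<epsilon> * U1 i k x t / ?qx - 0 - (v $ k * (-1)) / norm v)) (at 0)"
        by (intro DERIV_diff DERIV_const dnorm)
      moreover have "?f s \<le> ?f 0" for s
      proof -
        have "(x + s *\<^sub>R axis k 1) + (v + s *\<^sub>R axis k (-1)) = y"
          by (simp add: y_def vec_eq_iff axis_def)
        then have "w i (x + s *\<^sub>R axis k 1, v + s *\<^sub>R axis k (-1)) t = ?f s" by (simp add: w_def)
        then show ?thesis using max[of i "x + s *\<^sub>R axis k 1" "v + s *\<^sub>R axis k (-1)"] by (simp add: wp)
      qed
      ultimately have "\<epsilon> * U1 i k x t / ?qx - 0 - (v $ k * (-1)) / norm v = 0"
        by (intro DERIV_local_max[where f = ?f and x = 0 and d = 1]) simp_all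
      then show ?thesis by simp
    qed
    \<comment> \<open>move the second point and keep \<open>x\<close> fixed\<close>
    have grady: "\<epsilon> * U1 i k y t / ?qy = - (v $ k) / norm v" for k
    proof -
      let ?f = "\<lambda>s. \<epsilon> * P ?ux - \<epsilon> * P (U i (y + s *\<^sub>R axis k 1) t) - norm (v + s *\<^sub>R axis k 1)"
      have "((\<lambda>s. \<epsilon> * P (U i (y + s *\<^sub>R axis k 1) t)) has_real_derivative \<epsilon> * U1 i k y t / ?qy) (at 0)"
        using profile_partial[OF t(1)] unfolding has_partial_def by blast
      then have "(?f has_real_derivative (0 - \<epsilon> * U1 i k y t / ?qy - (v $ k * 1) / norm v)) (at 0)"
        by (intro DERIV_diff DERIV_const dnorm)
      moreover have "?f s \<le> ?f 0" for s
      proof -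
        have "w i (x, v + s *\<^sub>R axis k 1) t = ?f s" by (simp add: w_def y_def add.assoc)
        then show ?thesis using max[of i x "v + s *\<^sub>R axis k 1"] by (simp add: wp)
      qed
      ultimately have "0 - \<epsilon> * U1 i k y t / ?qy - (v $ k * 1) / norm v = 0"
        by (intro DERIV_local_max[where f = ?f and x = 0 and d = 1]) simp_all
      then show ?thesis by simp
    qed
    have unit: "(\<Sum>k\<in>UNIV. (- (v $ k) / norm v)\<^sup>2) = 1"
      using \<open>v \<noteq> 0\<close> by (simp add: power_divide sum_divide_distrib [symmetric] norm_vec_squared [symmetric])
    have sq: "(\<Sum>k\<in>UNIV. (U1 i k z t)\<^sup>2) = (steepness \<mu> (U i z t))\<^sup>2 / \<epsilon>\<^sup>2"
      if "\<And>k. \<epsilon> * U1 i k z t / steepness \<mu> (U i z t) = - (v $ k) / norm v" for z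
    proof -
      have "(\<Sum>k\<in>UNIV. (\<epsilon> * U1 i k z t / steepness \<mu> (U i z t))\<^sup>2) = 1"
        unfolding that by (rule unit)
      then have "\<epsilon>\<^sup>2 * (\<Sum>k\<in>UNIV. (U1 i k z t)\<^sup>2) / (steepness \<mu> (U i z t))\<^sup>2 = 1"
        by (simp add: power_divide power_mult_distrib sum_divide_distrib sum_distrib_left)
      then show ?thesis using steepness_U_pos[of t i z] t eps by (simp add: field_simps)
    qed
    define A where "A = (\<lambda>z. \<epsilon> * (\<Sum>k\<in>UNIV. U2 i k z t) / steepness \<mu> (U i z t) - steepness_slope (U i z t) / \<epsilon>)"
    define A2 where "A2 = (\<lambda>k z. \<epsilon> * U2 i k z t / steepness \<mu> (U i z t)
       - \<epsilon> * (U1 i k z t)\<^sup>2 * steepness_slope (U i z t) / (steepness \<mu> (U i z t))\<^sup>2)"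
    have sumA2: "(\<Sum>k\<in>UNIV. A2 k z) = A z"
      if "\<And>k. \<epsilon> * U1 i k z t / steepness \<mu> (U i z t) = - (v $ k) / norm v" for z
    proof -
      have "(\<Sum>k\<in>UNIV. A2 k z) = \<epsilon> * (\<Sum>k\<in>UNIV. U2 i k z t) / steepness \<mu> (U i z t)
          - \<epsilon> * (\<Sum>k\<in>UNIV. (U1 i k z t)\<^sup>2) * steepness_slope (U i z t) / (steepness \<mu> (U i z t))\<^sup>2"
        unfolding A2_def by (simp add: sum_subtractf sum_distrib_left sum_distrib_right sum_divide_distrib)
      then show ?thesis unfolding sq[OF that] A_def
        using steepness_U_pos[of t i z] t eps by (simp add: power2_eq_square)
    qed
    \<comment> \<open>move both points in parallel, which does not change their distance\<close>
    have "A2 k x - A2 k y \<le> 0" for k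
    proof (rule derivative_test_at_max(2)[of
          "\<lambda>s. \<epsilon> * P (U i (x + s *\<^sub>R axis k 1) t) - \<epsilon> * P (U i (y + s *\<^sub>R axis k 1) t)"
          "\<lambda>s. \<epsilon> * U1 i k (x + s *\<^sub>R axis k 1) t / steepness \<mu> (U i (x + s *\<^sub>R axis k 1) t)
             - \<epsilon> * U1 i k (y + s *\<^sub>R axis k 1) t / steepness \<mu> (U i (y + s *\<^sub>R axis k 1) t)"])
      fix s
      show "((\<lambda>s. \<epsilon> * P (U i (x + s *\<^sub>R axis k 1) t) - \<epsilon> * P (U i (y + s *\<^sub>R axis k 1) t)) has_real_derivative
          \<epsilon> * U1 i k (x + s *\<^sub>R axis k 1) t / steepness \<mu> (U i (x + s *\<^sub>R axis k 1) t)
             - \<epsilon> * U1 i k (y + s *\<^sub>R axis k 1) t / steepness \<mu> (U i (y + s *\<^sub>R axis k 1) t)) (at s)"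
        by (intro DERIV_diff has_partialD[OF profile_partial[OF t(1)]])
      show "((\<lambda>s. \<epsilon> * U1 i k (x + s *\<^sub>R axis k 1) t / steepness \<mu> (U i (x + s *\<^sub>R axis k 1) t)
             - \<epsilon> * U1 i k (y + s *\<^sub>R axis k 1) t / steepness \<mu> (U i (y + s *\<^sub>R axis k 1) t))
           has_real_derivative A2 k x - A2 k y) (at 0)"
        using profile_second_partial[OF t(1), of k i] unfolding has_partial_def A2_def by (intro DERIV_diff) blast+
      have "w i (x + s *\<^sub>R axis k 1, v) t \<le> w i p t" by (rule max)
      then show "\<epsilon> * P (U i (x + s *\<^sub>R axis k 1) t) - \<epsilon> * P (U i (y + s *\<^sub>R axis k 1) t)
          \<le> \<epsilon> * P (U i (x + 0 *\<^sub>R axis k 1) t) - \<epsilon> * P (U i (y + 0 *\<^sub>R axis k 1) t)"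
        unfolding wp by (simp add: w_def y_def ac_simps)
    qed
    then have "(\<Sum>k\<in>UNIV. A2 k x - A2 k y) \<le> 0" by (rule sum_nonpos)
    then have Axy: "A x - A y \<le> 0" using sumA2[OF gradx] sumA2[OF grady] by (simp add: sum_subtractf)

    define b where "b = (\<lambda>u. sqrt 2 * (u * (1 - u)) / steepness \<mu> u)"
    \<comment> \<open>the time derivative of the doubled function\<close>
    define D where "D = \<epsilon> * Ut i x t / ?qx - \<epsilon> * Ut i y t / ?qy"
    \<comment> \<open>here \<open>W'\<close> cancels against the slope of the steepness, except for the part from \<open>\<mu>\<close>\<close>
    have rate: "\<epsilon> * Ut i z t / steepness \<mu> (U i z t) = A z
        + \<mu> / \<epsilon> * ((1 - 2 * U i z t) / steepness \<mu> (U i z t)) + 1 / \<epsilon> powr \<alpha> * (b (U i z t) * lack z t)" for z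
    proof -
      have "\<bar>U i z t * (1 - U i z t)\<bar> = U i z t * (1 - U i z t)"
        using well_factor_bounds(1)[of "U i z t"] U_range[of t i z] t by simp
      then show ?thesis using steepness_U_pos[of t i z] t eps
        unfolding equation'[OF t(1)] A_def b_def steepness_slope_def by (simp add: field_simps)
    qed
    have damping: "(1 - 2 * ?ux) / ?qx - (1 - 2 * ?uy) / ?qy \<le> - 2 * l"
      unfolding l_def using rg t uxy by (intro damping_increment[OF mu P]) auto
    have bdiff: "\<bar>b ?ux - b ?uy\<bar> \<le> 2 * l"
    proof -
      have "\<bar>b ?ux - b ?uy\<bar> \<le> sqrt 2 * l"
        unfolding l_def b_def using rg t uxy by (intro forcing_weight_increment[OF mu P]) auto
      also have "\<dots> \<le> 2 * l" using l real_sqrt_le_mono[of 2 4] by (intro mult_right_mono) auto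
      finally show ?thesis .
    qed
    have bx: "\<bar>b ?ux\<bar> \<le> 1" unfolding b_def by (rule forcing_weight_le_1) (use mu U_range t in auto)
    \<comment> \<open>maximality against the other components, and against the reversed pair of points\<close>
    have Pdiff: "\<bar>P (U j x t) - P (U j y t)\<bar> \<le> l" for j
    proof -
      have "\<epsilon> * (P (U j x t) - P (U j y t)) \<le> \<epsilon> * l"
        using max[of j x v] unfolding wp l_def by (simp add: w_def y_def right_diff_distrib)
      moreover have "\<epsilon> * (P (U j y t) - P (U j x t)) \<le> \<epsilon> * l"
        using max[of j y "- v"] unfolding wp l_def by (simp add: w_def y_def right_diff_distrib)
      ultimately show ?thesis using eps by (simp add: abs_le_iff)
    qed
    have lackdiff: "\<bar>lack x t - lack y t\<bar> \<le> real CARD('n) * l"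
    proof -
      have "\<bar>lack x t - lack y t\<bar> = \<bar>\<Sum>j\<in>UNIV. phi (U j y t) - phi (U j x t)\<bar>"
        by (simp add: lack_def sum_subtractf)
      also have "\<dots> \<le> (\<Sum>j\<in>UNIV. \<bar>phi (U j y t) - phi (U j x t)\<bar>)" by (rule sum_abs)
      also have "\<dots> \<le> (\<Sum>j\<in>(UNIV :: 'n set). l)"
      proof (rule sum_mono)
        fix j
        have "\<bar>phi (U j y t) - phi (U j x t)\<bar> \<le> \<bar>P (U j y t) - P (U j x t)\<bar>"
          by (rule phi_le_profile) (use U_range t in auto)
        then show "\<bar>phi (U j y t) - phi (U j x t)\<bar> \<le> l" using Pdiff[of j] by simp
      qed
      finally show ?thesis by simp
    qed
    have "b ?ux * lack x t - b ?uy * lack y t = b ?ux * (lack x t - lack y t) + lack y t * (b ?ux - b ?uy)"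
      by (simp add: algebra_simps)
    also have "\<dots> \<le> \<bar>b ?ux\<bar> * \<bar>lack x t - lack y t\<bar> + \<bar>lack y t\<bar> * \<bar>b ?ux - b ?uy\<bar>"
      unfolding abs_mult[symmetric] by (intro add_mono abs_ge_self)
    also have "\<dots> \<le> 1 * (real CARD('n) * l) + real CARD('n) * (2 * l)"
      by (intro add_mono mult_mono bx lackdiff bdiff lack_bound) (use t l in auto)
    also have "\<dots> = 3 * real CARD('n) * l" by simp
    finally have forcing: "b ?ux * lack x t - b ?uy * lack y t \<le> 3 * real CARD('n) * l" .
    have "D = (A x - A y) + \<mu> / \<epsilon> * ((1 - 2 * ?ux) / ?qx - (1 - 2 * ?uy) / ?qy)
        + 1 / \<epsilon> powr \<alpha> * (b ?ux * lack x t - b ?uy * lack y t)"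
      unfolding D_def rate by (simp add: algebra_simps diff_divide_distrib)
    also have "\<dots> \<le> 0 + \<mu> / \<epsilon> * (- 2 * l) + 1 / \<epsilon> powr \<alpha> * (3 * real CARD('n) * l)"
      using mu eps by (intro add_mono mult_left_mono Axy damping forcing) auto
    also have "\<dots> = l * ((3 * real CARD('n) * \<epsilon> - 2 * \<mu> * \<epsilon> powr \<alpha>) / (\<epsilon> * \<epsilon> powr \<alpha>))"
      using eps by (simp add: field_simps)
    also have "\<dots> \<le> 0"
      using mu_large l eps by (intro mult_nonneg_nonpos divide_nonpos_pos) auto
    finally have "D \<le> 0 * w i p t" by simp
    moreover have "(w i p has_real_derivative D) (at t)"
    proof -
      have "((\<lambda>t. \<epsilon> * P (U i z t)) has_real_derivative \<epsilon> * (1 / steepness \<mu> (U i z t) * Ut i z t)) (at t)" for z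
        by (intro DERIV_cmult DERIV_chain2[where f = P] P Ut U_range') (use t in auto)
      then have "((\<lambda>t. \<epsilon> * P (U i x t) - \<epsilon> * P (U i y t) - norm v) has_real_derivative
          \<epsilon> * (1 / ?qx * Ut i x t) - \<epsilon> * (1 / ?qy * Ut i y t) - 0) (at t)"
        by (intro DERIV_diff DERIV_const) auto
      moreover have "w i p = (\<lambda>t. \<epsilon> * P (U i x t) - \<epsilon> * P (U i y t) - norm v)"
        by (simp add: w_def p y_def fun_eq_iff)
      ultimately show ?thesis by (simp add: D_def)
    qed
    ultimately show "\<exists>D. (w i p has_real_derivative D) (at t) \<and> D \<le> 0 * w i p t" by blast
  qed (use that assms in \<open>auto intro: compact_Times\<close>)
  show ?thesis
  proof (cases "norm (y - x) \<le> R")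
    case True
    obtain m where m: "x + m \<in> cbox 0 1" "\<And>i y. U i (y + m) T = U i y T"
      using periodic_representative[of T x] assms by auto
    have "w i (x + m, y - x) T = \<epsilon> * P (U i (x + m) T) - \<epsilon> * P (U i (y + m) T) - norm (y - x)"
      by (simp add: w_def add.commute)
    then show ?thesis using main[of "(x + m, y - x)" i] m True by (simp only: m(2)) (simp add: norm_minus_commute)
  next
    case False
    then show ?thesis using R[OF assms, of i x y] by (simp add: norm_minus_commute)
  qed
qed

text \<open>
  The two-point bound along the direction of the gradient, in the limit of coinciding points.
\<close>
lemma gradient_bound:
  assumes t: "0 < t"
  shows "(\<Sum>k\<in>UNIV. (\<epsilon> * U1 i k x t)\<^sup>2) \<le> (steepness \<mu> (U i x t))\<^sup>2"
proof -
  define a where "a = ((\<chi> k. U1 i k x t) :: real ^ 'd)"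
  let ?q = "steepness \<mu> (U i x t)"
  have q: "0 < ?q" using steepness_U_pos t by simp
  have "((\<lambda>s::real. x + s *\<^sub>R a) has_derivative (\<lambda>s. s *\<^sub>R a)) (at 0)"
    by (auto intro!: derivative_eq_intros)
  moreover have "((\<lambda>y. U i y t) has_derivative (\<lambda>h. \<Sum>k\<in>UNIV. U1 i k x t * h $ k)) (at (x + 0 *\<^sub>R a))"
    using U1[OF t] by simp
  ultimately have "((\<lambda>s. U i (x + s *\<^sub>R a) t) has_derivative (\<lambda>s. \<Sum>k\<in>UNIV. U1 i k x t * (s *\<^sub>R a) $ k)) (at 0)"
    by (rule has_derivative_compose)
  then have "((\<lambda>s. U i (x + s *\<^sub>R a) t) has_real_derivative (norm a)\<^sup>2) (at 0)"
    by (rule has_derivative_imp_has_field_derivative)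
       (simp add: norm_vec_squared, simp add: a_def sum_distrib_left power2_eq_square mult_ac)
  moreover have "(P has_real_derivative 1 / ?q) (at (U i (x + 0 *\<^sub>R a) t))"
    using P[OF U_range', of t i x] t by simp
  ultimately have "((\<lambda>s. P (U i (x + s *\<^sub>R a) t)) has_real_derivative 1 / ?q * (norm a)\<^sup>2) (at 0)"
    by (rule DERIV_chain2[where f = P, rotated])
  then have der: "((\<lambda>s. \<epsilon> * P (U i (x + s *\<^sub>R a) t) - s * norm a) has_real_derivative \<epsilon> * (1 / ?q * (norm a)\<^sup>2) - norm a) (at 0)"
    by (auto intro!: derivative_eq_intros)
  have "\<epsilon> * (1 / ?q * (norm a)\<^sup>2) - norm a \<le> 0"
  proof (rule ccontr)
    assume "\<not> \<epsilon> * (1 / ?q * (norm a)\<^sup>2) - norm a \<le> 0"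
    then obtain d where d: "0 < d" "\<And>h. 0 < h \<Longrightarrow> h < d \<Longrightarrow>
        \<epsilon> * P (U i (x + 0 *\<^sub>R a) t) - 0 * norm a < \<epsilon> * P (U i (x + (0 + h) *\<^sub>R a) t) - (0 + h) * norm a"
      using DERIV_pos_inc_right[OF der] by auto
    have "\<epsilon> * P (U i (x + (d / 2) *\<^sub>R a) t) - \<epsilon> * P (U i x t) \<le> d / 2 * norm a"
      using two_point_bound[of t i "x + (d / 2) *\<^sub>R a" x] t d(1) by simp
    then show False using d(2)[of "d / 2"] d(1) by simp
  qed
  then have "norm a * (\<epsilon> * norm a) \<le> norm a * ?q" using q by (simp add: field_simps power2_eq_square)
  then have "\<epsilon> * norm a \<le> ?q"
    using q by (cases "norm a = 0") auto
  then have "(\<epsilon> * norm a)\<^sup>2 \<le> ?q\<^sup>2" using eps by (intro power_mono) auto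
  then show ?thesis by (simp add: power_mult_distrib norm_vec_squared a_def sum_distrib_left)
qed

end

end

section \<open>Dissipation of the energy\<close>

lemma integral_by_parts_periodic:
  fixes f g :: "real ^ 'd \<Rightarrow> real"
  assumes f: "periodic f" "continuous_on UNIV f" "has_partial k f f'"
    and g: "periodic g" "continuous_on UNIV g" "has_partial k g g'"
    and f': "\<And>x. x \<in> cbox 0 2 \<Longrightarrow> \<bar>f' x\<bar> \<le> B" and g': "continuous_on UNIV g'"
  shows "((\<lambda>x. f' x * g x) has_integral - integral (cbox 0 1) (\<lambda>x. f x * g' x)) (cbox 0 1)"
proof -
  obtain Bg where Bg: "\<And>x. x \<in> cbox 0 (2 :: real ^ 'd) \<Longrightarrow> norm (g x) \<le> Bg"
    by (rule continuous_on_compact_bound[OF compact_cbox continuous_on_subset[OF g(2) subset_UNIV]]) blast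
  obtain Bf where Bf: "\<And>x. x \<in> cbox 0 (2 :: real ^ 'd) \<Longrightarrow> norm (f x * g' x) \<le> Bf"
    by (rule continuous_on_compact_bound[of "cbox 0 2" "\<lambda>x. f x * g' x"])
       (auto intro!: continuous_intros continuous_on_subset[OF f(2)] continuous_on_subset[OF g'])
  have sum: "((\<lambda>x. f' x * g x + f x * g' x) has_integral 0) (cbox 0 1)"
  proof (rule integral_partial_periodic[where f = "\<lambda>x. f x * g x" and B = "B * Bg + Bf"])
    show "periodic (\<lambda>x. f x * g x)" using f g by (simp add: periodic_def)
    show "continuous_on UNIV (\<lambda>x. f x * g x)" using f g by (intro continuous_intros)
    show "has_partial k (\<lambda>x. f x * g x) (\<lambda>x. f' x * g x + f x * g' x)"
      by (rule has_partial_mult[OF f(3) g(3)])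
    fix x :: "real ^ 'd" assume x: "x \<in> cbox 0 2"
    have "\<bar>f' x * g x\<bar> \<le> B * Bg" unfolding abs_mult
      using f'[OF x] Bg[OF x] by (intro mult_mono) auto
    then show "\<bar>f' x * g x + f x * g' x\<bar> \<le> B * Bg + Bf" using Bf[OF x] by (auto simp: abs_le_iff)
  qed
  have "((\<lambda>x. f x * g' x) has_integral integral (cbox 0 1) (\<lambda>x. f x * g' x)) (cbox 0 1)"
    by (intro integrable_integral integrable_continuous continuous_intros continuous_on_subset[OF f(2)] continuous_on_subset[OF g']) auto
  from has_integral_diff[OF sum this] show ?thesis by simp
qed

lemma continuous_at_left_end:
  fixes f :: "real \<Rightarrow> real"
  assumes "continuous_on {0..} f" "0 < e"
  obtains d where "0 < d" "\<And>t. 0 \<le> t \<Longrightarrow> t < d \<Longrightarrow> \<bar>f t - f 0\<bar> < e"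
proof -
  obtain d where "0 < d" "\<forall>t\<in>{0..}. dist t 0 < d \<longrightarrow> dist (f t) (f 0) < e"
    using assms(1)[unfolded continuous_on_iff, rule_format, OF _ assms(2), of 0] by auto
  then show ?thesis using that[of d] by (simp add: dist_real_def)
qed

context allen_cahn_flow
begin

definition lap :: "'n \<Rightarrow> real ^ 'd \<Rightarrow> real \<Rightarrow> real" where
  "lap i x t = (\<Sum>k\<in>UNIV. U2 i k x t)"

text \<open>
  All zeroth-order terms of the equation, so that \<open>\<partial>\<^sub>t u\<^sub>i = \<Delta>u\<^sub>i + reaction\<close>.  It is continuous up to
  time zero, which is not known of the derivatives of the solution.
\<close>
definition reaction :: "'n \<Rightarrow> real ^ 'd \<Rightarrow> real \<Rightarrow> real" where
  "reaction i x t = (1 / \<epsilon> powr \<alpha> * (sqrt 2 * \<bar>U i x t * (1 - U i x t)\<bar>) * lack x t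
     - 1 / \<epsilon> * (2 * (U i x t * (1 - U i x t)) * (1 - 2 * U i x t))) / \<epsilon>"

definition dirichlet :: "real ^ 'd \<Rightarrow> real \<Rightarrow> real" where
  "dirichlet x t = (\<Sum>i\<in>UNIV. \<Sum>k\<in>UNIV. (U1 i k x t)\<^sup>2)"

definition potential :: "real ^ 'd \<Rightarrow> real \<Rightarrow> real" where
  "potential x t = 1 / \<epsilon> * (\<Sum>i\<in>UNIV. double_well (U i x t)) + 1 / (2 * \<epsilon> powr \<alpha>) * (lack x t)\<^sup>2"

definition total_energy :: "real \<Rightarrow> real" where
  "total_energy t = integral (cbox 0 1) (\<lambda>x. \<epsilon> / 2 * dirichlet x t + potential x t)"

lemma lap_continuous' [continuous_intros]:
  assumes "continuous_on A f" "continuous_on A g" "\<And>z. z \<in> A \<Longrightarrow> 0 < g z"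
  shows "continuous_on A (\<lambda>z. lap i (f z) (g z))"
  unfolding lap_def by (rule continuous_on_sum, rule U2_continuous'[OF assms])

lemma dirichlet_continuous' [continuous_intros]:
  assumes "continuous_on A f" "continuous_on A g" "\<And>z. z \<in> A \<Longrightarrow> 0 < g z"
  shows "continuous_on A (\<lambda>z. dirichlet (f z) (g z))"
  unfolding dirichlet_def by (intro continuous_on_sum continuous_on_power U1_continuous' assms)

lemma potential_continuous' [continuous_intros]:
  assumes "continuous_on A f" "continuous_on A g" "\<And>z. z \<in> A \<Longrightarrow> 0 \<le> g z"
  shows "continuous_on A (\<lambda>z. potential (f z) (g z))"
  unfolding potential_def
  by (intro continuous_on_add continuous_on_mult continuous_on_const continuous_on_sum continuous_on_power
      continuous_on_double_well U_continuous' lack_continuous' assms)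

lemma reaction_continuous' [continuous_intros]:
  assumes "continuous_on A f" "continuous_on A g" "\<And>z. z \<in> A \<Longrightarrow> 0 \<le> g z"
  shows "continuous_on A (\<lambda>z. reaction i (f z) (g z))"
  unfolding reaction_def
  by (intro continuous_on_diff continuous_on_divide continuous_on_mult continuous_on_const continuous_on_rabs
      U_continuous' lack_continuous' assms) (use eps in auto)

lemma reaction_diffusion: "0 < t \<Longrightarrow> Ut i x t = lap i x t + reaction i x t"
  using equation'[of t i x] eps by (simp add: lap_def reaction_def field_simps)

lemma U1_periodic: "0 < t \<Longrightarrow> periodic (\<lambda>x. U1 i k x t)"
  using periodic_partial[OF U1_partial U_periodic] by simp

lemma integrable_cell: "continuous_on UNIV f \<Longrightarrow> f integrable_on cbox 0 (1 :: real ^ 'd)" for f :: "real ^ 'd \<Rightarrow> real"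
  by (rule integrable_continuous) (rule continuous_on_subset[OF _ subset_UNIV])

text \<open>
  The first factor is only assumed to have bounded partial derivatives, because it will also be the
  difference between the solution and its initial data.
\<close>
lemma green:
  assumes f: "\<And>i. periodic (f i)" "\<And>i. continuous_on UNIV (f i)" "\<And>i k. has_partial k (f i) (f' i k)"
    and f': "\<And>i k. \<exists>B. \<forall>x\<in>cbox 0 2. \<bar>f' i k x\<bar> \<le> B" and t: "0 < t"
  shows "((\<lambda>x. \<Sum>i\<in>UNIV. \<Sum>k\<in>UNIV. f' i k x * U1 i k x t) has_integral
    - integral (cbox 0 1) (\<lambda>x. \<Sum>i\<in>UNIV. f i x * lap i x t)) (cbox 0 1)"
proof -
  have one: "((\<lambda>x. f' i k x * U1 i k x t) has_integral - integral (cbox 0 1) (\<lambda>x. f i x * U2 i k x t)) (cbox 0 1)" for i k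
  proof -
    obtain B where "\<And>x. x \<in> cbox 0 2 \<Longrightarrow> \<bar>f' i k x\<bar> \<le> B" using f' by blast
    then show ?thesis
      by (intro integral_by_parts_periodic[OF f U1_periodic[OF t] _ U2[OF t]])
         (use t in \<open>auto intro!: continuous_intros\<close>)
  qed
  have "((\<lambda>x. \<Sum>i\<in>UNIV. \<Sum>k\<in>UNIV. f' i k x * U1 i k x t) has_integral
      (\<Sum>i\<in>UNIV. \<Sum>k\<in>UNIV. - integral (cbox 0 1) (\<lambda>x. f i x * U2 i k x t))) (cbox 0 1)"
    by (intro has_integral_sum one) auto
  moreover have "(\<Sum>i\<in>UNIV. \<Sum>k\<in>UNIV. integral (cbox 0 1) (\<lambda>x. f i x * U2 i k x t)) =
     integral (cbox 0 1) (\<lambda>x. \<Sum>i\<in>UNIV. \<Sum>k\<in>UNIV. f i x * U2 i k x t)"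
    using t by (subst integral_sum, simp, (intro integrable_cell continuous_intros f; simp), subst integral_sum)
      (auto intro!: integrable_cell continuous_intros f)
  ultimately show ?thesis by (simp add: lap_def sum_distrib_left sum_negf)
qed

lemma U1_bounded:
  assumes "0 < t"
  shows "\<exists>B. \<forall>x\<in>cbox 0 2. \<bar>U1 i k x t\<bar> \<le> B"
proof -
  have "continuous_on (cbox 0 2) (\<lambda>x. U1 i k x t)" using assms by (intro continuous_intros) auto
  then obtain B where "\<And>x. x \<in> cbox 0 2 \<Longrightarrow> norm (U1 i k x t) \<le> B"
    using continuous_on_compact_bound[OF compact_cbox] by blast
  then show ?thesis by auto
qed

text \<open>
  The form \<open>\<integral> u(r) \<sqdot> \<Delta>u(s)\<close>, minus the Dirichlet energy on the diagonal.  It can be differentiated in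
  its first time without differentiating \<open>\<nabla>u\<close> in time, for which there is no regularity.
\<close>
definition pairing :: "real \<Rightarrow> real \<Rightarrow> real" where
  "pairing r s = integral (cbox 0 1) (\<lambda>x. \<Sum>i\<in>UNIV. U i x r * lap i x s)"

definition pairing_rate :: "real \<Rightarrow> real \<Rightarrow> real" where
  "pairing_rate r s = integral (cbox 0 1) (\<lambda>x. \<Sum>i\<in>UNIV. Ut i x r * lap i x s)"

lemma pairing_green:
  assumes "0 < r" "0 < s"
  shows "pairing r s = - integral (cbox 0 1) (\<lambda>x. \<Sum>i\<in>UNIV. \<Sum>k\<in>UNIV. U1 i k x r * U1 i k x s)"
proof -
  have "((\<lambda>x. \<Sum>i\<in>UNIV. \<Sum>k\<in>UNIV. U1 i k x r * U1 i k x s) has_integral - pairing r s) (cbox 0 1)"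
    unfolding pairing_def
    by (rule green[where f = "\<lambda>i x. U i x r"]) (use assms in \<open>auto intro!: U_periodic U1_partial U1_bounded continuous_intros\<close>)
  then show ?thesis by (simp add: integral_unique)
qed

lemma pairing_sym: "0 < r \<Longrightarrow> 0 < s \<Longrightarrow> pairing r s = pairing s r"
  by (simp add: pairing_green mult.commute)

lemma pairing_diag: "0 < t \<Longrightarrow> integral (cbox 0 1) (\<lambda>x. dirichlet x t) = - pairing t t"
  by (simp add: pairing_green dirichlet_def power2_eq_square)

lemma pairing_has_derivative:
  assumes "0 < r" "0 < s"
  shows "((\<lambda>r. pairing r s) has_real_derivative pairing_rate r s) (at r)"
  unfolding pairing_def pairing_rate_def
  by (rule torus_integral_has_derivative)
     (use assms in \<open>auto intro!: derivative_eq_intros continuous_intros Ut simp: case_prod_unfold\<close>)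

lemma pairing_rate_continuous:
  "continuous_on ({0<..} \<times> {0<..}) (\<lambda>p. pairing_rate (fst p) (snd p))"
  unfolding pairing_rate_def
  by (rule torus_integral_continuous) (auto intro!: continuous_intros simp: case_prod_unfold)

text \<open>
  By symmetry the increment of the form along the diagonal is the increment of
  \<open>r \<mapsto> pairing r t' + pairing r t\<close>, to which the mean value theorem applies.
\<close>
lemma pairing_diag_has_derivative:
  assumes t: "0 < t"
  shows "((\<lambda>t. pairing t t) has_real_derivative 2 * pairing_rate t t) (at t)"
  unfolding has_field_derivative_iff
proof (rule LIM_I)
  fix e :: real assume e: "0 < e"
  have "continuous (at (t, t) within {0<..} \<times> {0<..}) (\<lambda>p. pairing_rate (fst p) (snd p))"
    using pairing_rate_continuous t by (auto simp: continuous_on_eq_continuous_within)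
  then obtain d where d: "0 < d" "\<And>p. p \<in> {0<..} \<times> {0<..} \<Longrightarrow> dist p (t, t) < d \<Longrightarrow>
      dist (pairing_rate (fst p) (snd p)) (pairing_rate t t) < e / 2"
    unfolding continuous_within_eps_delta using e by (metis fst_conv snd_conv half_gt_zero)
  have near: "\<bar>pairing_rate r s - pairing_rate t t\<bar> < e / 2" if "\<bar>r - t\<bar> < d / 2" "\<bar>s - t\<bar> < d / 2" "0 < r" "0 < s" for r s
  proof -
    have "dist (r, s) (t, t) \<le> \<bar>r - t\<bar> + \<bar>s - t\<bar>"
      unfolding dist_prod_def using sqrt_sum_squares_le_sum_abs by (simp add: dist_real_def)
    then show ?thesis using d(2)[of "(r, s)"] that by (simp add: dist_real_def)
  qed
  show "\<exists>b>0. \<forall>t'. t' \<noteq> t \<and> norm (t' - t) < b \<longrightarrow> norm ((pairing t' t' - pairing t t) / (t' - t) - 2 * pairing_rate t t) < e"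
  proof (intro exI conjI allI impI)
    show "0 < min (d / 2) t" using d t by simp
    fix t' assume "t' \<noteq> t \<and> norm (t' - t) < min (d / 2) t"
    then have t': "t' \<noteq> t" "\<bar>t' - t\<bar> < d / 2" "0 < t'" by auto
    define h where "h = (\<lambda>r. pairing r t' + pairing r t)"
    have dh: "(h has_real_derivative pairing_rate r t' + pairing_rate r t) (at r)" if "0 < r" for r
      unfolding h_def by (intro DERIV_add pairing_has_derivative that t t')
    have "\<exists>z. 0 < z \<and> \<bar>z - t\<bar> < d / 2 \<and> h t' - h t = (t' - t) * (pairing_rate z t' + pairing_rate z t)"
    proof (cases "t < t'")
      case True
      then obtain z where "t < z" "z < t'" "h t' - h t = (t' - t) * (pairing_rate z t' + pairing_rate z t)"
        using MVT2[of t t' h "\<lambda>r. pairing_rate r t' + pairing_rate r t"] dh t by fastforce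
      then show ?thesis using t t' by (intro exI[of _ z]) auto
    next
      case False
      then obtain z where "t' < z" "z < t" "h t - h t' = (t - t') * (pairing_rate z t' + pairing_rate z t)"
        using MVT2[of t' t h "\<lambda>r. pairing_rate r t' + pairing_rate r t"] dh t t' by fastforce
      then show ?thesis using t t' by (intro exI[of _ z]) (auto simp: algebra_simps)
    qed
    then obtain z where z: "0 < z" "\<bar>z - t\<bar> < d / 2" "h t' - h t = (t' - t) * (pairing_rate z t' + pairing_rate z t)"
      by blast
    have "h t' - h t = pairing t' t' - pairing t t"
      using pairing_sym[OF t t'(3)] by (simp add: h_def)
    then have "(pairing t' t' - pairing t t) / (t' - t) = (t' - t) * (pairing_rate z t' + pairing_rate z t) / (t' - t)"
      using z(3) by simp
    also have "\<dots> = pairing_rate z t' + pairing_rate z t"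
      using t'(1) by simp
    finally have "(pairing t' t' - pairing t t) / (t' - t) = pairing_rate z t' + pairing_rate z t" .
    moreover have "\<bar>pairing_rate z t' - pairing_rate t t\<bar> < e / 2" "\<bar>pairing_rate z t - pairing_rate t t\<bar> < e / 2"
      using near z t t' d by auto
    ultimately show "norm ((pairing t' t' - pairing t t) / (t' - t) - 2 * pairing_rate t t) < e"
      unfolding real_norm_def by linarith
  qed
qed

lemma lack_has_derivative:
  assumes "0 < t"
  shows "(lack x has_real_derivative - (\<Sum>i\<in>UNIV. sqrt 2 * \<bar>U i x t * (1 - U i x t)\<bar> * Ut i x t)) (at t)"
proof -
  have "((\<lambda>t. phi (U i x t)) has_real_derivative sqrt 2 * \<bar>U i x t * (1 - U i x t)\<bar> * Ut i x t) (at t)" for i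
    by (rule DERIV_chain2[where f = phi, OF phi_has_derivative Ut[OF assms]])
  then have "((\<lambda>t. surface_tension - (\<Sum>j\<in>UNIV. phi (U j x t))) has_real_derivative
      0 - (\<Sum>i\<in>UNIV. sqrt 2 * \<bar>U i x t * (1 - U i x t)\<bar> * Ut i x t)) (at t)"
    by (intro DERIV_diff DERIV_const DERIV_sum)
  then show ?thesis by (simp add: lack_def [abs_def])
qed

lemma potential_has_derivative:
  assumes t: "0 < t"
  shows "(potential x has_real_derivative - \<epsilon> * (\<Sum>i\<in>UNIV. reaction i x t * Ut i x t)) (at t)"
proof -
  have dW: "((\<lambda>t. double_well (U i x t)) has_real_derivative
      2 * (U i x t * (1 - U i x t)) * (1 - 2 * U i x t) * Ut i x t) (at t)" for i
    by (rule DERIV_chain2[where f = double_well, OF double_well_has_derivative Ut[OF t]])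
  have "(potential x has_real_derivative
      1 / \<epsilon> * (\<Sum>i\<in>UNIV. 2 * (U i x t * (1 - U i x t)) * (1 - 2 * U i x t) * Ut i x t)
      + 1 / (2 * \<epsilon> powr \<alpha>) * (2 * lack x t * - (\<Sum>i\<in>UNIV. sqrt 2 * \<bar>U i x t * (1 - U i x t)\<bar> * Ut i x t))) (at t)"
    unfolding potential_def [abs_def]
    by (intro DERIV_add DERIV_cmult DERIV_sum dW)
       (rule DERIV_cong[OF DERIV_power[OF lack_has_derivative[OF t], where n = 2]], simp)
  also have "1 / \<epsilon> * (\<Sum>i\<in>UNIV. 2 * (U i x t * (1 - U i x t)) * (1 - 2 * U i x t) * Ut i x t)
      + 1 / (2 * \<epsilon> powr \<alpha>) * (2 * lack x t * - (\<Sum>i\<in>UNIV. sqrt 2 * \<bar>U i x t * (1 - U i x t)\<bar> * Ut i x t))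
      = (\<Sum>i\<in>UNIV. 1 / \<epsilon> * (2 * (U i x t * (1 - U i x t)) * (1 - 2 * U i x t) * Ut i x t)
          - 1 / \<epsilon> powr \<alpha> * (lack x t * (sqrt 2 * \<bar>U i x t * (1 - U i x t)\<bar> * Ut i x t)))"
    by (simp add: sum_subtractf sum_distrib_left [symmetric] sum_divide_distrib [symmetric])
  also have "\<dots> = - \<epsilon> * (\<Sum>i\<in>UNIV. reaction i x t * Ut i x t)"
    unfolding sum_distrib_left by (rule sum.cong[OF refl]) (use eps in \<open>simp add: reaction_def field_simps\<close>)
  finally show ?thesis .
qed

lemma total_energy_split:
  assumes "0 < t"
  shows "total_energy t = - (\<epsilon> / 2) * pairing t t + integral (cbox 0 1) (\<lambda>x. potential x t)"
proof -
  have "total_energy t = integral (cbox 0 1) (\<lambda>x. \<epsilon> / 2 * dirichlet x t) + integral (cbox 0 1) (\<lambda>x. potential x t)"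
    unfolding total_energy_def using assms
    by (intro Henstock_Kurzweil_Integration.integral_add integrable_cell continuous_intros) auto
  then show ?thesis using pairing_diag[OF assms] by simp
qed

text \<open>
  The system is the gradient flow of the energy, up to the factor \<open>\<epsilon>\<close>.
\<close>
lemma energy_dissipation:
  assumes t: "0 < t"
  shows "(total_energy has_real_derivative - \<epsilon> * integral (cbox 0 1) (\<lambda>x. \<Sum>i\<in>UNIV. (Ut i x t)\<^sup>2)) (at t)"
proof -
  have dpot: "((\<lambda>t. integral (cbox 0 1) (\<lambda>x. potential x t)) has_real_derivative
      integral (cbox 0 1) (\<lambda>x. - \<epsilon> * (\<Sum>i\<in>UNIV. reaction i x t * Ut i x t))) (at t)"
    by (rule torus_integral_has_derivative[OF potential_has_derivative])
       (use t in \<open>auto intro!: continuous_intros simp: case_prod_unfold\<close>)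
  have "((\<lambda>t. - (\<epsilon> / 2) * pairing t t + integral (cbox 0 1) (\<lambda>x. potential x t)) has_real_derivative
      - (\<epsilon> / 2) * (2 * pairing_rate t t) + integral (cbox 0 1) (\<lambda>x. - \<epsilon> * (\<Sum>i\<in>UNIV. reaction i x t * Ut i x t))) (at t)"
    by (intro DERIV_add DERIV_cmult pairing_diag_has_derivative dpot t)
  moreover have "- (\<epsilon> / 2) * (2 * pairing_rate t t) + integral (cbox 0 1) (\<lambda>x. - \<epsilon> * (\<Sum>i\<in>UNIV. reaction i x t * Ut i x t))
      = - \<epsilon> * (pairing_rate t t + integral (cbox 0 1) (\<lambda>x. \<Sum>i\<in>UNIV. reaction i x t * Ut i x t))"
    by (simp add: algebra_simps)
  also have "pairing_rate t t + integral (cbox 0 1) (\<lambda>x. \<Sum>i\<in>UNIV. reaction i x t * Ut i x t)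
      = integral (cbox 0 1) (\<lambda>x. (\<Sum>i\<in>UNIV. Ut i x t * lap i x t) + (\<Sum>i\<in>UNIV. reaction i x t * Ut i x t))"
    unfolding pairing_rate_def using t
    by (intro Henstock_Kurzweil_Integration.integral_add[symmetric] integrable_cell continuous_intros) auto
  also have "(\<lambda>x. (\<Sum>i\<in>UNIV. Ut i x t * lap i x t) + (\<Sum>i\<in>UNIV. reaction i x t * Ut i x t)) = (\<lambda>x. \<Sum>i\<in>UNIV. (Ut i x t)\<^sup>2)"
    using t by (simp add: fun_eq_iff sum.distrib [symmetric] reaction_diffusion power2_eq_square algebra_simps)
  finally have "((\<lambda>t. - (\<epsilon> / 2) * pairing t t + integral (cbox 0 1) (\<lambda>x. potential x t)) has_real_derivative
      - \<epsilon> * integral (cbox 0 1) (\<lambda>x. \<Sum>i\<in>UNIV. (Ut i x t)\<^sup>2)) (at t)" .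
  moreover have "eventually (\<lambda>t. - (\<epsilon> / 2) * pairing t t + integral (cbox 0 1) (\<lambda>x. potential x t) = total_energy t) (nhds t)"
    using eventually_nhds_in_open[OF open_greaterThan, of t 0] t
    by (auto elim!: eventually_mono simp: total_energy_split)
  ultimately show ?thesis by (subst (asm) DERIV_cong_ev[OF refl _ refl])
qed

lemma energy_decreasing:
  assumes "0 < s" "s \<le> t"
  shows "total_energy t \<le> total_energy s"
proof (rule DERIV_nonpos_imp_nonincreasing[OF assms(2)])
  fix r assume r: "s \<le> r" "r \<le> t"
  have "0 \<le> integral (cbox 0 1) (\<lambda>x. \<Sum>i\<in>UNIV. (Ut i x r)\<^sup>2)"
    by (intro integral_nonneg integrable_cell continuous_intros sum_nonneg) (use r assms in auto)
  then show "\<exists>y. (total_energy has_real_derivative y) (at r) \<and> y \<le> 0"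
    using energy_dissipation[of r] r assms eps by (intro exI conjI) (auto simp: mult_nonneg_nonneg)
qed

section \<open>The energy at small times\<close>

definition initial_dirichlet :: "real ^ 'd \<Rightarrow> real" where
  "initial_dirichlet x = (\<Sum>i\<in>UNIV. \<Sum>k\<in>UNIV. (V1 i k x)\<^sup>2)"

context
  fixes B :: real
  assumes V1_bound: "\<And>i k x. \<bar>V1 i k x\<bar> \<le> B"
begin

lemma V1_limit:
  "(\<lambda>n. (U i (x + inverse (real (Suc n)) *\<^sub>R axis k 1) 0 - U i x 0) / inverse (real (Suc n))) \<longlonglongrightarrow> V1 i k x"
proof -
  have "((\<lambda>r. (U i (x + (0 + r) *\<^sub>R axis k 1) 0 - U i (x + 0 *\<^sub>R axis k 1) 0) / r) \<longlongrightarrow> V1 i k x) (at 0)"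
    using V1_partial unfolding has_partial_def DERIV_def by blast
  moreover have "filterlim (\<lambda>n. inverse (real (Suc n))) (at 0) sequentially"
    unfolding filterlim_at using LIMSEQ_inverse_real_of_nat by auto
  ultimately show ?thesis using filterlim_compose by fastforce
qed

lemma initial_dirichlet_integrable: "initial_dirichlet integrable_on cbox 0 1"
proof -
  have "(\<lambda>x. (V1 i k x)\<^sup>2) integrable_on cbox 0 1" for i k
  proof (rule dominated_convergence(1))
    let ?q = "\<lambda>n x. ((U i (x + inverse (real (Suc n)) *\<^sub>R axis k 1) 0 - U i x 0) / inverse (real (Suc n)))\<^sup>2"
    show "?q n integrable_on cbox 0 1" for n
      by (intro integrable_cell continuous_intros) auto
    show "(\<lambda>x. B\<^sup>2) integrable_on cbox 0 (1 :: real ^ 'd)" by (intro integrable_cell continuous_intros)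
    show "(\<lambda>n. ?q n x) \<longlonglongrightarrow> (V1 i k x)\<^sup>2" for x by (intro tendsto_power V1_limit)
    show "norm (?q n x) \<le> B\<^sup>2" for n x
    proof -
      let ?h = "inverse (real (Suc n))"
      obtain z where z: "0 < z" "z < ?h" "U i (x + ?h *\<^sub>R axis k 1) 0 - U i (x + 0 *\<^sub>R axis k 1) 0 = (?h - 0) * V1 i k (x + z *\<^sub>R axis k 1)"
        using MVT2[of 0 ?h "\<lambda>s. U i (x + s *\<^sub>R axis k 1) 0" "\<lambda>s. V1 i k (x + s *\<^sub>R axis k 1)"] has_partialD[OF V1_partial] by auto
      then have "?q n x = (V1 i k (x + z *\<^sub>R axis k 1))\<^sup>2" by simp
      also have "\<dots> \<le> B\<^sup>2" by (intro abs_le_square_iff[THEN iffD1] order_trans[OF V1_bound abs_ge_self])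
      finally show ?thesis by simp
    qed
  qed
  then show ?thesis unfolding initial_dirichlet_def by (intro integrable_sum) auto
qed

text \<open>
  Let \<open>Q(t)\<close> be the squared distance in \<open>L\<^sup>2\<close> of the solution from its initial data.  Testing the equation with
  \<open>u(t) - u(0)\<close> gives \<open>Q' \<le> \<integral> |\<nabla>u(0)|\<^sup>2 - \<integral> |\<nabla>u(t)|\<^sup>2\<close> up to a reaction term that tends to zero.  If the
  Dirichlet energy stayed larger than its initial value by a fixed amount, then \<open>Q\<close> would decrease
  from \<open>Q(0) = 0\<close>.
\<close>
lemma dirichlet_small_time:
  assumes e: "0 < e" and d: "0 < d"
  shows "\<exists>t. 0 < t \<and> t < d \<and> integral (cbox 0 1) (\<lambda>x. dirichlet x t) < integral (cbox 0 1) initial_dirichlet + e"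
proof (rule ccontr)
  assume "\<not> ?thesis"
  then have large: "integral (cbox 0 1) initial_dirichlet + e \<le> integral (cbox 0 1) (\<lambda>x. dirichlet x t)" if "0 < t" "t < d" for t
    using that by (meson not_less)
  define G where "G = (\<lambda>t. integral (cbox 0 1) (\<lambda>x. \<Sum>i\<in>UNIV. (U i x t - U i x 0) * reaction i x t))"
  define Q where "Q = (\<lambda>t. integral (cbox 0 1) (\<lambda>x. \<Sum>i\<in>UNIV. (U i x t - U i x 0)\<^sup>2))"
  have "continuous_on {0..} G" "continuous_on {0..} Q" unfolding G_def Q_def
    by (rule torus_integral_continuous; auto intro!: continuous_intros simp: case_prod_unfold)+
  then have cont: "continuous_on {0..} G" and contQ: "continuous_on {0..} Q" .
  have G0: "G 0 = 0" and Q0: "Q 0 = 0" by (simp_all add: G_def Q_def)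
  obtain d' where d': "0 < d'" "\<And>t. 0 \<le> t \<Longrightarrow> t < d' \<Longrightarrow> \<bar>G t\<bar> < e / 4"
    using continuous_at_left_end[OF cont, of "e / 4"] e G0 by auto
  have dQ: "\<exists>l. (Q has_real_derivative l) (at t) \<and> l < 0" if t: "0 < t" "t < d" "t < d'" for t
  proof -
    have der: "(Q has_real_derivative integral (cbox 0 1) (\<lambda>x. \<Sum>i\<in>UNIV. 2 * (U i x t - U i x 0) * Ut i x t)) (at t)"
      unfolding Q_def
    proof (rule torus_integral_has_derivative[where h = "\<lambda>x t. \<Sum>i\<in>UNIV. (U i x t - U i x 0)\<^sup>2"])
      show "((\<lambda>t. \<Sum>i\<in>UNIV. (U i x t - U i x 0)\<^sup>2) has_real_derivative (\<Sum>i\<in>UNIV. 2 * (U i x t - U i x 0) * Ut i x t)) (at t)"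
        if "0 < t" for x t
        by (rule DERIV_sum) (auto intro!: derivative_eq_intros Ut that)
    qed (use t in \<open>auto intro!: continuous_intros simp: case_prod_unfold\<close>)
    define S where "S = integral (cbox 0 1) (\<lambda>x. \<Sum>i\<in>UNIV. (U i x t - U i x 0) * lap i x t)"
    have "integral (cbox 0 1) (\<lambda>x. \<Sum>i\<in>UNIV. 2 * (U i x t - U i x 0) * Ut i x t)
        = integral (cbox 0 1) (\<lambda>x. 2 * (\<Sum>i\<in>UNIV. (U i x t - U i x 0) * lap i x t) + 2 * (\<Sum>i\<in>UNIV. (U i x t - U i x 0) * reaction i x t))"
      using t by (simp add: reaction_diffusion sum_distrib_left sum.distrib [symmetric] algebra_simps)
    also have "\<dots> = 2 * S + 2 * G t"
      unfolding S_def G_def using t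
      by (subst Henstock_Kurzweil_Integration.integral_add) (auto intro!: integrable_cell continuous_intros)
    finally have rate: "integral (cbox 0 1) (\<lambda>x. \<Sum>i\<in>UNIV. 2 * (U i x t - U i x 0) * Ut i x t) = 2 * S + 2 * G t" .
    have "((\<lambda>x. \<Sum>i\<in>UNIV. \<Sum>k\<in>UNIV. (U1 i k x t - V1 i k x) * U1 i k x t) has_integral - S) (cbox 0 1)"
      unfolding S_def
    proof (rule green[where f = "\<lambda>i x. U i x t - U i x 0"])
      show "periodic (\<lambda>x. U i x t - U i x 0)" for i
        using U_periodic[of t i] U_periodic[of 0 i] t by (simp add: periodic_def)
      show "has_partial k (\<lambda>x. U i x t - U i x 0) (\<lambda>x. U1 i k x t - V1 i k x)" for i k
        by (rule has_partial_diff[OF U1_partial[OF t(1)] V1_partial])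
      show "\<exists>C. \<forall>x\<in>cbox 0 2. \<bar>U1 i k x t - V1 i k x\<bar> \<le> C" for i k
      proof -
        obtain C where "\<And>x. x \<in> cbox 0 2 \<Longrightarrow> \<bar>U1 i k x t\<bar> \<le> C" using U1_bounded[OF t(1)] by blast
        then show ?thesis using V1_bound by (intro exI[of _ "C + B"]) (meson abs_triangle_ineq4 add_mono order_trans)
      qed
    qed (use t in \<open>auto intro!: continuous_intros\<close>)
    moreover have "((\<lambda>x. dirichlet x t / 2 - initial_dirichlet x / 2) has_integral
        (integral (cbox 0 1) (\<lambda>x. dirichlet x t) / 2 - integral (cbox 0 1) initial_dirichlet / 2)) (cbox 0 1)"
      using t by (intro has_integral_diff has_integral_divide integrable_integral initial_dirichlet_integrable integrable_cell continuous_intros) auto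
    moreover have "dirichlet x t / 2 - initial_dirichlet x / 2 \<le> (\<Sum>i\<in>UNIV. \<Sum>k\<in>UNIV. (U1 i k x t - V1 i k x) * U1 i k x t)" for x
    proof -
      have "a\<^sup>2 / 2 - b\<^sup>2 / 2 \<le> (a - b) * a" for a b :: real
        using zero_le_power2[of "a - b"] by (simp add: power2_eq_square algebra_simps)
      then have "(\<Sum>i\<in>UNIV. \<Sum>k\<in>UNIV. (U1 i k x t)\<^sup>2 / 2 - (V1 i k x)\<^sup>2 / 2) \<le> (\<Sum>i\<in>UNIV. \<Sum>k\<in>UNIV. (U1 i k x t - V1 i k x) * U1 i k x t)"
        by (intro sum_mono)
      then show ?thesis by (simp add: dirichlet_def initial_dirichlet_def sum_subtractf sum_divide_distrib)
    qed
    ultimately have "integral (cbox 0 1) (\<lambda>x. dirichlet x t) / 2 - integral (cbox 0 1) initial_dirichlet / 2 \<le> - S"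
      using has_integral_le by blast
    then have "2 * S + 2 * G t < 0" using large[of t] d'(2)[of t] t e by (auto simp: abs_less_iff)
    then show ?thesis using der rate by auto
  qed
  define b where "b = min d d' / 2"
  have b: "0 < b" "b < d" "b < d'" using d d' by (auto simp: b_def)
  have "\<exists>l z. 0 < z \<and> z < b \<and> (Q has_real_derivative l) (at z) \<and> Q b - Q 0 = (b - 0) * l"
  proof (rule MVT[OF b(1)])
    show "continuous_on {0..b} Q" using contQ by (rule continuous_on_subset) auto
    show "Q differentiable at x" if "0 < x" "x < b" for x
      using dQ[of x] that b by (auto simp: real_differentiable_def)
  qed
  then obtain l z where "0 < z" "z < b" "(Q has_real_derivative l) (at z)" "Q b = b * l" using Q0 by auto
  moreover from this have "l < 0" using dQ[of z] b DERIV_unique by force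
  ultimately have "Q b < 0" using b by (simp add: mult_pos_neg)
  moreover have "0 \<le> Q b"
    unfolding Q_def using b by (intro integral_nonneg integrable_cell continuous_intros sum_nonneg) auto
  ultimately show False by simp
qed

lemma energy_le_initial:
  assumes t: "0 < t"
  shows "total_energy t \<le> integral (cbox 0 1) (\<lambda>x. \<epsilon> / 2 * initial_dirichlet x + potential x 0)"
proof (rule field_le_epsilon)
  fix e :: real assume e: "0 < e"
  let ?p = "\<lambda>t. integral (cbox 0 1) (\<lambda>x. potential x t)"
  have "continuous_on {0..} ?p"
    by (rule torus_integral_continuous) (auto intro!: continuous_intros simp: case_prod_unfold)
  then obtain d where d: "0 < d" "\<And>s. 0 \<le> s \<Longrightarrow> s < d \<Longrightarrow> \<bar>?p s - ?p 0\<bar> < e / 2"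
    using continuous_at_left_end[of ?p "e / 2"] e by auto
  \<comment> \<open>the energy decreases from an earlier time at which it exceeds its initial value by at most \<open>e\<close>\<close>
  obtain s where s: "0 < s" "s < min d t" "integral (cbox 0 1) (\<lambda>x. dirichlet x s) < integral (cbox 0 1) initial_dirichlet + e"
    using dirichlet_small_time[OF e, of "min d t"] d t by auto
  have "total_energy t \<le> total_energy s" using energy_decreasing[of s t] s by simp
  also have "\<dots> = \<epsilon> / 2 * integral (cbox 0 1) (\<lambda>x. dirichlet x s) + ?p s"
    using total_energy_split[OF s(1)] pairing_diag[OF s(1)] by simp
  also have "\<dots> \<le> \<epsilon> / 2 * (integral (cbox 0 1) initial_dirichlet + e) + (?p 0 + e / 2)"
  proof (intro add_mono mult_left_mono)
    show "?p s \<le> ?p 0 + e / 2" using d(2)[of s] s by linarith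
  qed (use s eps in auto)
  also have "\<dots> \<le> (\<epsilon> / 2 * integral (cbox 0 1) initial_dirichlet + ?p 0) + e"
  proof -
    have "\<epsilon> * e \<le> 1 * e" by (rule mult_right_mono[OF eps(2)]) (use e in simp)
    then show ?thesis unfolding distrib_left by linarith
  qed
  also have "\<epsilon> / 2 * integral (cbox 0 1) initial_dirichlet + ?p 0 = integral (cbox 0 1) (\<lambda>x. \<epsilon> / 2 * initial_dirichlet x + potential x 0)"
    by (subst Henstock_Kurzweil_Integration.integral_add)
       (auto intro!: integrable_cell continuous_intros integrable_on_mult_right initial_dirichlet_integrable)
  finally show "total_energy t \<le> integral (cbox 0 1) (\<lambda>x. \<epsilon> / 2 * initial_dirichlet x + potential x 0) + e" .
qed

end

end

section \<open>Testing the equation near the wells\<close>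

text \<open>
  To leading order this is \<open>u\<close> near the well \<open>0\<close> and \<open>u - 1\<close> near the well \<open>1\<close>; in between it is
  bounded by \<open>\<delta>\<close> and its slope is only slightly negative.
\<close>
definition well_test :: "real \<Rightarrow> real \<Rightarrow> real" where
  "well_test \<delta> u = \<delta> * (1 - 2 * u) * (u * (1 - u)) / (\<delta> + u * (1 - u))"

definition well_test_primitive :: "real \<Rightarrow> real \<Rightarrow> real" where
  "well_test_primitive \<delta> u = \<delta> * (u * (1 - u) - \<delta> * ln (1 + u * (1 - u) / \<delta>))"

text \<open>
  The positive term in the derivative of the test function; it is of order one where
  \<open>u (1 - u) \<le> \<delta>\<close>.
\<close>
definition well_weight :: "real \<Rightarrow> real \<Rightarrow> real" where
  "well_weight \<delta> u = \<delta>\<^sup>2 * (1 - 2 * u)\<^sup>2 / (\<delta> + u * (1 - u))\<^sup>2"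

definition well_test_deriv :: "real \<Rightarrow> real \<Rightarrow> real" where
  "well_test_deriv \<delta> u = well_weight \<delta> u - 2 * \<delta> * (u * (1 - u)) / (\<delta> + u * (1 - u))"

context
  fixes \<delta> :: real
  assumes delta: "0 < \<delta>"
begin

lemma well_test_primitive_has_derivative:
  assumes "0 \<le> u" "u \<le> 1"
  shows "(well_test_primitive \<delta> has_real_derivative well_test \<delta> u) (at u)"
proof -
  have s: "0 \<le> u * (1 - u)" using assms by simp
  then have p: "0 < 1 + u * (1 - u) / \<delta>" "\<delta> + u * (1 - u) \<noteq> 0" using delta by (auto intro!: add_pos_nonneg)
  have d: "((\<lambda>u. u * (1 - u)) has_real_derivative (1 - 2 * u)) (at u)"
    by (auto intro!: derivative_eq_intros simp: algebra_simps)
  have "((\<lambda>u. 1 + u * (1 - u) / \<delta>) has_real_derivative (0 + (1 - 2 * u) / \<delta>)) (at u)"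
    by (intro DERIV_add DERIV_const DERIV_cdivide d)
  then have l: "((\<lambda>u. ln (1 + u * (1 - u) / \<delta>)) has_real_derivative
      1 / (1 + u * (1 - u) / \<delta>) * (0 + (1 - 2 * u) / \<delta>)) (at u)"
    by (rule DERIV_chain2[where f = ln, rotated]) (rule DERIV_ln_divide[OF p(1)])
  have alg: "\<delta> * (b - \<delta> * (1 / (1 + r / \<delta>) * (0 + b / \<delta>))) = \<delta> * b * r / (\<delta> + r)"
    if "0 \<le> r" for b r :: real
  proof -
    have "\<delta> * (1 / (1 + r / \<delta>) * (0 + b / \<delta>)) = \<delta> * b / (\<delta> + r)"
      using delta that by (simp add: field_simps)
    moreover have "b = (\<delta> + r) * b / (\<delta> + r)" using delta that by simp
    ultimately have "b - \<delta> * (1 / (1 + r / \<delta>) * (0 + b / \<delta>)) = ((\<delta> + r) * b - \<delta> * b) / (\<delta> + r)"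
      by (simp add: diff_divide_distrib)
    also have "\<dots> = b * r / (\<delta> + r)" by (simp add: algebra_simps)
    finally show ?thesis by simp
  qed
  show ?thesis unfolding well_test_primitive_def [abs_def] well_test_def
    by (rule DERIV_cong[OF DERIV_cmult[OF DERIV_diff[OF d DERIV_cmult[OF l]]] alg[OF s]])
qed

lemma well_test_has_derivative:
  assumes "0 \<le> u" "u \<le> 1"
  shows "(well_test \<delta> has_real_derivative well_test_deriv \<delta> u) (at u)"
proof -
  have s: "0 \<le> u * (1 - u)" using assms by simp
  then have p: "\<delta> + u * (1 - u) \<noteq> 0" using delta by auto
  have n: "((\<lambda>u. \<delta> * (1 - 2 * u) * (u * (1 - u))) has_real_derivative \<delta> * ((1 - 2 * u)\<^sup>2 - 2 * (u * (1 - u)))) (at u)"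
    by (auto intro!: derivative_eq_intros simp: algebra_simps power2_eq_square)
  have d: "((\<lambda>u. \<delta> + u * (1 - u)) has_real_derivative (1 - 2 * u)) (at u)"
    by (auto intro!: derivative_eq_intros simp: algebra_simps)
  have alg: "(\<delta> * (c - 2 * r) * (\<delta> + r) - \<delta> * b * r * b) / ((\<delta> + r) * (\<delta> + r)) = \<delta>\<^sup>2 * c / (\<delta> + r)\<^sup>2 - 2 * \<delta> * r / (\<delta> + r)"
    if "\<delta> + r \<noteq> 0" "c = b\<^sup>2" for b c r :: real
    using that by (simp add: divide_simps power2_eq_square) (simp add: algebra_simps)
  show ?thesis unfolding well_test_def [abs_def] well_test_deriv_def well_weight_def
    by (rule DERIV_cong[OF DERIV_divide[OF n d p] alg[OF p refl]])
qed

lemma well_test_primitive_bounds: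
  assumes "0 \<le> u" "u \<le> 1"
  shows "0 \<le> well_test_primitive \<delta> u" "well_test_primitive \<delta> u \<le> \<delta>"
proof -
  note s = well_factor_bounds[OF assms]
  have "\<delta> * ln (1 + u * (1 - u) / \<delta>) \<le> \<delta> * (u * (1 - u) / \<delta>)"
    using s delta by (intro mult_left_mono ln_add_one_self_le_self) auto
  then show "0 \<le> well_test_primitive \<delta> u" using delta by (simp add: well_test_primitive_def)
  have "0 \<le> \<delta> * ln (1 + u * (1 - u) / \<delta>)" using s delta by (intro mult_nonneg_nonneg ln_ge_zero) auto
  then have "u * (1 - u) - \<delta> * ln (1 + u * (1 - u) / \<delta>) \<le> 1" using s by linarith
  then have "well_test_primitive \<delta> u \<le> \<delta> * 1" unfolding well_test_primitive_def using delta by (intro mult_left_mono) auto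
  then show "well_test_primitive \<delta> u \<le> \<delta>" by simp
qed

text \<open>
  The second bound says that the test function has the sign of \<open>W'\<close>, so that the contribution of the
  potential can be dropped.
\<close>
lemma well_test_bounds:
  assumes "0 \<le> u" "u \<le> 1"
  shows "\<bar>well_test \<delta> u\<bar> \<le> \<delta>" "0 \<le> (1 - 2 * u) * well_test \<delta> u"
proof -
  note s = well_factor_bounds[OF assms]
  have f: "0 \<le> u * (1 - u) / (\<delta> + u * (1 - u))" "u * (1 - u) / (\<delta> + u * (1 - u)) \<le> 1"
    using s delta by auto
  have "\<bar>well_test \<delta> u\<bar> = \<delta> * \<bar>1 - 2 * u\<bar> * (u * (1 - u) / (\<delta> + u * (1 - u)))"
    unfolding well_test_def using s delta assms by (simp add: abs_mult)
  also have "\<dots> \<le> \<delta> * 1 * 1" using f assms delta by (intro mult_mono) auto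
  finally show "\<bar>well_test \<delta> u\<bar> \<le> \<delta>" by simp
  have "(1 - 2 * u) * well_test \<delta> u = \<delta> * (1 - 2 * u)\<^sup>2 * (u * (1 - u) / (\<delta> + u * (1 - u)))"
    by (simp add: well_test_def power2_eq_square)
  also have "\<dots> \<ge> 0" using f delta by (intro mult_nonneg_nonneg) auto
  finally show "0 \<le> (1 - 2 * u) * well_test \<delta> u" .
qed

lemma well_weight_le:
  assumes "0 \<le> u" "u \<le> 1"
  shows "0 \<le> well_weight \<delta> u" "well_weight \<delta> u \<le> well_test_deriv \<delta> u + 2 * \<delta>"
proof -
  note s = well_factor_bounds[OF assms]
  show "0 \<le> well_weight \<delta> u" by (simp add: well_weight_def)
  have "u * (1 - u) / (\<delta> + u * (1 - u)) \<le> 1" using s delta by auto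
  then have "2 * \<delta> * (u * (1 - u) / (\<delta> + u * (1 - u))) \<le> 2 * \<delta> * 1" using delta by (intro mult_left_mono) auto
  then show "well_weight \<delta> u \<le> well_test_deriv \<delta> u + 2 * \<delta>" by (simp add: well_test_deriv_def)
qed

lemma well_weight_near_wells:
  assumes "0 \<le> u" "u \<le> 1" "u * (1 - u) \<le> \<delta>" "\<delta> \<le> 1/16"
  shows "1/6 \<le> well_weight \<delta> u"
proof -
  note s = well_factor_bounds[OF assms(1,2)]
  have "(\<delta> + u * (1 - u))\<^sup>2 \<le> (2 * \<delta>)\<^sup>2" using s assms delta by (intro power_mono) auto
  then have a: "(\<delta> + u * (1 - u))\<^sup>2 \<le> 4 * \<delta>\<^sup>2" by (simp add: power_mult_distrib)
  have "(1 - 2 * u)\<^sup>2 = 1 - 4 * (u * (1 - u))" by (simp add: power2_eq_square algebra_simps)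
  then have "3/4 \<le> (1 - 2 * u)\<^sup>2" using assms by linarith
  then have "\<delta>\<^sup>2 * (3/4) \<le> \<delta>\<^sup>2 * (1 - 2 * u)\<^sup>2" by (intro mult_left_mono) auto
  then have "1/6 * (\<delta> + u * (1 - u))\<^sup>2 \<le> \<delta>\<^sup>2 * (1 - 2 * u)\<^sup>2" using a zero_le_power2[of \<delta>] by linarith
  moreover have "0 < (\<delta> + u * (1 - u))\<^sup>2" using s delta by (intro zero_less_power) auto
  ultimately show ?thesis unfolding well_weight_def by (simp add: field_simps)
qed

end

context allen_cahn_flow
begin

abbreviation component_gradient :: "'n \<Rightarrow> real ^ 'd \<Rightarrow> real \<Rightarrow> real" where
  "component_gradient i x t \<equiv> (\<Sum>k\<in>UNIV. (U1 i k x t)\<^sup>2)"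

lemma dirichlet_nonneg: "0 \<le> dirichlet x t"
  unfolding dirichlet_def by (intro sum_nonneg) auto

lemma potential_nonneg: "0 \<le> potential x t"
proof -
  have "0 \<le> (\<Sum>i\<in>UNIV. double_well (U i x t))" by (rule sum_nonneg) (simp add: double_well_eq)
  then show ?thesis unfolding potential_def using eps by simp
qed

definition discrepancy_plus :: "real ^ 'd \<Rightarrow> real \<Rightarrow> real" where
  "discrepancy_plus x t = max (\<epsilon> / 2 * dirichlet x t - potential x t) 0"

text \<open>
  The assumptions on \<open>\<beta>\<close> say that \<open>\<beta> = \<epsilon>\<^bsup>(1 - \<alpha>)/2\<^esup>\<close>, and the last two assumptions are the
  conclusions of the preceding sections.
\<close>
context
  fixes \<mu> \<delta> \<beta> E0 :: real
  assumes mu: "0 < \<mu>"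
    and delta: "0 < \<delta>" "\<delta> \<le> 1/16"
    and beta: "0 < \<beta>" "\<beta>\<^sup>2 * \<epsilon> powr \<alpha> = \<epsilon>"
    and gradient: "\<And>i x t. 0 < t \<Longrightarrow> (\<Sum>k\<in>UNIV. (\<epsilon> * U1 i k x t)\<^sup>2) \<le> (steepness \<mu> (U i x t))\<^sup>2"
    and energy: "\<And>t. 0 < t \<Longrightarrow> total_energy t \<le> E0"
begin

lemma well_test_continuous:
  assumes "continuous_on A f" "\<And>z. z \<in> A \<Longrightarrow> 0 \<le> f z \<and> f z \<le> 1"
  shows "continuous_on A (\<lambda>z. well_test \<delta> (f z))" "continuous_on A (\<lambda>z. well_test_primitive \<delta> (f z))"
    "continuous_on A (\<lambda>z. well_test_deriv \<delta> (f z))"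
proof -
  have a: "\<delta> + f z * (1 - f z) \<noteq> 0" if "z \<in> A" for z
    using well_factor_bounds(1)[of "f z"] assms(2)[OF that] delta by linarith
  show "continuous_on A (\<lambda>z. well_test \<delta> (f z))" "continuous_on A (\<lambda>z. well_test_deriv \<delta> (f z))"
    unfolding well_test_def well_test_deriv_def well_weight_def
    using a by (auto intro!: continuous_intros assms(1))
  have "1 + f z * (1 - f z) / \<delta> \<noteq> 0" if "z \<in> A" for z
    using assms(2)[OF that] delta by (intro less_imp_neq[symmetric] add_pos_nonneg divide_nonneg_pos mult_nonneg_nonneg) auto
  then show "continuous_on A (\<lambda>z. well_test_primitive \<delta> (f z))"
    unfolding well_test_primitive_def using delta
    by (auto intro!: continuous_intros assms(1))
qed

lemma well_test_green:
  assumes t: "0 < t"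
  shows "((\<lambda>x. \<Sum>i\<in>UNIV. well_test_deriv \<delta> (U i x t) * component_gradient i x t) has_integral
    - integral (cbox 0 1) (\<lambda>x. \<Sum>i\<in>UNIV. well_test \<delta> (U i x t) * lap i x t)) (cbox 0 1)"
proof -
  have rg: "0 \<le> U i x t \<and> U i x t \<le> 1" for i x using U_range t by simp
  have "((\<lambda>x. \<Sum>i\<in>UNIV. \<Sum>k\<in>UNIV. (well_test_deriv \<delta> (U i x t) * U1 i k x t) * U1 i k x t) has_integral
    - integral (cbox 0 1) (\<lambda>x. \<Sum>i\<in>UNIV. well_test \<delta> (U i x t) * lap i x t)) (cbox 0 1)"
  proof (rule green[OF _ _ _ _ t])
    show "periodic (\<lambda>x. well_test \<delta> (U i x t))" for i using U_periodic[of t i] t by (simp add: periodic_def)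
    show "continuous_on UNIV (\<lambda>x. well_test \<delta> (U i x t))" for i
      by (rule well_test_continuous) (use t rg in \<open>auto intro!: continuous_intros\<close>)
    show "has_partial k (\<lambda>x. well_test \<delta> (U i x t)) (\<lambda>x. well_test_deriv \<delta> (U i x t) * U1 i k x t)" for i k
      by (rule has_partial_compose[OF U1_partial[OF t] well_test_has_derivative[OF delta(1)]]) (use rg in auto)
    show "\<exists>B. \<forall>x\<in>cbox 0 2. \<bar>well_test_deriv \<delta> (U i x t) * U1 i k x t\<bar> \<le> B" for i k
    proof -
      have "continuous_on (cbox 0 2) (\<lambda>x. well_test_deriv \<delta> (U i x t) * U1 i k x t)"
        by (intro continuous_intros well_test_continuous) (use t rg in auto)
      then obtain B where "\<And>x. x \<in> cbox 0 2 \<Longrightarrow> norm (well_test_deriv \<delta> (U i x t) * U1 i k x t) \<le> B"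
        using continuous_on_compact_bound[OF compact_cbox] by blast
      then show ?thesis by auto
    qed
  qed
  then show ?thesis by (simp add: sum_distrib_left power2_eq_square mult.assoc)
qed

text \<open>
  Of the reaction only the forcing matters.  It is the product of \<open>sqrt W\<close> and the lack of total
  phase, and the energy controls these two with the weights \<open>1/\<epsilon>\<close> and \<open>\<epsilon>\<^bsup>-\<alpha>\<^esup>\<close>.  The inequality
  between arithmetic and geometric means turns the mismatch of the powers of \<open>\<epsilon>\<close> into the gain \<open>\<beta>\<close>.
\<close>
lemma reaction_test_le:
  assumes t: "0 < t"
  shows "\<epsilon> * (\<Sum>i\<in>UNIV. well_test \<delta> (U i x t) * reaction i x t) \<le> 2 * real CARD('n) * \<beta> * potential x t"
proof -
  let ?C = "\<epsilon> powr \<alpha>" and ?l = "\<bar>lack x t\<bar>"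
  let ?s = "\<lambda>i. U i x t * (1 - U i x t)"
  have C: "0 < ?C" using eps by simp
  have l: "0 \<le> ?l\<^sup>2 / ?C" by simp
  have one: "\<epsilon> * (well_test \<delta> (U i x t) * reaction i x t) \<le> \<beta> * (double_well (U i x t) / \<epsilon> + ?l\<^sup>2 / ?C)" for i
  proof -
    have rg: "0 \<le> U i x t" "U i x t \<le> 1" using U_range t by auto
    note s = well_factor_bounds[OF rg]
    note w = well_test_bounds[OF delta(1) rg]
    have "\<epsilon> * (well_test \<delta> (U i x t) * reaction i x t) =
       well_test \<delta> (U i x t) * (sqrt 2 * ?s i * lack x t / ?C) - 2 * ?s i * ((1 - 2 * U i x t) * well_test \<delta> (U i x t)) / \<epsilon>"
      unfolding reaction_def abs_of_nonneg[OF s(1)] using eps by (simp add: field_simps)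
    also have "\<dots> \<le> well_test \<delta> (U i x t) * (sqrt 2 * ?s i * lack x t / ?C)"
    proof -
      have "0 \<le> 2 * ?s i * ((1 - 2 * U i x t) * well_test \<delta> (U i x t)) / \<epsilon>"
        using rg by (intro divide_nonneg_pos mult_nonneg_nonneg w s eps) auto
      then show ?thesis by linarith
    qed
    also have "\<dots> \<le> \<bar>well_test \<delta> (U i x t) * (sqrt 2 * ?s i * lack x t / ?C)\<bar>" by (rule abs_ge_self)
    also have "\<dots> = \<bar>well_test \<delta> (U i x t)\<bar> * (sqrt 2 * ?s i * ?l / ?C)"
      using rg C by (simp add: abs_mult)
    also have "\<dots> \<le> 1 * (2 * ?s i * ?l / ?C)"
    proof (intro mult_mono divide_right_mono)
      show "\<bar>well_test \<delta> (U i x t)\<bar> \<le> 1" using w delta by linarith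
      show "sqrt 2 \<le> 2" using real_sqrt_le_mono[of 2 4] by simp
    qed (use s rg C in auto)
    also have "\<dots> \<le> \<beta> * (double_well (U i x t) / \<epsilon> + ?l\<^sup>2 / ?C)"
    proof -
      have "0 \<le> (?s i - \<beta> * ?l)\<^sup>2" by simp
      then have "2 * ?s i * ?l * \<beta> \<le> (?s i)\<^sup>2 + \<beta>\<^sup>2 * ?l\<^sup>2" by (simp add: power2_eq_square algebra_simps)
      then have "2 * ?s i * ?l * \<beta> / (\<beta> * ?C) \<le> ((?s i)\<^sup>2 + \<beta>\<^sup>2 * ?l\<^sup>2) / (\<beta> * ?C)"
        using beta C by (intro divide_right_mono) auto
      moreover have "2 * ?s i * ?l * \<beta> / (\<beta> * ?C) = 1 * (2 * ?s i * ?l / ?C)" using beta by simp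
      moreover have "((?s i)\<^sup>2 + \<beta>\<^sup>2 * ?l\<^sup>2) / (\<beta> * ?C) = \<beta> * ((?s i)\<^sup>2 / (\<beta>\<^sup>2 * ?C) + ?l\<^sup>2 / ?C)"
      proof -
        have "(a + \<beta>\<^sup>2 * b) / (\<beta> * ?C) = \<beta> * (a / (\<beta>\<^sup>2 * ?C) + b / ?C)" for a b
          using beta(1) C by (simp add: add_divide_distrib distrib_left power2_eq_square)
        then show ?thesis .
      qed
      ultimately show ?thesis unfolding beta(2) double_well_eq by simp
    qed
    finally show ?thesis .
  qed
  have W: "0 \<le> (\<Sum>i\<in>UNIV. double_well (U i x t))" by (rule sum_nonneg) (simp add: double_well_eq)
  have n: "1 \<le> real CARD('n)" using zero_less_card_finite[where 'a='n] by linarith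
  have "\<epsilon> * (\<Sum>i\<in>UNIV. well_test \<delta> (U i x t) * reaction i x t) \<le> (\<Sum>i\<in>UNIV. \<beta> * (double_well (U i x t) / \<epsilon> + ?l\<^sup>2 / ?C))"
    unfolding sum_distrib_left by (rule sum_mono) (rule one)
  also have "\<dots> = \<beta> * ((\<Sum>i\<in>UNIV. double_well (U i x t)) / \<epsilon> + real CARD('n) * (?l\<^sup>2 / ?C))"
    by (simp add: sum_distrib_left [symmetric] sum.distrib sum_divide_distrib)
  also have "\<dots> \<le> \<beta> * (2 * real CARD('n) * ((\<Sum>i\<in>UNIV. double_well (U i x t)) / \<epsilon>) + real CARD('n) * (?l\<^sup>2 / ?C))"
  proof -
    have "1 * ((\<Sum>i\<in>UNIV. double_well (U i x t)) / \<epsilon>) \<le> 2 * real CARD('n) * ((\<Sum>i\<in>UNIV. double_well (U i x t)) / \<epsilon>)"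
    proof (rule mult_right_mono)
      show "1 \<le> 2 * real CARD('n)" using n by linarith
    qed (use W eps in auto)
    then show ?thesis using beta by (intro mult_left_mono) auto
  qed
  also have "\<dots> = 2 * real CARD('n) * \<beta> * potential x t"
    unfolding potential_def by (simp add: algebra_simps)
  finally show ?thesis .
qed

text \<open>
  Where \<open>u (1 - u) \<le> \<delta>\<close> the gradient term is absorbed by the weight of the test function; elsewhere
  the gradient bound leaves \<open>\<mu> (1 + s)/\<epsilon>\<close>, a small multiple of the potential.
\<close>
lemma discrepancy_plus_le:
  assumes t: "0 < t"
  shows "discrepancy_plus x t \<le> 3 * \<epsilon> * (\<Sum>i\<in>UNIV. well_test_deriv \<delta> (U i x t) * component_gradient i x t)
    + 12 * \<delta> * (\<epsilon> / 2 * dirichlet x t) + 5 / 4 * (\<mu> / \<delta>\<^sup>2) * potential x t"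
proof -
  let ?g = "\<lambda>i. component_gradient i x t"
  let ?r = "\<lambda>i. 3 * \<epsilon> * (well_weight \<delta> (U i x t) * ?g i) + 5 / 4 * (\<mu> / \<delta>\<^sup>2) * (1 / \<epsilon> * double_well (U i x t))"
  have g: "0 \<le> ?g i" for i by (simp add: sum_nonneg)
  have rg: "0 \<le> U i x t" "U i x t \<le> 1" for i using U_range t by auto
  have W: "0 \<le> double_well u" for u by (simp add: double_well_eq)
  have r1: "0 \<le> 3 * \<epsilon> * (well_weight \<delta> (U i x t) * ?g i)" for i
    using eps g well_weight_le(1)[OF delta(1) rg] by (intro mult_nonneg_nonneg) auto
  have r2: "0 \<le> 5 / 4 * (\<mu> / \<delta>\<^sup>2) * (1 / \<epsilon> * double_well (U i x t))" for i
    using eps mu W by (intro mult_nonneg_nonneg) auto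
  have le: "\<epsilon> / 2 * ?g i - 1 / \<epsilon> * double_well (U i x t) \<le> ?r i" for i
  proof (cases "U i x t * (1 - U i x t) \<le> \<delta>")
    case True
    have "1/6 * ?g i \<le> well_weight \<delta> (U i x t) * ?g i"
      by (intro mult_right_mono well_weight_near_wells delta rg True g)
    then have "3 * \<epsilon> * (1/6 * ?g i) \<le> 3 * \<epsilon> * (well_weight \<delta> (U i x t) * ?g i)"
      using eps by (intro mult_left_mono) auto
    moreover have "0 \<le> 1 / \<epsilon> * double_well (U i x t)" using eps W by simp
    ultimately show ?thesis using r2[of i] by simp
  next
    case False
    let ?s = "U i x t * (1 - U i x t)"
    note s = well_factor_bounds[OF rg[of i]]
    have "\<epsilon>\<^sup>2 * ?g i \<le> 2 * (?s\<^sup>2 + \<mu> * (1 + ?s))"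
      using gradient[OF t, of i x] steepness_sq[OF mu, of "U i x t"] rg[of i]
      by (simp add: power_mult_distrib sum_distrib_left)
    moreover have "\<epsilon> / 2 * g - 1 / \<epsilon> * a \<le> m / \<epsilon>" if "\<epsilon>\<^sup>2 * g \<le> 2 * (a + m)" for g a m
    proof -
      have "(\<epsilon>\<^sup>2 * g) / (2 * \<epsilon>) \<le> (2 * (a + m)) / (2 * \<epsilon>)"
        using eps that by (intro divide_right_mono) auto
      moreover have "(\<epsilon>\<^sup>2 * g) / (2 * \<epsilon>) = \<epsilon> / 2 * g" using eps by (simp add: power2_eq_square)
      moreover have "(2 * (a + m)) / (2 * \<epsilon>) = 1 / \<epsilon> * a + m / \<epsilon>" by (simp add: add_divide_distrib)
      ultimately show ?thesis by linarith
    qed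
    ultimately have "\<epsilon> / 2 * ?g i - 1 / \<epsilon> * double_well (U i x t) \<le> \<mu> * (1 + ?s) / \<epsilon>"
      unfolding double_well_eq by blast
    also have "\<dots> \<le> \<mu> * (5 / 4 * (?s\<^sup>2 / \<delta>\<^sup>2)) / \<epsilon>"
    proof -
      have "\<delta>\<^sup>2 \<le> ?s\<^sup>2" using False delta by (intro power_mono) auto
      then have "1 \<le> ?s\<^sup>2 / \<delta>\<^sup>2" using delta by simp
      then have "1 + ?s \<le> 5 / 4 * (?s\<^sup>2 / \<delta>\<^sup>2)" using s by linarith
      then show ?thesis using mu eps by (intro divide_right_mono mult_left_mono) auto
    qed
    also have "\<dots> = 5 / 4 * (\<mu> / \<delta>\<^sup>2) * (1 / \<epsilon> * double_well (U i x t))" by (simp add: double_well_eq)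
    also have "\<dots> \<le> ?r i" using r1[of i] by linarith
    finally show ?thesis .
  qed
  have lackn: "0 \<le> 1 / (2 * \<epsilon> powr \<alpha>) * (lack x t)\<^sup>2" using eps by simp
  have "\<epsilon> / 2 * dirichlet x t - potential x t \<le> (\<Sum>i\<in>UNIV. \<epsilon> / 2 * ?g i - 1 / \<epsilon> * double_well (U i x t))"
    unfolding dirichlet_def potential_def sum_subtractf sum_distrib_left[symmetric] using lackn by linarith
  also have "\<dots> \<le> (\<Sum>i\<in>UNIV. ?r i)" by (rule sum_mono) (rule le)
  finally have "discrepancy_plus x t \<le> (\<Sum>i\<in>UNIV. ?r i)"
    unfolding discrepancy_plus_def using r1 r2 by (intro max.boundedI sum_nonneg add_nonneg_nonneg) auto
  also have "\<dots> \<le> (\<Sum>i\<in>UNIV. 3 * \<epsilon> * (well_test_deriv \<delta> (U i x t) * ?g i) + 12 * \<delta> * (\<epsilon> / 2 * ?g i)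
      + 5 / 4 * (\<mu> / \<delta>\<^sup>2) * (1 / \<epsilon> * double_well (U i x t)))"
  proof (intro sum_mono add_right_mono)
    fix i
    have "well_weight \<delta> (U i x t) * ?g i \<le> (well_test_deriv \<delta> (U i x t) + 2 * \<delta>) * ?g i"
      by (intro mult_right_mono well_weight_le delta rg g)
    then have "3 * \<epsilon> * (well_weight \<delta> (U i x t) * ?g i) \<le> 3 * \<epsilon> * ((well_test_deriv \<delta> (U i x t) + 2 * \<delta>) * ?g i)"
      using eps by (intro mult_left_mono) auto
    then show "3 * \<epsilon> * (well_weight \<delta> (U i x t) * ?g i)
        \<le> 3 * \<epsilon> * (well_test_deriv \<delta> (U i x t) * ?g i) + 12 * \<delta> * (\<epsilon> / 2 * ?g i)"
      by (simp add: distrib_left distrib_right mult.left_commute)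
  qed
  also have "\<dots> = 3 * \<epsilon> * (\<Sum>i\<in>UNIV. well_test_deriv \<delta> (U i x t) * ?g i) + 12 * \<delta> * (\<epsilon> / 2 * dirichlet x t)
      + 5 / 4 * (\<mu> / \<delta>\<^sup>2) * (1 / \<epsilon> * (\<Sum>i\<in>UNIV. double_well (U i x t)))"
    unfolding dirichlet_def sum_distrib_left sum.distrib by simp
  also have "\<dots> \<le> 3 * \<epsilon> * (\<Sum>i\<in>UNIV. well_test_deriv \<delta> (U i x t) * ?g i) + 12 * \<delta> * (\<epsilon> / 2 * dirichlet x t)
      + 5 / 4 * (\<mu> / \<delta>\<^sup>2) * potential x t"
    using mu lackn unfolding potential_def by (intro add_left_mono mult_left_mono) auto
  finally show ?thesis .
qed

definition test_mass :: "real \<Rightarrow> real" where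
  "test_mass t = integral (cbox 0 1) (\<lambda>x. \<Sum>i\<in>UNIV. well_test_primitive \<delta> (U i x t))"

definition test_mass_rate :: "real \<Rightarrow> real" where
  "test_mass_rate t = integral (cbox 0 1) (\<lambda>x. \<Sum>i\<in>UNIV. well_test \<delta> (U i x t) * Ut i x t)"

definition error_factor :: real where
  "error_factor = 6 * real CARD('n) * \<beta> + 12 * \<delta> + 5 / 4 * (\<mu> / \<delta>\<^sup>2)"

lemma test_mass_has_derivative:
  assumes "0 < t"
  shows "(test_mass has_real_derivative test_mass_rate t) (at t)"
  unfolding test_mass_def [abs_def] test_mass_rate_def
proof (rule torus_integral_has_derivative[where h = "\<lambda>x t. \<Sum>i\<in>UNIV. well_test_primitive \<delta> (U i x t)"])
  show "((\<lambda>t. \<Sum>i\<in>UNIV. well_test_primitive \<delta> (U i x t)) has_real_derivative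
      (\<Sum>i\<in>UNIV. well_test \<delta> (U i x t) * Ut i x t)) (at t)" if t: "0 < t" for x t
  proof (rule DERIV_sum)
    fix i
    show "((\<lambda>t. well_test_primitive \<delta> (U i x t)) has_real_derivative well_test \<delta> (U i x t) * Ut i x t) (at t)"
      by (rule DERIV_chain2[where f = "well_test_primitive \<delta>"], rule well_test_primitive_has_derivative[OF delta(1)])
         (use U_range t Ut in auto)
  qed
qed (use assms U_range in \<open>auto intro!: continuous_intros well_test_continuous simp: case_prod_unfold\<close>)

text \<open>
  Green's formula turns the weighted gradient term into \<open>- \<integral> \<eta>(u) \<sqdot> \<Delta>u\<close>, and the equation turns this into
  a time derivative and the reaction term.
\<close>
lemma discrepancy_plus_integral_le:
  assumes t: "0 < t"
  shows "integral (cbox 0 1) (\<lambda>x. discrepancy_plus x t) \<le> error_factor * E0 - 3 * \<epsilon> * test_mass_rate t"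
proof -
  let ?W = "\<lambda>x. \<Sum>i\<in>UNIV. well_test_deriv \<delta> (U i x t) * component_gradient i x t"
  let ?R = "\<lambda>x. \<Sum>i\<in>UNIV. well_test \<delta> (U i x t) * reaction i x t"
  let ?L = "\<lambda>x. \<Sum>i\<in>UNIV. well_test \<delta> (U i x t) * lap i x t"
  let ?e = "\<lambda>x. \<epsilon> / 2 * dirichlet x t + potential x t"
  have rg: "0 \<le> U i x t \<and> U i x t \<le> 1" for i x using U_range t by simp
  have int: "(\<lambda>x. discrepancy_plus x t) integrable_on cbox 0 1" "?R integrable_on cbox 0 1"
    "?L integrable_on cbox 0 1" "?e integrable_on cbox 0 1"
    unfolding discrepancy_plus_def using t rg
    by (auto intro!: integrable_cell continuous_intros well_test_continuous)
  have "test_mass_rate t = integral (cbox 0 1) (\<lambda>x. ?L x + ?R x)"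
    unfolding test_mass_rate_def using t by (simp add: reaction_diffusion distrib_left sum.distrib)
  then have rate: "test_mass_rate t = integral (cbox 0 1) ?L + integral (cbox 0 1) ?R"
    using int by (simp add: Henstock_Kurzweil_Integration.integral_add)
  have "((\<lambda>x. 3 * \<epsilon> * ?W x - 3 * \<epsilon> * ?R x + error_factor * ?e x) has_integral
      (3 * \<epsilon> * - integral (cbox 0 1) ?L - 3 * \<epsilon> * integral (cbox 0 1) ?R + error_factor * total_energy t)) (cbox 0 1)"
    unfolding total_energy_def
    by (intro has_integral_add has_integral_diff has_integral_mult_right well_test_green[OF t] integrable_integral int)
  moreover have "discrepancy_plus x t \<le> 3 * \<epsilon> * ?W x - 3 * \<epsilon> * ?R x + error_factor * ?e x" for x
  proof -
    have dir: "0 \<le> \<epsilon> / 2 * dirichlet x t" using eps dirichlet_nonneg by simp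
    have "12 * \<delta> * (\<epsilon> / 2 * dirichlet x t) \<le> error_factor * (\<epsilon> / 2 * dirichlet x t)"
      using dir mu beta by (intro mult_right_mono) (auto simp: error_factor_def)
    moreover have "5 / 4 * (\<mu> / \<delta>\<^sup>2) * potential x t + 3 * (2 * real CARD('n) * \<beta> * potential x t) \<le> error_factor * potential x t"
    proof -
      have "0 \<le> 12 * \<delta> * potential x t" using delta potential_nonneg[of x t] by simp
      then show ?thesis unfolding error_factor_def distrib_right by linarith
    qed
    moreover note discrepancy_plus_le[OF t, of x] reaction_test_le[OF t, of x]
    ultimately show ?thesis unfolding distrib_left by linarith
  qed
  ultimately have "integral (cbox 0 1) (\<lambda>x. discrepancy_plus x t)
      \<le> 3 * \<epsilon> * - integral (cbox 0 1) ?L - 3 * \<epsilon> * integral (cbox 0 1) ?R + error_factor * total_energy t"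
    using has_integral_le[OF integrable_integral[OF int(1)]] by blast
  also have "\<dots> = error_factor * total_energy t - 3 * \<epsilon> * test_mass_rate t"
    unfolding rate by (simp add: algebra_simps)
  also have "\<dots> \<le> error_factor * E0 - 3 * \<epsilon> * test_mass_rate t"
    using energy[OF t] mu beta delta by (intro diff_right_mono mult_left_mono) (auto simp: error_factor_def)
  finally show ?thesis .
qed

lemma test_mass_bounds:
  assumes "0 \<le> t"
  shows "0 \<le> test_mass t" "test_mass t \<le> real CARD('n) * \<delta>"
proof -
  have rg: "0 \<le> U i x t \<and> U i x t \<le> 1" for i x using U_range assms by simp
  have c: "continuous_on UNIV (\<lambda>x. \<Sum>i\<in>UNIV. well_test_primitive \<delta> (U i x t))"
    using assms rg by (intro continuous_intros well_test_continuous) auto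
  show "0 \<le> test_mass t" unfolding test_mass_def
    using well_test_primitive_bounds[OF delta(1)] rg by (intro integral_nonneg integrable_cell c sum_nonneg) auto
  have "test_mass t \<le> integral (cbox 0 (1 :: real ^ 'd)) (\<lambda>x. real CARD('n) * \<delta>)"
    unfolding test_mass_def
  proof (intro integral_le integrable_cell c continuous_on_const)
    show "(\<Sum>i\<in>UNIV. well_test_primitive \<delta> (U i x t)) \<le> real CARD('n) * \<delta>" for x
      by (rule sum_bounded_above) (use well_test_primitive_bounds[OF delta(1)] rg in auto)
  qed
  also have "\<dots> = real CARD('n) * \<delta>"
  proof -
    have "(0 :: real ^ 'd) \<in> cbox 0 1" by (simp add: mem_box_cart)
    then have "cbox 0 (1 :: real ^ 'd) \<noteq> {}" by blast
    then show ?thesis by (simp add: content_cbox_cart)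
  qed
  finally show "test_mass t \<le> real CARD('n) * \<delta>" .
qed

text \<open>
  The time derivative integrates to a boundary term of size \<open>\<epsilon>\<close>; at time zero this uses that the
  initial data are attained uniformly.
\<close>
lemma discrepancy_plus_time_integral:
  assumes T: "0 < T"
  shows "(\<integral>\<^sup>+t\<in>{0<..<T}. ennreal (integral (cbox 0 1) (\<lambda>x. discrepancy_plus x t)) \<partial>lborel)
    \<le> ennreal ((6 * real CARD('n) * \<beta> + 12 * \<delta> + 5 / 4 * (\<mu> / \<delta>\<^sup>2)) * E0 * T + 3 * real CARD('n) * \<epsilon>)"
proof -
  define F where "F = (\<lambda>t. error_factor * E0 * t - 3 * \<epsilon> * test_mass t)"
  define f where "f = (\<lambda>t. error_factor * E0 - 3 * \<epsilon> * test_mass_rate t)"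
  have "continuous_on {0..} test_mass"
    unfolding test_mass_def [abs_def] using U_range
    by (intro torus_integral_continuous) (auto intro!: continuous_intros well_test_continuous simp: case_prod_unfold)
  then have "continuous_on {0..T} F"
    unfolding F_def by (intro continuous_intros) (auto elim: continuous_on_subset)
  moreover have "(F has_vector_derivative f t) (at t)" if "t \<in> {0<..<T}" for t
    unfolding F_def f_def has_real_derivative_iff_has_vector_derivative[symmetric]
    using that by (auto intro!: derivative_eq_intros test_mass_has_derivative)
  ultimately have "(f has_integral (F T - F 0)) {0..T}"
    using T by (intro fundamental_theorem_of_calculus_interior) auto
  then have F: "(f has_integral (F T - F 0)) {0<..<T}" by (simp add: has_integral_Icc_iff_Ioo)
  have X: "0 \<le> integral (cbox 0 1) (\<lambda>x. discrepancy_plus x t)" if "0 < t" for t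
    unfolding discrepancy_plus_def using that by (intro integral_nonneg integrable_cell continuous_intros) auto
  have le: "integral (cbox 0 1) (\<lambda>x. discrepancy_plus x t) \<le> f t" if "0 < t" for t
    using discrepancy_plus_integral_le[OF that] by (simp add: f_def)
  have "(\<integral>\<^sup>+t\<in>{0<..<T}. ennreal (integral (cbox 0 1) (\<lambda>x. discrepancy_plus x t)) \<partial>lborel)
      \<le> (\<integral>\<^sup>+t. ennreal (indicator {0<..<T} t * f t) \<partial>lborel)"
    by (intro nn_integral_mono) (auto simp: indicator_def intro!: ennreal_leI le)
  also have "\<dots> = ennreal (F T - F 0)"
    by (rule nn_integral_has_integral_lebesgue[OF _ F]) (use X le in force)
  also have "\<dots> \<le> ennreal (error_factor * E0 * T + 3 * real CARD('n) * \<epsilon>)"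
  proof (rule ennreal_leI)
    have "test_mass 0 \<le> real CARD('n) * 1"
      using test_mass_bounds(2)[of 0] mult_left_mono[of \<delta> 1 "real CARD('n)"] delta by linarith
    then have "3 * \<epsilon> * test_mass 0 \<le> 3 * \<epsilon> * real CARD('n)" using eps by (intro mult_left_mono) auto
    moreover have "0 \<le> 3 * \<epsilon> * test_mass T" using test_mass_bounds(1)[of T] T eps by simp
    ultimately show "F T - F 0 \<le> error_factor * E0 * T + 3 * real CARD('n) * \<epsilon>"
      unfolding F_def by (simp add: mult_ac)
  qed
  finally show ?thesis by (simp only: error_factor_def)
qed

end
end

section \<open>Classical solutions as flows\<close>

lemma component_has_derivative:
  fixes f :: "real ^ 'd \<Rightarrow> real ^ 'n"
  assumes "f differentiable (at x)"
  shows "((\<lambda>y. f y $ i) has_derivative (\<lambda>h. \<Sum>k\<in>UNIV. partial k f x $ i * h $ k)) (at x)"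
proof -
  let ?D = "frechet_derivative f (at x)"
  have D: "(f has_derivative ?D) (at x)" using assms by (simp add: frechet_derivative_works)
  then have lin: "linear ?D" by (rule has_derivative_linear)
  have "?D h $ i = (\<Sum>k\<in>UNIV. partial k f x $ i * h $ k)" for h
  proof -
    have "?D h = ?D (\<Sum>k\<in>UNIV. h $ k *\<^sub>R axis k 1)"
      using basis_expansion[of h] by (simp add: scalar_mult_eq_scaleR)
    also have "\<dots> = (\<Sum>k\<in>UNIV. h $ k *\<^sub>R partial k f x)"
      by (simp add: linear_sum[OF lin] linear_scale[OF lin] partial_def)
    finally show ?thesis by (simp add: mult.commute)
  qed
  moreover have "((\<lambda>y. f y $ i) has_derivative (\<lambda>h. ?D h $ i)) (at x)"
    using bounded_linear.has_derivative[OF bounded_linear_vec_nth D] .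
  ultimately show ?thesis by simp
qed

lemma norm_jacobian_row:
  fixes f :: "real ^ 'd \<Rightarrow> real ^ 'n"
  shows "(norm (jacobian f (at x) $ i))\<^sup>2 = (\<Sum>k\<in>UNIV. (partial k f x $ i)\<^sup>2)"
  by (simp add: norm_vec_squared jacobian_def matrix_def partial_def)

lemma norm_jacobian:
  fixes f :: "real ^ 'd \<Rightarrow> real ^ 'n"
  shows "(norm (jacobian f (at x)))\<^sup>2 = (\<Sum>i\<in>UNIV. \<Sum>k\<in>UNIV. (partial k f x $ i)\<^sup>2)"
proof -
  have "(norm (jacobian f (at x)))\<^sup>2 = (\<Sum>i\<in>UNIV. (norm (jacobian f (at x) $ i))\<^sup>2)"
    by (simp add: norm_vec_def L2_set_def sum_nonneg)
  then show ?thesis by (simp add: norm_jacobian_row)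
qed

lemma solution_is_flow:
  fixes u :: "real ^ 'd \<Rightarrow> real \<Rightarrow> real ^ 'n"
  assumes alpha: "0 < \<alpha>" "\<alpha> < 1" and eps: "0 < \<epsilon>" "\<epsilon> \<le> 1"
    and sol: "allen_cahn_solution \<alpha> \<epsilon> v0 u"
    and v0: "\<And>x. v0 differentiable (at x)" "\<And>x i. 0 \<le> v0 x $ i \<and> v0 x $ i \<le> 1"
  shows "allen_cahn_flow \<alpha> \<epsilon> (\<lambda>i x t. u x t $ i) (\<lambda>i x t. dt u x t $ i)
    (\<lambda>i k x t. partial k (\<lambda>y. u y t) x $ i) (\<lambda>i k x t. partial k (partial k (\<lambda>y. u y t)) x $ i)
    (\<lambda>i k x. partial k v0 x $ i)"
proof
  have per: "\<And>t. 0 \<le> t \<Longrightarrow> periodic (\<lambda>x. u x t)"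
    and cont: "continuous_on (UNIV \<times> {0..}) (\<lambda>(x, t). u x t)" and C21: "C21 u"
    and init: "\<And>x. u x 0 = v0 x"
    using sol unfolding allen_cahn_solution_def by auto
  have diff: "\<And>x t. 0 < t \<Longrightarrow> u x differentiable (at t)"
      "\<And>x t. 0 < t \<Longrightarrow> (\<lambda>y. u y t) differentiable (at x)"
      "\<And>x t k. 0 < t \<Longrightarrow> partial k (\<lambda>y. u y t) differentiable (at x)"
    and cts: "continuous_on (UNIV \<times> {0<..}) (\<lambda>(x, t). dt u x t)"
      "\<And>k. continuous_on (UNIV \<times> {0<..}) (\<lambda>(x, t). partial k (\<lambda>y. u y t) x)"
      "\<And>k l. continuous_on (UNIV \<times> {0<..}) (\<lambda>(x, t). partial l (partial k (\<lambda>y. u y t)) x)"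
    using C21 unfolding C21_def by auto
  show "0 < \<alpha>" "\<alpha> < 1" "0 < \<epsilon>" "\<epsilon> \<le> 1" by fact+
  show "periodic (\<lambda>x. u x t $ i)" if "0 \<le> t" for i t
    using per[OF that] by (simp add: periodic_def)
  show "continuous_on (UNIV \<times> {0..}) (\<lambda>(x, t). u x t $ i)" for i
    using continuous_on_component[OF cont] by (simp add: case_prod_unfold)
  show "((\<lambda>t. u x t $ i) has_real_derivative dt u x t $ i) (at t)" if "0 < t" for i x t
  proof -
    have "(u x has_vector_derivative dt u x t) (at t)"
      using diff(1)[OF that] unfolding dt_def by (simp add: vector_derivative_works)
    then have "((\<lambda>t. u x t $ i) has_vector_derivative dt u x t $ i) (at t)"
      by (rule bounded_linear.has_vector_derivative[OF bounded_linear_vec_nth])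
    then show ?thesis by (simp add: has_real_derivative_iff_has_vector_derivative)
  qed
  show "((\<lambda>y. u y t $ i) has_derivative (\<lambda>h. \<Sum>k\<in>UNIV. partial k (\<lambda>y. u y t) x $ i * h $ k)) (at x)"
    if "0 < t" for i x t
    by (rule component_has_derivative[OF diff(2)[OF that]])
  show "has_partial k (\<lambda>y. partial k (\<lambda>y. u y t) y $ i) (\<lambda>y. partial k (partial k (\<lambda>y. u y t)) y $ i)"
    if "0 < t" for i k t
    by (rule has_derivative_imp_has_partial[where f' = "\<lambda>l y. partial l (partial k (\<lambda>y. u y t)) y $ i"])
       (rule component_has_derivative[OF diff(3)[OF that]])
  show "continuous_on (UNIV \<times> {0<..}) (\<lambda>(x, t). dt u x t $ i)" for i
    using continuous_on_component[OF cts(1)] by (simp add: case_prod_unfold)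
  show "continuous_on (UNIV \<times> {0<..}) (\<lambda>(x, t). partial k (\<lambda>y. u y t) x $ i)" for i k
    using continuous_on_component[OF cts(2)] by (simp add: case_prod_unfold)
  show "continuous_on (UNIV \<times> {0<..}) (\<lambda>(x, t). partial k (partial k (\<lambda>y. u y t)) x $ i)" for i k
    using continuous_on_component[OF cts(3)] by (simp add: case_prod_unfold)
  show "((\<lambda>y. u y 0 $ i) has_derivative (\<lambda>h. \<Sum>k\<in>UNIV. partial k v0 x $ i * h $ k)) (at x)" for i x
    unfolding init by (rule component_has_derivative[OF v0(1)])
  show "0 \<le> u x 0 $ i" "u x 0 $ i \<le> 1" for i x using v0(2) by (auto simp: init)
  show "\<epsilon> * dt u x t $ i = \<epsilon> * (\<Sum>k\<in>UNIV. partial k (partial k (\<lambda>y. u y t)) x $ i)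
      - 1 / \<epsilon> * deriv double_well (u x t $ i)
      + 1 / \<epsilon> powr \<alpha> * sqrt (2 * double_well (u x t $ i)) * (surface_tension - (\<Sum>j\<in>UNIV. phi (u x t $ j)))"
    if "0 < t" for i x t
    using sol that unfolding allen_cahn_solution_def laplacian_def by simp
qed

section \<open>From integrals over a cell to measures\<close>

lemma torus_cell_borel [measurable]: "torus_cell \<in> sets (borel :: (real ^ 'd) measure)"
proof -
  have "torus_cell = (\<Inter>k\<in>UNIV. {x :: real ^ 'd. 0 \<le> x $ k} \<inter> {x. x $ k < 1})"
    by (auto simp: torus_cell_def)
  also have "\<dots> \<in> sets borel"
    by (intro sets.finite_INT sets.Int borel_closed borel_open closed_halfspace_component_ge_cart open_halfspace_component_lt_cart) auto
  finally show ?thesis .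
qed

lemma nn_integral_torus:
  "(\<integral>\<^sup>+x. f x \<partial>torus_lborel) = (\<integral>\<^sup>+x. f x * indicator torus_cell x \<partial>lborel)"
  unfolding torus_lborel_def by (rule nn_integral_restrict_space) simp

lemma nn_integral_torus_le:
  fixes f :: "real ^ 'd \<Rightarrow> real"
  assumes "continuous_on UNIV f" "\<And>x. 0 \<le> f x"
  shows "(\<integral>\<^sup>+x. ennreal (f x) \<partial>torus_lborel) \<le> ennreal (integral (cbox 0 1) f)"
proof -
  have "f integrable_on cbox 0 1"
    by (rule integrable_continuous) (rule continuous_on_subset[OF assms(1) subset_UNIV])
  then have I: "(f has_integral integral (cbox 0 1) f) (cbox 0 1)" by (rule integrable_integral)
  have "(\<integral>\<^sup>+x. ennreal (f x) \<partial>torus_lborel) \<le> (\<integral>\<^sup>+x. ennreal (indicator (cbox 0 1) x * f x) \<partial>lborel)"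
    unfolding nn_integral_torus using torus_cell_subset_cbox
    by (intro nn_integral_mono) (auto simp: indicator_def)
  also have "\<dots> = ennreal (integral (cbox 0 1) f)"
    by (rule nn_integral_has_integral_lebesgue[OF _ I]) (use assms in auto)
  finally show ?thesis .
qed

text \<open>
  Here the function is only integrable, since it will be the initial energy density.
\<close>
lemma integral_le_nn_integral_torus:
  fixes f :: "real ^ 'd \<Rightarrow> real"
  assumes "f integrable_on cbox 0 1" "\<And>x. 0 \<le> f x"
  shows "ennreal (integral (cbox 0 1) f) \<le> (\<integral>\<^sup>+x. ennreal (f x) \<partial>torus_lborel)"
proof -
  have I: "(f has_integral integral (cbox 0 1) f) (box 0 1)"
    using integrable_integral[OF assms(1)] by (simp add: has_integral_open_interval)
  have "ennreal (integral (cbox 0 1) f) = (\<integral>\<^sup>+x. ennreal (indicator (box 0 1) x * f x) \<partial>lborel)"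
    by (rule nn_integral_has_integral_lebesgue[OF _ I, symmetric]) (use assms in auto)
  also have "\<dots> \<le> (\<integral>\<^sup>+x. ennreal (f x) \<partial>torus_lborel)"
    unfolding nn_integral_torus using box_subset_torus_cell
    by (intro nn_integral_mono) (auto simp: indicator_def)
  finally show ?thesis .
qed

definition discrepancy_mass ::
    "real \<Rightarrow> real \<Rightarrow> (real ^ 'd \<Rightarrow> real \<Rightarrow> real ^ 'n) \<Rightarrow> real \<Rightarrow> ennreal" where
  "discrepancy_mass \<alpha> \<epsilon> u T = (\<integral>\<^sup>+t\<in>{0<..<T}. (\<integral>\<^sup>+x. ennreal (max (discrepancy \<alpha> \<epsilon> (\<lambda>y. u y t) x) 0)
             \<partial>torus_lborel) \<partial>lborel)"

lemma spacetime_set_borel [measurable]: "torus_cell \<times> {0<..} \<in> sets (borel :: ((real ^ 'd) \<times> real) measure)"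
  unfolding borel_prod[symmetric] by (intro pair_measureI) auto

text \<open>
  Tonelli's theorem; the time interval is enlarged in order to be open.
\<close>
lemma xi_plus_mass_le:
  fixes u :: "real ^ 'd \<Rightarrow> real \<Rightarrow> real ^ 'n"
  assumes cont: "continuous_on (UNIV \<times> {0<..}) (\<lambda>(x, t). discrepancy \<alpha> \<epsilon> (\<lambda>y. u y t) x)"
  shows "emeasure (xi_plus \<alpha> \<epsilon> u) (torus_cell \<times> {0<..T}) \<le> discrepancy_mass \<alpha> \<epsilon> u (T + 1)"
proof -
  define f where "f = (\<lambda>z :: (real ^ 'd) \<times> real. max (case z of (x, t) \<Rightarrow> discrepancy \<alpha> \<epsilon> (\<lambda>y. u y t) x) 0)"
  have half: "UNIV \<times> {0<..} \<in> sets (borel :: ((real ^ 'd) \<times> real) measure)"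
    by (intro borel_open open_Times) auto
  have "continuous_on (UNIV \<times> {0<..}) f" unfolding f_def by (intro continuous_intros cont)
  then have [measurable]: "(\<lambda>z. indicator (UNIV \<times> {0<..}) z *\<^sub>R f z) \<in> borel_measurable borel"
    by (rule borel_measurable_continuous_on_indicator[OF half])
  let ?A = "torus_cell \<times> {0<..T} :: ((real ^ 'd) \<times> real) set"
  have A: "?A \<in> sets (borel :: ((real ^ 'd) \<times> real) measure)"
    unfolding borel_prod[symmetric] by (intro pair_measureI) auto
  have A': "?A \<in> sets spacetime"
    unfolding spacetime_def by (auto simp: sets_restrict_space_iff A)
  have fm: "(\<lambda>z. ennreal (f z)) \<in> borel_measurable spacetime"
  proof -
    have "(\<lambda>z. ennreal (indicator (UNIV \<times> {0<..}) z *\<^sub>R f z)) \<in> borel_measurable spacetime"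
      unfolding spacetime_def by (intro measurable_restrict_space1) measurable
    then show ?thesis
      by (rule measurable_cong[THEN iffD1, rotated]) (auto simp: spacetime_def space_restrict_space)
  qed
  define h where "h = (\<lambda>z. ennreal (indicator (UNIV \<times> {0<..}) z *\<^sub>R f z) * indicator ?A z)"
  have hm: "h \<in> borel_measurable (lborel \<Otimes>\<^sub>M lborel)"
    unfolding h_def lborel_prod using A by measurable
  have "xi_plus \<alpha> \<epsilon> u = density spacetime (\<lambda>z. ennreal (f z))"
    unfolding xi_plus_def f_def by (simp add: case_prod_unfold)
  then have "emeasure (xi_plus \<alpha> \<epsilon> u) ?A = (\<integral>\<^sup>+z. ennreal (f z) * indicator ?A z \<partial>spacetime)"
    by (simp add: emeasure_density[OF fm A'])
  also have "\<dots> = (\<integral>\<^sup>+z. ennreal (f z) * indicator ?A z * indicator (torus_cell \<times> {0<..}) z \<partial>lborel)"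
    unfolding spacetime_def by (rule nn_integral_restrict_space) simp
  also have "\<dots> = (\<integral>\<^sup>+z. h z \<partial>(lborel \<Otimes>\<^sub>M lborel))"
    unfolding lborel_prod h_def by (intro nn_integral_cong) (auto simp: indicator_def)
  also have "\<dots> = (\<integral>\<^sup>+t. (\<integral>\<^sup>+x. h (x, t) \<partial>lborel) \<partial>lborel)"
    by (rule lborel_pair.nn_integral_snd[OF hm, symmetric])
  also have "\<dots> \<le> discrepancy_mass \<alpha> \<epsilon> u (T + 1)"
    unfolding discrepancy_mass_def nn_integral_torus
  proof (intro nn_integral_mono)
    fix t :: real
    show "(\<integral>\<^sup>+x. h (x, t) \<partial>lborel) \<le> (\<integral>\<^sup>+x. ennreal (max (discrepancy \<alpha> \<epsilon> (\<lambda>y. u y t) x) 0) * indicator torus_cell x \<partial>lborel)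
        * indicator {0<..<T + 1} t"
    proof (cases "0 < t \<and> t \<le> T")
      case True
      then show ?thesis by (auto simp: h_def f_def indicator_def intro!: nn_integral_mono)
    next
      case False
      then have "h (x, t) = 0" for x by (auto simp: h_def indicator_def)
      then show ?thesis by simp
    qed
  qed
  finally show ?thesis .
qed

section \<open>Vanishing of the positive discrepancy\<close>

text \<open>
  The cube root balances the two error terms \<open>\<delta>\<close> and \<open>\<mu>/\<delta>\<^sup>2\<close>, and \<open>\<mu> = \<delta>\<^sup>3\<close>.
\<close>
lemma flow_discrepancy_bound:
  fixes u :: "real ^ 'd \<Rightarrow> real \<Rightarrow> real ^ 'n"
  assumes alpha: "0 < \<alpha>" "\<alpha> < 1" and eps: "0 < \<epsilon>" "\<epsilon> \<le> 1"
    and sol: "allen_cahn_solution \<alpha> \<epsilon> v0 u"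
    and v0: "\<And>x. v0 differentiable (at x)" "\<And>x i. 0 \<le> v0 x $ i \<and> v0 x $ i \<le> 1"
    and init: "\<And>x i. \<epsilon> / 2 * (norm (jacobian v0 (at x) $ i))\<^sup>2 - 1 / \<epsilon> * double_well (v0 x $ i)
          \<le> C * \<epsilon> powr (- ((1 + \<alpha>) / 2))"
    and E0: "energy \<alpha> \<epsilon> v0 \<le> ennreal E0" "0 \<le> E0"
    and M: "C \<le> M" "2 * real CARD('n) \<le> M"
    and delta: "\<delta> = root 3 (M * \<epsilon> powr ((1 - \<alpha>) / 2))" "\<delta> \<le> 1 / 16"
  shows "continuous_on (UNIV \<times> {0<..}) (\<lambda>(x, t). discrepancy \<alpha> \<epsilon> (\<lambda>y. u y t) x)"
    and "0 < T \<Longrightarrow> discrepancy_mass \<alpha> \<epsilon> u T \<le> ennreal (\<delta> * (17 * E0 * T + 2))"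
proof -
  interpret flow: allen_cahn_flow \<alpha> \<epsilon> "\<lambda>i x t. u x t $ i" "\<lambda>i x t. dt u x t $ i"
    "\<lambda>i k x t. partial k (\<lambda>y. u y t) x $ i" "\<lambda>i k x t. partial k (partial k (\<lambda>y. u y t)) x $ i"
    "\<lambda>i k x. partial k v0 x $ i"
    by (rule solution_is_flow) fact+
  have disc: "discrepancy \<alpha> \<epsilon> (\<lambda>y. u y t) x = \<epsilon> / 2 * flow.dirichlet x t - flow.potential x t" for x t
    by (simp add: discrepancy_def norm_jacobian flow.dirichlet_def flow.potential_def F_eps_def flow.lack_def)
  show "continuous_on (UNIV \<times> {0<..}) (\<lambda>(x, t). discrepancy \<alpha> \<epsilon> (\<lambda>y. u y t) x)"
    unfolding disc by (auto intro!: continuous_intros flow.dirichlet_continuous' flow.potential_continuous' simp: case_prod_unfold)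

  define \<beta> where "\<beta> = \<epsilon> powr ((1 - \<alpha>) / 2)"
  define \<mu> where "\<mu> = M * \<beta>"
  have n: "1 \<le> real CARD('n)" using zero_less_card_finite[where 'a='n] by linarith
  have beta: "0 < \<beta>" "\<beta> \<le> 1" using eps alpha by (auto simp: \<beta>_def intro!: powr_le1)
  have "\<beta>\<^sup>2 = \<epsilon> powr (1 - \<alpha>)" unfolding \<beta>_def power2_eq_square powr_add[symmetric] by simp
  then have beta2: "\<beta>\<^sup>2 * \<epsilon> powr \<alpha> = \<epsilon>" using eps by (simp add: powr_add[symmetric])
  have mu: "0 < \<mu>" unfolding \<mu>_def using M n beta by (intro mult_pos_pos) linarith+
  have d3: "\<delta> ^ 3 = \<mu>" and d0: "0 < \<delta>"
    using mu unfolding delta(1) \<mu>_def \<beta>_def by (simp_all add: real_root_gt_zero real_root_pow_pos2)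
  have mu_delta: "\<mu> \<le> \<delta>"
  proof -
    have "\<delta> ^ 3 \<le> \<delta> ^ 1" using d0 delta(2) by (intro power_decreasing) auto
    then show ?thesis using d3 by simp
  qed
  then have mu1: "\<mu> \<le> 1" using delta(2) by linarith
  have mu_div: "\<mu> / \<delta>\<^sup>2 = \<delta>" unfolding d3[symmetric] using d0 by (simp add: power2_eq_square power3_eq_cube)
  have nbeta: "2 * real CARD('n) * \<beta> \<le> \<mu>" unfolding \<mu>_def using M(2) beta by (intro mult_right_mono) auto
  \<comment> \<open>here \<open>\<epsilon> = \<beta>\<^sup>2 \<epsilon>\<^bsup>\<alpha>\<^esup>\<close> and \<open>\<beta> \<le> 1\<close>, so \<open>\<mu> = M \<beta>\<close> is more than large enough\<close>
  have mu_large: "3 * real CARD('n) * \<epsilon> \<le> 2 * \<mu> * \<epsilon> powr \<alpha>"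
  proof -
    have "real CARD('n) * \<beta> * \<beta> \<le> real CARD('n) * \<beta> * 1" using beta n by (intro mult_left_mono) auto
    then have "3 * real CARD('n) * \<beta>\<^sup>2 \<le> 2 * \<mu>" using nbeta beta n mu unfolding power2_eq_square by linarith
    then have "3 * real CARD('n) * \<beta>\<^sup>2 * \<epsilon> powr \<alpha> \<le> 2 * \<mu> * \<epsilon> powr \<alpha>" by (intro mult_right_mono) auto
    then show ?thesis using beta2 by (simp add: mult.assoc)
  qed
  obtain P where P: "\<And>u. -1/2 < u \<Longrightarrow> u < 3/2 \<Longrightarrow> (P has_real_derivative 1 / steepness \<mu> u) (at u)"
    using steepness_antiderivative[OF mu] by blast

  have u0: "u x 0 = v0 x" for x using sol by (simp add: allen_cahn_solution_def)
  have steep: "(\<Sum>k\<in>UNIV. (\<epsilon> * (partial k v0 x $ i))\<^sup>2) \<le> (steepness \<mu> (u x 0 $ i))\<^sup>2" for i x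
  proof -
    let ?s = "v0 x $ i * (1 - v0 x $ i)" and ?g = "\<Sum>k\<in>UNIV. (partial k v0 x $ i)\<^sup>2"
    have s: "0 \<le> ?s" using v0(2)[of x i] by simp
    \<comment> \<open>multiplied by \<open>\<epsilon>\<close>, the bound in the initial gradient condition becomes a multiple of \<open>\<beta>\<close>\<close>
    have "\<epsilon> * \<epsilon> powr (- ((1 + \<alpha>) / 2)) = \<epsilon> powr (1 + (- ((1 + \<alpha>) / 2)))"
      using eps by (simp only: powr_add powr_one)
    also have "1 + (- ((1 + \<alpha>) / 2)) = (1 - \<alpha>) / 2" by (simp add: field_simps)
    finally have e: "\<epsilon> * \<epsilon> powr (- ((1 + \<alpha>) / 2)) = \<beta>" by (simp add: \<beta>_def)
    have "2 * \<epsilon> * (\<epsilon> / 2 * ?g - 1 / \<epsilon> * ?s\<^sup>2) \<le> 2 * \<epsilon> * (C * \<epsilon> powr (- ((1 + \<alpha>) / 2)))"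
      using init[of x i] eps by (intro mult_left_mono) (auto simp: norm_jacobian_row double_well_eq)
    also have "\<dots> = 2 * (C * \<beta>)" unfolding e[symmetric] by simp
    also have "2 * \<epsilon> * (\<epsilon> / 2 * ?g - 1 / \<epsilon> * ?s\<^sup>2) = \<epsilon>\<^sup>2 * ?g - 2 * ?s\<^sup>2"
      using eps by (simp add: right_diff_distrib power2_eq_square)
    finally have "\<epsilon>\<^sup>2 * ?g \<le> 2 * (?s\<^sup>2 + C * \<beta>)" unfolding distrib_left by linarith
    moreover have "C * \<beta> \<le> \<mu>" unfolding \<mu>_def using M(1) beta by (intro mult_right_mono) auto
    moreover have "\<mu> * 1 \<le> \<mu> * (1 + ?s)" using mu s by (intro mult_left_mono) auto
    ultimately have "\<epsilon>\<^sup>2 * ?g \<le> 2 * (?s\<^sup>2 + \<mu> * (1 + ?s))"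
      by (elim order_trans) (intro mult_left_mono add_left_mono, linarith, simp)
    moreover have "(steepness \<mu> (v0 x $ i))\<^sup>2 = 2 * (?s\<^sup>2 + \<mu> * (1 + ?s))"
      by (rule steepness_sq[OF mu]) (use v0(2)[of x i] in auto)
    moreover have "(\<Sum>k\<in>UNIV. (\<epsilon> * (partial k v0 x $ i))\<^sup>2) = \<epsilon>\<^sup>2 * ?g"
      by (simp add: power_mult_distrib sum_distrib_left)
    ultimately show ?thesis by (simp add: u0)
  qed
  have gradient: "(\<Sum>k\<in>UNIV. (\<epsilon> * (partial k (\<lambda>y. u y t) x $ i))\<^sup>2) \<le> (steepness \<mu> (u x t $ i))\<^sup>2"
    if "0 < t" for i x t
    by (rule flow.gradient_bound[OF mu mu1 mu_large P steep that])

  have V1_bound: "\<bar>partial k v0 x $ i\<bar> \<le> 2 / \<epsilon>" for i k x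
  proof -
    have "(\<epsilon> * (partial k v0 x $ i))\<^sup>2 \<le> (\<Sum>k\<in>UNIV. (\<epsilon> * (partial k v0 x $ i))\<^sup>2)"
      by (rule member_le_sum) auto
    also have "\<dots> \<le> (steepness \<mu> (u x 0 $ i))\<^sup>2" by (rule steep)
    also have "\<dots> = 2 * ((u x 0 $ i * (1 - u x 0 $ i))\<^sup>2 + \<mu> * (1 + u x 0 $ i * (1 - u x 0 $ i)))"
      by (rule steepness_sq[OF mu]) (use v0(2)[of x i] in \<open>auto simp: u0\<close>)
    also have "\<dots> \<le> 2 * ((1/4)\<^sup>2 + 1 * (1 + 1/4))"
      using well_factor_bounds[of "u x 0 $ i"] v0(2)[of x i] mu mu1
      by (intro mult_left_mono add_mono mult_mono power_mono) (auto simp: u0)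
    also have "\<dots> \<le> 2\<^sup>2" by (simp add: power2_eq_square)
    finally have "\<bar>\<epsilon> * (partial k v0 x $ i)\<bar> \<le> 2" by (subst (asm) abs_le_square_iff[symmetric]) simp
    then show ?thesis using eps by (simp add: abs_mult field_simps)
  qed
  have energy: "flow.total_energy t \<le> E0" if "0 < t" for t
  proof -
    let ?e = "\<lambda>x. \<epsilon> / 2 * flow.initial_dirichlet x + flow.potential x 0"
    have "?e x = energy_density \<alpha> \<epsilon> v0 x" for x
      by (simp add: energy_density_def norm_jacobian flow.initial_dirichlet_def flow.potential_def F_eps_def flow.lack_def u0)
    then have "energy \<alpha> \<epsilon> v0 = (\<integral>\<^sup>+x. ennreal (?e x) \<partial>torus_lborel)" by (simp add: energy_def)
    moreover have "0 \<le> ?e x" for x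
      using eps flow.potential_nonneg by (auto simp: flow.initial_dirichlet_def intro!: add_nonneg_nonneg mult_nonneg_nonneg sum_nonneg)
    moreover have "?e integrable_on cbox 0 1"
      by (intro integrable_add integrable_on_mult_right flow.initial_dirichlet_integrable[OF V1_bound]
          flow.integrable_cell flow.potential_continuous' continuous_intros) auto
    ultimately have "ennreal (integral (cbox 0 1) ?e) \<le> ennreal E0"
      using integral_le_nn_integral_torus[of ?e] E0(1) by (auto intro: order_trans)
    then have "integral (cbox 0 1) ?e \<le> E0" using E0(2) by (simp add: ennreal_le_iff)
    then show ?thesis using flow.energy_le_initial[OF V1_bound that] by linarith
  qed

  show "discrepancy_mass \<alpha> \<epsilon> u T \<le> ennreal (\<delta> * (17 * E0 * T + 2))" if T: "0 < T"
  proof -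
    have "discrepancy_mass \<alpha> \<epsilon> u T \<le> (\<integral>\<^sup>+t\<in>{0<..<T}. ennreal (integral (cbox 0 1) (\<lambda>x. flow.discrepancy_plus x t)) \<partial>lborel)"
      unfolding discrepancy_mass_def
    proof (intro nn_integral_mono)
      fix t :: real
      have "(\<integral>\<^sup>+x. ennreal (max (discrepancy \<alpha> \<epsilon> (\<lambda>y. u y t) x) 0) \<partial>torus_lborel)
          \<le> ennreal (integral (cbox 0 1) (\<lambda>x. flow.discrepancy_plus x t))" if "0 < t"
        unfolding disc flow.discrepancy_plus_def
        by (rule nn_integral_torus_le)
           (use that in \<open>auto intro!: continuous_intros flow.dirichlet_continuous' flow.potential_continuous'\<close>)
      then show "(\<integral>\<^sup>+x. ennreal (max (discrepancy \<alpha> \<epsilon> (\<lambda>y. u y t) x) 0) \<partial>torus_lborel) * indicator {0<..<T} t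
         \<le> ennreal (integral (cbox 0 1) (\<lambda>x. flow.discrepancy_plus x t)) * indicator {0<..<T} t"
        by (auto simp: indicator_def)
    qed
    also have "\<dots> \<le> ennreal ((6 * real CARD('n) * \<beta> + 12 * \<delta> + 5 / 4 * (\<mu> / \<delta>\<^sup>2)) * E0 * T + 3 * real CARD('n) * \<epsilon>)"
      by (rule flow.discrepancy_plus_time_integral[OF mu d0 delta(2) beta(1) beta2 gradient energy T])
    also have "\<dots> \<le> ennreal (\<delta> * (17 * E0 * T + 2))"
    proof (rule ennreal_leI)
      have "6 * real CARD('n) * \<beta> + 12 * \<delta> + 5 / 4 * (\<mu> / \<delta>\<^sup>2) \<le> 17 * \<delta>"
        unfolding mu_div using nbeta mu_delta d0 by linarith
      then have "(6 * real CARD('n) * \<beta> + 12 * \<delta> + 5 / 4 * (\<mu> / \<delta>\<^sup>2)) * E0 * T \<le> 17 * \<delta> * E0 * T"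
        using E0 T by (intro mult_right_mono) auto
      moreover have "3 * real CARD('n) * \<epsilon> \<le> 2 * \<delta>"
      proof -
        have "\<epsilon> powr \<alpha> \<le> 1" using eps alpha by (intro powr_le1) auto
        then have "2 * \<mu> * \<epsilon> powr \<alpha> \<le> 2 * \<mu> * 1" using mu by (intro mult_left_mono) auto
        then show ?thesis using mu_large mu_delta by linarith
      qed
      ultimately show "(6 * real CARD('n) * \<beta> + 12 * \<delta> + 5 / 4 * (\<mu> / \<delta>\<^sup>2)) * E0 * T + 3 * real CARD('n) * \<epsilon> \<le> \<delta> * (17 * E0 * T + 2)"
        by (simp add: algebra_simps)
    qed
    finally show ?thesis .
  qed
qed

theorem theorem2:
  fixes \<alpha> :: real
    and u0 :: "real \<Rightarrow> real ^ 'd \<Rightarrow> real ^ 'n"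
    and u :: "real \<Rightarrow> real ^ 'd \<Rightarrow> real \<Rightarrow> real ^ 'n"
  assumes "0 < \<alpha>" and "\<alpha> < 1"
    and "well_prepared \<alpha> u0"
    and "\<And>\<epsilon>. \<epsilon> \<in> {0<..1} \<Longrightarrow> allen_cahn_solution \<alpha> \<epsilon> (u0 \<epsilon>) (u \<epsilon>)"
  shows "(\<forall>T>0. ((\<lambda>\<epsilon>. \<integral>\<^sup>+t\<in>{0<..<T}. (\<integral>\<^sup>+x. ennreal (max (discrepancy \<alpha> \<epsilon> (\<lambda>y. u \<epsilon> y t) x) 0)
             \<partial>torus_lborel) \<partial>lborel) \<longlongrightarrow> 0) (at_right 0))
    \<and> weak_star_tendsto (\<lambda>\<epsilon>. xi_plus \<alpha> \<epsilon> (u \<epsilon>)) (null_measure spacetime) (at_right 0)"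
proof -
  have sup: "(SUP \<epsilon>\<in>{0<..1}. energy \<alpha> \<epsilon> (u0 \<epsilon>)) < \<infinity>"
    and diff: "\<And>\<epsilon> x. \<epsilon> \<in> {0<..1} \<Longrightarrow> u0 \<epsilon> differentiable (at x)"
    and rng: "\<And>\<epsilon> x i. \<epsilon> \<in> {0<..1} \<Longrightarrow> 0 \<le> u0 \<epsilon> x $ i \<and> u0 \<epsilon> x $ i \<le> 1"
    using assms(3) unfolding well_prepared_def by blast+
  obtain C where C: "\<And>\<epsilon> x i. \<epsilon> \<in> {0<..1} \<Longrightarrow>
        \<epsilon> / 2 * (norm (jacobian (u0 \<epsilon>) (at x) $ i))\<^sup>2 - 1 / \<epsilon> * double_well (u0 \<epsilon> x $ i)
          \<le> C * \<epsilon> powr (- ((1 + \<alpha>) / 2))"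
    using assms(3) unfolding well_prepared_def by blast
  define E0 where "E0 = enn2real (SUP \<epsilon>\<in>{0<..1}. energy \<alpha> \<epsilon> (u0 \<epsilon>))"
  have E0: "energy \<alpha> \<epsilon> (u0 \<epsilon>) \<le> ennreal E0" if "\<epsilon> \<in> {0<..1}" for \<epsilon>
    unfolding E0_def using sup that by (auto simp: less_top intro!: SUP_upper)
  define M where "M = max C (2 * real CARD('n))"
  define \<delta> where "\<delta> = (\<lambda>\<epsilon>. root 3 (M * \<epsilon> powr ((1 - \<alpha>) / 2)))"
  have "((\<lambda>\<epsilon>. \<epsilon> powr ((1 - \<alpha>) / 2)) \<longlongrightarrow> 0) (at_right 0)"
    by (rule tendsto_zero_powrI[OF tendsto_ident_at tendsto_const])
      (use assms(1,2) in \<open>auto simp: eventually_at_filter\<close>)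
  then have "((\<lambda>\<epsilon>. root 3 (M * \<epsilon> powr ((1 - \<alpha>) / 2))) \<longlongrightarrow> root 3 (M * 0)) (at_right 0)"
    by (intro tendsto_real_root tendsto_mult tendsto_const)
  then have delta_lim: "(\<delta> \<longlongrightarrow> 0) (at_right 0)" by (simp add: \<delta>_def)
  have small: "\<forall>\<^sub>F \<epsilon> in at_right 0. \<epsilon> \<in> {0<..1} \<and> \<delta> \<epsilon> \<le> 1 / 16"
  proof -
    have "\<forall>\<^sub>F \<epsilon> in at_right 0. \<delta> \<epsilon> < 1 / 16" by (rule order_tendstoD(2)[OF delta_lim]) simp
    moreover have "\<forall>\<^sub>F \<epsilon> in at_right (0 :: real). \<epsilon> \<in> {0<..<1}"
      by (rule eventually_at_right_real) simp
    ultimately show ?thesis by eventually_elim auto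
  qed
  have bound: "discrepancy_mass \<alpha> \<epsilon> (u \<epsilon>) T \<le> ennreal (\<delta> \<epsilon> * (17 * E0 * T + 2))"
    and cont: "continuous_on (UNIV \<times> {0<..}) (\<lambda>(x, t). discrepancy \<alpha> \<epsilon> (\<lambda>y. u \<epsilon> y t) x)"
    if "\<epsilon> \<in> {0<..1}" "\<delta> \<epsilon> \<le> 1 / 16" "0 < T" for \<epsilon> T
    by (rule flow_discrepancy_bound[OF assms(1,2) _ _ assms(4)[OF that(1)] diff[OF that(1)] rng[OF that(1)]
          C[OF that(1)] E0[OF that(1)], where M = M and \<delta> = "\<delta> \<epsilon>"];
        use that in \<open>auto simp: M_def \<delta>_def E0_def\<close>)+
  have lim: "((\<lambda>\<epsilon>. discrepancy_mass \<alpha> \<epsilon> (u \<epsilon>) T) \<longlongrightarrow> 0) (at_right 0)" if "0 < T" for T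
  proof (rule tendsto_sandwich[OF _ _ tendsto_const])
    have "((\<lambda>\<epsilon>. \<delta> \<epsilon> * (17 * E0 * T + 2)) \<longlongrightarrow> 0 * (17 * E0 * T + 2)) (at_right 0)"
      by (intro tendsto_mult delta_lim tendsto_const)
    from tendsto_ennrealI[OF this]
    show "((\<lambda>\<epsilon>. ennreal (\<delta> \<epsilon> * (17 * E0 * T + 2))) \<longlongrightarrow> 0) (at_right 0)" by simp
    show "\<forall>\<^sub>F \<epsilon> in at_right 0. discrepancy_mass \<alpha> \<epsilon> (u \<epsilon>) T \<le> ennreal (\<delta> \<epsilon> * (17 * E0 * T + 2))"
      using small by eventually_elim (use bound that in auto)
  qed auto
  have xi: "emeasure (xi_plus \<alpha> \<epsilon> (u \<epsilon>)) (torus_cell \<times> {0<..T}) \<le> discrepancy_mass \<alpha> \<epsilon> (u \<epsilon>) (T + 1)"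
    if "\<epsilon> \<in> {0<..1}" "\<delta> \<epsilon> \<le> 1 / 16" for \<epsilon> T
    by (rule xi_plus_mass_le[OF cont[OF that zero_less_one]])
  have sets_xi: "sets (xi_plus \<alpha> \<epsilon> (u \<epsilon>)) = sets spacetime"
    and space_xi: "space (xi_plus \<alpha> \<epsilon> (u \<epsilon>)) = torus_cell \<times> {0<..}" for \<epsilon>
    by (simp_all add: xi_plus_def spacetime_def space_restrict_space)
  have "weak_star_tendsto (\<lambda>\<epsilon>. xi_plus \<alpha> \<epsilon> (u \<epsilon>)) (null_measure spacetime) (at_right 0)"
    unfolding weak_star_tendsto_def
  proof (intro conjI ballI)
    show "\<forall>\<^sub>F \<epsilon> in at_right 0. radon_spacetime (xi_plus \<alpha> \<epsilon> (u \<epsilon>))"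
      using small
    proof eventually_elim
      case (elim \<epsilon>)
      have "emeasure (xi_plus \<alpha> \<epsilon> (u \<epsilon>)) (torus_cell \<times> {0<..T}) < \<infinity>" for T
      proof -
        have "emeasure (xi_plus \<alpha> \<epsilon> (u \<epsilon>)) (torus_cell \<times> {0<..T})
            \<le> emeasure (xi_plus \<alpha> \<epsilon> (u \<epsilon>)) (torus_cell \<times> {0<..max T 0})"
        proof (rule emeasure_mono)
          show "torus_cell \<times> {0<..max T 0} \<in> sets (xi_plus \<alpha> \<epsilon> (u \<epsilon>))"
            unfolding sets_xi spacetime_def
            by (auto simp: sets_restrict_space_iff borel_prod[symmetric] intro!: pair_measureI)
        qed auto
        also have "\<dots> \<le> ennreal (\<delta> \<epsilon> * (17 * E0 * (max T 0 + 1) + 2))"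
          using elim by (intro order_trans[OF xi bound]) auto
        also have "\<dots> < \<infinity>" by simp
        finally show ?thesis .
      qed
      then show ?case by (simp add: radon_spacetime_def sets_xi)
    qed
    show "radon_spacetime (null_measure spacetime)" by (simp add: radon_spacetime_def)
    fix \<psi> :: "(real ^ 'd) \<times> real \<Rightarrow> real" assume psi: "\<psi> \<in> test_functions"
    then have psi_cont: "continuous_on (UNIV \<times> {0..}) \<psi>" by (simp add: test_functions_def)
    obtain T0 where T0: "\<And>x t. T0 \<le> t \<Longrightarrow> \<psi> (x, t) = 0" using psi by (auto simp: test_functions_def)
    define T where "T = max T0 1"
    have T: "0 < T" "\<And>x t. T \<le> t \<Longrightarrow> \<psi> (x, t) = 0" using T0 by (auto simp: T_def)
    obtain B where B: "0 \<le> B" "\<And>z. z \<in> cbox 0 1 \<times> {0..T} \<Longrightarrow> norm (\<psi> z) \<le> B"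
      by (rule continuous_on_compact_bound[of "cbox 0 1 \<times> {0..T}" \<psi>])
         (auto intro: compact_Times continuous_on_subset[OF psi_cont])
    have le: "ennreal (norm (\<integral>z. \<psi> z \<partial>xi_plus \<alpha> \<epsilon> (u \<epsilon>))) \<le> ennreal B * discrepancy_mass \<alpha> \<epsilon> (u \<epsilon>) (T + 1)"
      if eps: "\<epsilon> \<in> {0<..1}" "\<delta> \<epsilon> \<le> 1 / 16" for \<epsilon>
    proof (cases "integrable (xi_plus \<alpha> \<epsilon> (u \<epsilon>)) \<psi>")
      case True
      have A: "torus_cell \<times> {0<..T} \<in> sets (xi_plus \<alpha> \<epsilon> (u \<epsilon>))"
        unfolding sets_xi spacetime_def
        by (auto simp: sets_restrict_space_iff borel_prod[symmetric] intro!: pair_measureI)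
      have "ennreal (norm (\<integral>z. \<psi> z \<partial>xi_plus \<alpha> \<epsilon> (u \<epsilon>))) \<le> (\<integral>\<^sup>+z. ennreal (norm (\<psi> z)) \<partial>xi_plus \<alpha> \<epsilon> (u \<epsilon>))"
        by (rule integral_norm_bound_ennreal[OF True])
      also have "\<dots> \<le> (\<integral>\<^sup>+z. ennreal B * indicator (torus_cell \<times> {0<..T}) z \<partial>xi_plus \<alpha> \<epsilon> (u \<epsilon>))"
      proof (intro nn_integral_mono)
        fix z assume "z \<in> space (xi_plus \<alpha> \<epsilon> (u \<epsilon>))"
        then obtain x t where z: "z = (x, t)" "x \<in> torus_cell" "0 < t" by (auto simp: space_xi)
        show "ennreal (norm (\<psi> z)) \<le> ennreal B * indicator (torus_cell \<times> {0<..T}) z"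
        proof (cases "t \<le> T")
          case True
          then show ?thesis using z B(2)[of z] torus_cell_subset_cbox by (auto intro!: ennreal_leI)
        next
          case False
          then show ?thesis using z T by simp
        qed
      qed
      also have "\<dots> = ennreal B * emeasure (xi_plus \<alpha> \<epsilon> (u \<epsilon>)) (torus_cell \<times> {0<..T})"
        by (rule nn_integral_cmult_indicator[OF A])
      also have "\<dots> \<le> ennreal B * discrepancy_mass \<alpha> \<epsilon> (u \<epsilon>) (T + 1)"
        by (intro mult_left_mono xi eps) simp
      finally show ?thesis .
    qed (simp add: not_integrable_integral_eq)
    have up: "((\<lambda>\<epsilon>. ennreal B * discrepancy_mass \<alpha> \<epsilon> (u \<epsilon>) (T + 1)) \<longlongrightarrow> ennreal B * 0) (at_right 0)"
      by (intro ennreal_tendsto_cmult lim) (use T in auto)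
    have "((\<lambda>\<epsilon>. ennreal (norm (\<integral>z. \<psi> z \<partial>xi_plus \<alpha> \<epsilon> (u \<epsilon>)))) \<longlongrightarrow> 0) (at_right 0)"
    proof (rule tendsto_sandwich[OF _ _ tendsto_const])
      show "((\<lambda>\<epsilon>. ennreal B * discrepancy_mass \<alpha> \<epsilon> (u \<epsilon>) (T + 1)) \<longlongrightarrow> 0) (at_right 0)"
        using up by simp
      show "\<forall>\<^sub>F \<epsilon> in at_right 0. ennreal (norm (\<integral>z. \<psi> z \<partial>xi_plus \<alpha> \<epsilon> (u \<epsilon>)))
          \<le> ennreal B * discrepancy_mass \<alpha> \<epsilon> (u \<epsilon>) (T + 1)"
        using small by eventually_elim (use le in auto)
    qed auto
    then have "((\<lambda>\<epsilon>. ennreal (norm (\<integral>z. \<psi> z \<partial>xi_plus \<alpha> \<epsilon> (u \<epsilon>)))) \<longlongrightarrow> ennreal 0) (at_right 0)"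
      by simp
    then have "((\<lambda>\<epsilon>. norm (\<integral>z. \<psi> z \<partial>xi_plus \<alpha> \<epsilon> (u \<epsilon>))) \<longlongrightarrow> 0) (at_right 0)"
      by (subst (asm) tendsto_ennreal_iff) auto
    from tendsto_norm_zero_cancel[OF this] show "((\<lambda>\<epsilon>. \<integral>z. \<psi> z \<partial>xi_plus \<alpha> \<epsilon> (u \<epsilon>)) \<longlongrightarrow> (\<integral>z. \<psi> z \<partial>null_measure spacetime)) (at_right 0)"
      by simp
  qed
  then show ?thesis using lim unfolding discrepancy_mass_def by blast
qed

end
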